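(* For every partial Boolean function $f$ on $n$ bits, \[\widetilde{\mathrm{R}}(f)=\Theta\!\left(\frac{\mathrm{R}(f\circ\textsc{GapMaj}_n)}{n}\right),\] where the constants in the $\Theta$ are universal. Moreover, $\mathrm{R}(\textsc{GapMaj}_n)=\Theta(n)$.
   Context: $\textsc{GapMaj}_n$ is the partial Boolean function on $n$ bits with value $1$ on strings of Hamming weight $\lceil n/2+\sqrt n\rceil$, value $0$ on strings of Hamming weight $\lfloor n/2-\sqrt n\rfloor$, and undefined elsewhere. A partial Boolean function on $n$ bits is a map $f\colon\mathrm{Dom}(f)\to\{0,1\}$, $\mathrm{Dom}(f)\subseteq\{0,1\}^n$. $\mathrm{R}(f)$ is the error-$1/3$ randomized query complexity (minimum worst-case number of queries of a randomized decision tree that outputs $f(x)$ with probability $\ge 2/3$ on every $x\in\mathrm{Dom}(f)$). For $f$ on $n$ bits and $g$ on $m$ bits, $f\circ g$ is the partial function on $nm$ bits defined on $x^1\cdots x^n$ with $x^i\in\mathrm{Dom}(g)$ and $g(x^1)\cdots g(x^n)\in\mathrm{Dom}(f)$, with value $f(g(x^1)\cdots g(x^n))$. A noisy oracle for a bit $b$ accepts $\gamma\in[0,1]$ and returns a fresh independent bit equal to $b$ with probability $(1+\gamma)/2$, at cost $\gamma^2$. A noisy oracle decision tree on $n$ bits is a finite binary tree with internal nodes labeled $(i,\gamma)$, $i\in[n]$, $\gamma\in[0,1]$ (repetitions allowed), leaves labeled by outputs; on input $x$, at node $(i,\gamma)$ it calls the noisy oracle for $x_i$ with parameter $\gamma$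 and branches on the answer; the cost of a run is the sum of the $\gamma^2$ of visited nodes. A noisy oracle randomized algorithm $R$ is a finite-support distribution over such trees, $\mathrm{cost}(R,x)$ its expected cost on $x$; it computes $f$ to error $\epsilon$ if $\Pr[R(x)=f(x)]\ge 1-\epsilon$ for all $x\in\mathrm{Dom}(f)$. $\widetilde{\mathrm{R}}(f)$ is the infimum over $R$ computing $f$ to error $1/3$ of $\max_{x\in\mathrm{Dom}(f)}\mathrm{cost}(R,x)$.
   Formalization: The first claim is stated for n ≥ 4: for n = 1, 2, 3 the weights defining GapMaj_n lie outside {0,…,n}, so its domain is empty, R(f∘GapMaj_n) = 0, and the claim fails for nonconstant f; for n = 0 the quotient is undefined. *)

theory Defs
  imports "HOL-Probability.Probability" "HOL-Library.Landau_Symbols"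
begin

text \<open>
  A string in \<open>{0,1}\<^sup>n\<close> is a \<open>bool list\<close> of length \<open>n\<close>, with positions numbered from 0.
  A partial Boolean function is a map \<open>bool list \<rightharpoonup> bool\<close>; its domain is \<open>dom f\<close>.
\<close>

definition partial_bool_fun :: "nat \<Rightarrow> (bool list \<rightharpoonup> bool) \<Rightarrow> bool" where
  "partial_bool_fun n f \<longleftrightarrow> dom f \<subseteq> {x. length x = n}"

definition hamming_weight :: "bool list \<Rightarrow> nat" where
  "hamming_weight x = card {i. i < length x \<and> x ! i}"

text \<open>
  For \<open>0 < n < 4\<close> the two weights fall outside \<open>{0..n}\<close>, so the domain is empty;
  for \<open>n \<ge> 4\<close> both values are attained.
\<close>

definition GapMaj :: "nat \<Rightarrow> bool list \<rightharpoonup> bool" where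
  "GapMaj n x =
    (if length x \<noteq> n then None
     else if int (hamming_weight x) = \<lceil>real n / 2 + sqrt (real n)\<rceil> then Some True
     else if int (hamming_weight x) = \<lfloor>real n / 2 - sqrt (real n)\<rfloor> then Some False
     else None)"

definition block :: "nat \<Rightarrow> bool list \<Rightarrow> nat \<Rightarrow> bool list" where
  "block m x i = take m (drop (i * m) x)"

definition partial_compose ::
  "nat \<Rightarrow> nat \<Rightarrow> (bool list \<rightharpoonup> bool) \<Rightarrow> (bool list \<rightharpoonup> bool) \<Rightarrow> bool list \<rightharpoonup> bool" where
  "partial_compose n m f g x =
    (if length x = n * m \<and> (\<forall>i<n. block m x i \<in> dom g)
     then f (map (\<lambda>i. the (g (block m x i))) [0..<n])
     else None)"


text \<open>In \<open>Query i t0 t1\<close> the run continues with \<open>t1\<close> if the queried bit is 1, else with \<open>t0\<close>.\<close>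

datatype dtree = Leaf bool | Query nat dtree dtree

primrec dtree_on :: "nat \<Rightarrow> dtree \<Rightarrow> bool" where
  "dtree_on n (Leaf b) \<longleftrightarrow> True"
| "dtree_on n (Query i t0 t1) \<longleftrightarrow> i < n \<and> dtree_on n t0 \<and> dtree_on n t1"

primrec dtree_output :: "bool list \<Rightarrow> dtree \<Rightarrow> bool" where
  "dtree_output x (Leaf b) = b"
| "dtree_output x (Query i t0 t1) = (if x ! i then dtree_output x t1 else dtree_output x t0)"

primrec dtree_queries :: "bool list \<Rightarrow> dtree \<Rightarrow> nat" where
  "dtree_queries x (Leaf b) = 0"
| "dtree_queries x (Query i t0 t1) =
     1 + (if x ! i then dtree_queries x t1 else dtree_queries x t0)"

definition rand_dtree :: "nat \<Rightarrow> dtree pmf \<Rightarrow> bool" where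
  "rand_dtree n R \<longleftrightarrow> (\<forall>t \<in> set_pmf R. dtree_on n t)"

definition rand_computes :: "dtree pmf \<Rightarrow> (bool list \<rightharpoonup> bool) \<Rightarrow> real \<Rightarrow> bool" where
  "rand_computes R f \<epsilon> \<longleftrightarrow>
    (\<forall>x \<in> dom f. measure_pmf.prob R {t. f x = Some (dtree_output x t)} \<ge> 1 - \<epsilon>)"

definition rand_query_complexity :: "nat \<Rightarrow> (bool list \<rightharpoonup> bool) \<Rightarrow> nat" where
  "rand_query_complexity n f =
    (LEAST d. \<exists>R. rand_dtree n R \<and> rand_computes R f (1/3) \<and>
       (\<forall>t \<in> set_pmf R. \<forall>x. length x = n \<longrightarrow> dtree_queries x t \<le> d))"


definition noisy_oracle :: "bool \<Rightarrow> real \<Rightarrow> bool pmf" where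
  "noisy_oracle b \<gamma> = map_pmf (\<lambda>correct. if correct then b else \<not> b) (bernoulli_pmf ((1 + \<gamma>) / 2))"

datatype ntree = NLeaf bool | NQuery nat real ntree ntree

primrec ntree_on :: "nat \<Rightarrow> ntree \<Rightarrow> bool" where
  "ntree_on n (NLeaf b) \<longleftrightarrow> True"
| "ntree_on n (NQuery i \<gamma> t0 t1) \<longleftrightarrow> i < n \<and> 0 \<le> \<gamma> \<and> \<gamma> \<le> 1 \<and> ntree_on n t0 \<and> ntree_on n t1"

text \<open>Joint distribution of the output and the cost of a run.\<close>

primrec ntree_run :: "bool list \<Rightarrow> ntree \<Rightarrow> (bool \<times> real) pmf" where
  "ntree_run x (NLeaf b) = return_pmf (b, 0)"
| "ntree_run x (NQuery i \<gamma> t0 t1) =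
     bind_pmf (noisy_oracle (x ! i) \<gamma>)
       (\<lambda>a. map_pmf (\<lambda>(b, c). (b, \<gamma>\<^sup>2 + c)) (if a then ntree_run x t1 else ntree_run x t0))"

definition noisy_alg :: "nat \<Rightarrow> ntree pmf \<Rightarrow> bool" where
  "noisy_alg n R \<longleftrightarrow> finite (set_pmf R) \<and> (\<forall>t \<in> set_pmf R. ntree_on n t)"

definition noisy_run :: "ntree pmf \<Rightarrow> bool list \<Rightarrow> (bool \<times> real) pmf" where
  "noisy_run R x = bind_pmf R (ntree_run x)"

definition noisy_cost :: "ntree pmf \<Rightarrow> bool list \<Rightarrow> real" where
  "noisy_cost R x = measure_pmf.expectation (noisy_run R x) snd"

definition noisy_computes :: "ntree pmf \<Rightarrow> (bool list \<rightharpoonup> bool) \<Rightarrow> real \<Rightarrow> bool" where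
  "noisy_computes R f \<epsilon> \<longleftrightarrow>
    (\<forall>x \<in> dom f. measure_pmf.prob (noisy_run R x) {r. f x = Some (fst r)} \<ge> 1 - \<epsilon>)"

text \<open>Costs are nonnegative, so inserting 0 only fixes the maximum over an empty domain to be 0.\<close>

definition noisy_query_complexity :: "nat \<Rightarrow> (bool list \<rightharpoonup> bool) \<Rightarrow> real" where
  "noisy_query_complexity n f =
    Inf {Max (insert 0 (noisy_cost R ` dom f)) | R. noisy_alg n R \<and> noisy_computes R f (1/3)}"

end

theory Submission
  imports Defs "HOL-Combinatorics.Transposition"
begin

text \<open>
  A uniformly random string with the weight prescribed by \<open>GapMaj n\<close> reveals its value, bit by bit,
  like a noisy oracle with parameter of order \<open>1 / sqrt n\<close>, that is, at cost of order \<open>1 / n\<close> per bit.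

  Upper bound on the noisy complexity: run the decision tree for the composed function on such random
  blocks. While less than an eighth of a block has been read, the next bit is produced by one noisy
  query of cost \<open>O(1 / n)\<close>; after that the input bit itself is queried with parameter 1.

  Lower bound: put \<open>g = 1 / sqrt n\<close>. A query with a parameter above \<open>g\<close> is simulated by a stopped
  random walk of queries with parameter \<open>g\<close>, or by parameter 1 if it is bounded below by a constant.
  Queries with parameters far below \<open>g\<close> move the posterior mean of the bit by small steps; a single
  query with parameter \<open>g\<close> is used as the endpoint of this martingale, conditioned on which the small
  steps no longer depend on the bit. This costs at most one extra query with parameter \<open>g\<close> per bit,
  an additive cost of \<open>n g\<^sup>2 = 1\<close>, and by a Hellinger distance argument a nonconstant function has
  noisy complexity at least \<open>1 / 18\<close>. Queries with parameter \<open>g\<close> and 1 become one query to a random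
  position of a block and a reading of the whole block; truncation and majority votes then give a
  worst-case bound.
\<close>

text \<open>Every simulation reproduces acceptance probabilities exactly, so no error accumulates
  and only expected costs are tracked; error enters once, in passing to a worst-case bound. Coins
  are nodes of the trees, so that acceptance and cost obey linear recursions and \<open>pmf\<close>
  is needed only at the borders. The obstacle to the lower bound is a parameter \<gamma> far below
  \<open>g\<close>. Mixing a query with a fair coin realizes it at a cost linear in \<gamma>,
  whereas the budget is quadratic; replacing such queries one by one is too expensive, so all small
  queries to a bit have to be treated together. The obstacle to the upper bound is sampling without
  replacement: late in a block the unseen positions become too informative for cheap noise. The
  price of learning the bit is therefore spread over the positions already seen. The linear bound
  for gap majority is a by-product: composed with the function returning the first bit, it is no
  harder than on a single block, and that function is nonconstant.\<close>

section \<open>Decision trees with coin flips\<close>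

text \<open>
  \<open>racc x t\<close> is the probability that \<open>t\<close> accepts \<open>x\<close>, and \<open>rcost w x t\<close> the expected total weight
  of the queries made on \<open>x\<close>, where a query to \<open>i\<close> with parameter \<open>\<gamma>\<close> weighs \<open>w i \<gamma>\<close>.
\<close>

datatype rtree = RLeaf bool | RCoin real rtree rtree | RQuery nat real rtree rtree

definition qprob :: "bool \<Rightarrow> real \<Rightarrow> real" where
  "qprob b \<gamma> = (1 + (if b then \<gamma> else - \<gamma>)) / 2"

primrec racc :: "(nat \<Rightarrow> bool) \<Rightarrow> rtree \<Rightarrow> real" where
  "racc x (RLeaf b) = of_bool b"
| "racc x (RCoin p t0 t1) = p * racc x t1 + (1 - p) * racc x t0"
| "racc x (RQuery i \<gamma> t0 t1) = qprob (x i) \<gamma> * racc x t1 + (1 - qprob (x i) \<gamma>) * racc x t0"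

primrec rcost :: "(nat \<Rightarrow> real \<Rightarrow> real) \<Rightarrow> (nat \<Rightarrow> bool) \<Rightarrow> rtree \<Rightarrow> real" where
  "rcost w x (RLeaf b) = 0"
| "rcost w x (RCoin p t0 t1) = p * rcost w x t1 + (1 - p) * rcost w x t0"
| "rcost w x (RQuery i \<gamma> t0 t1) =
     w i \<gamma> + (qprob (x i) \<gamma> * rcost w x t1 + (1 - qprob (x i) \<gamma>) * rcost w x t0)"

text \<open>The predicate \<open>P\<close> restricts the pairs of position and parameter, so that
  one type of tree covers noisy trees (\<open>i < n\<close>), ordinary decision trees
  (\<open>\<gamma> = 1\<close>) and the stages in between.\<close>

primrec rok :: "(nat \<Rightarrow> real \<Rightarrow> bool) \<Rightarrow> rtree \<Rightarrow> bool" where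
  "rok P (RLeaf b) \<longleftrightarrow> True"
| "rok P (RCoin p t0 t1) \<longleftrightarrow> 0 \<le> p \<and> p \<le> 1 \<and> rok P t0 \<and> rok P t1"
| "rok P (RQuery i \<gamma> t0 t1) \<longleftrightarrow> 0 \<le> \<gamma> \<and> \<gamma> \<le> 1 \<and> P i \<gamma> \<and> rok P t0 \<and> rok P t1"

primrec rdepth :: "rtree \<Rightarrow> nat" where
  "rdepth (RLeaf b) = 0"
| "rdepth (RCoin p t0 t1) = max (rdepth t0) (rdepth t1)"
| "rdepth (RQuery i \<gamma> t0 t1) = Suc (max (rdepth t0) (rdepth t1))"

text \<open>Sequential composition: the output of \<open>t\<close> plays the part of a query answer
  with continuations \<open>u0\<close> and \<open>u1\<close>. Query gadgets and majority votes are
  both built this way.\<close>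

primrec rsubst :: "rtree \<Rightarrow> rtree \<Rightarrow> rtree \<Rightarrow> rtree" where
  "rsubst (RLeaf b) u0 u1 = (if b then u1 else u0)"
| "rsubst (RCoin p t0 t1) u0 u1 = RCoin p (rsubst t0 u0 u1) (rsubst t1 u0 u1)"
| "rsubst (RQuery i \<gamma> t0 t1) u0 u1 = RQuery i \<gamma> (rsubst t0 u0 u1) (rsubst t1 u0 u1)"

lemma convex_comb_mono:
  fixes p :: real
  assumes "0 \<le> p" "p \<le> 1" "a \<le> a'" "b \<le> b'"
  shows "p * a + (1 - p) * b \<le> p * a' + (1 - p) * b'"
  using assms by (intro add_mono mult_left_mono) auto

lemma qprob_bounds: "0 \<le> \<gamma> \<Longrightarrow> \<gamma> \<le> 1 \<Longrightarrow> 0 \<le> qprob b \<gamma> \<and> qprob b \<gamma> \<le> 1"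
  by (auto simp: qprob_def)

lemma qprob_1 [simp]: "qprob b 1 = of_bool b"
  by (simp add: qprob_def)

lemma racc_bounds: "rok P t \<Longrightarrow> 0 \<le> racc x t \<and> racc x t \<le> 1"
proof (induction t)
  case (RCoin p t0 t1)
  then show ?case by (auto intro!: add_nonneg_nonneg convex_bound_le)
next
  case (RQuery i \<gamma> t0 t1)
  then show ?case using qprob_bounds[of \<gamma> "x i"]
    by (auto intro!: add_nonneg_nonneg convex_bound_le)
qed auto

lemma rcost_nonneg:
  "rok P t \<Longrightarrow> (\<And>i \<gamma>. P i \<gamma> \<Longrightarrow> 0 \<le> w i \<gamma>) \<Longrightarrow> 0 \<le> rcost w x t"
proof (induction t)
  case (RQuery i \<gamma> t0 t1)
  then show ?case using qprob_bounds[of \<gamma> "x i"] by (auto intro!: add_nonneg_nonneg)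
qed auto

lemma rok_mono: "rok P t \<Longrightarrow> (\<And>i \<gamma>. 0 \<le> \<gamma> \<Longrightarrow> \<gamma> \<le> 1 \<Longrightarrow> P i \<gamma> \<Longrightarrow> Q i \<gamma>) \<Longrightarrow> rok Q t"
  by (induction t) auto

lemma racc_cong: "rok (\<lambda>i \<gamma>. i < n \<and> P i \<gamma>) t \<Longrightarrow> (\<And>i. i < n \<Longrightarrow> x i = y i) \<Longrightarrow> racc x t = racc y t"
  by (induction t) auto

lemma rcost_cong:
  "rok (\<lambda>i \<gamma>. i < n \<and> P i \<gamma>) t \<Longrightarrow> (\<And>i. i < n \<Longrightarrow> x i = y i) \<Longrightarrow> rcost w x t = rcost w y t"
  by (induction t) auto

lemma rok_rsubst: "rok P t \<Longrightarrow> rok P u0 \<Longrightarrow> rok P u1 \<Longrightarrow> rok P (rsubst t u0 u1)"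
  by (induction t) auto

lemma racc_rsubst: "racc x (rsubst t u0 u1) = racc x t * racc x u1 + (1 - racc x t) * racc x u0"
proof (induction t)
  case (RCoin p t0 t1)
  show ?case by (simp only: rsubst.simps racc.simps RCoin.IH) algebra
next
  case (RQuery i \<gamma> t0 t1)
  show ?case by (simp only: rsubst.simps racc.simps RQuery.IH) algebra
qed simp

lemma rcost_rsubst:
  "rcost w x (rsubst t u0 u1) = rcost w x t + (racc x t * rcost w x u1 + (1 - racc x t) * rcost w x u0)"
proof (induction t)
  case (RCoin p t0 t1)
  show ?case by (simp only: rsubst.simps rcost.simps racc.simps RCoin.IH) algebra
next
  case (RQuery i \<gamma> t0 t1)
  show ?case by (simp only: rsubst.simps rcost.simps racc.simps RQuery.IH) algebra
qed simp

lemma rdepth_rsubst: "rdepth (rsubst t u0 u1) \<le> rdepth t + max (rdepth u0) (rdepth u1)"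
  by (induction t) auto

text \<open>The weights stay unnormalized and both sides carry the factor \<open>sum v S\<close>, so
  that total weight 0 needs no exception: any tree of the family will then do.\<close>

lemma rtree_mixture:
  fixes F :: "'a \<Rightarrow> rtree" and v :: "'a \<Rightarrow> real"
  assumes "finite S" "S \<noteq> {}" "\<And>s. s \<in> S \<Longrightarrow> 0 \<le> v s" "\<And>s. s \<in> S \<Longrightarrow> rok P (F s)"
  shows "\<exists>T. rok P T \<and> (\<forall>x. sum v S * racc x T = (\<Sum>s\<in>S. v s * racc x (F s))) \<and>
    (\<forall>w x. sum v S * rcost w x T = (\<Sum>s\<in>S. v s * rcost w x (F s)))"
  using assms
proof (induction rule: finite_ne_induct)
  case (singleton s)
  then show ?case by auto
next
  case (insert s S)
  then obtain T where T: "rok P T" "\<And>x. sum v S * racc x T = (\<Sum>s\<in>S. v s * racc x (F s))"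
    "\<And>w x. sum v S * rcost w x T = (\<Sum>s\<in>S. v s * rcost w x (F s))"
    by auto
  have n: "0 \<le> v s" "0 \<le> sum v S" using insert by (auto intro: sum_nonneg)
  show ?case
  proof (cases "v s + sum v S = 0")
    case True
    then have "v s = 0" "sum v S = 0" using n by auto
    moreover from this have "\<forall>s\<in>S. v s = 0"
      using insert by (subst (asm) sum_nonneg_eq_0_iff) auto
    ultimately show ?thesis using insert by (intro exI[of _ "F s"]) auto
  next
    case False
    then have pos: "v s + sum v S > 0" using n by auto
    have e: "(v s + sum v S) * (v s / (v s + sum v S) * a + (1 - v s / (v s + sum v S)) * b) =
        v s * a + sum v S * b" for a b :: real
    proof -
      have "(v s + sum v S) * (v s / (v s + sum v S)) = v s"
        "(v s + sum v S) * (1 - v s / (v s + sum v S)) = sum v S"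
        using pos by (simp_all add: right_diff_distrib)
      then show ?thesis by (metis distrib_left mult.assoc)
    qed
    show ?thesis
    proof (intro exI[of _ "RCoin (v s / (v s + sum v S)) T (F s)"] conjI allI)
      show "rok P (RCoin (v s / (v s + sum v S)) T (F s))" using insert T n pos by simp
    qed (simp_all only: racc.simps rcost.simps sum.insert[OF insert.hyps(1,3)] e T(2,3))
  qed
qed

section \<open>Translation between trees with coins and the two query models\<close>

primrec rtree_of_dtree :: "dtree \<Rightarrow> rtree" where
  "rtree_of_dtree (Leaf b) = RLeaf b"
| "rtree_of_dtree (Query i t0 t1) = RQuery i 1 (rtree_of_dtree t0) (rtree_of_dtree t1)"

primrec rtree_of_ntree :: "ntree \<Rightarrow> rtree" where
  "rtree_of_ntree (NLeaf b) = RLeaf b"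
| "rtree_of_ntree (NQuery i \<gamma> t0 t1) = RQuery i \<gamma> (rtree_of_ntree t0) (rtree_of_ntree t1)"

lemma racc_dtree: "racc ((!) x) (rtree_of_dtree t) = of_bool (dtree_output x t)"
  by (induction t) auto

lemma rcost_dtree: "rcost (\<lambda>_ _. 1) ((!) x) (rtree_of_dtree t) = real (dtree_queries x t)"
  by (induction t) auto

lemma rok_dtree: "dtree_on n t \<Longrightarrow> rok (\<lambda>i \<gamma>. i < n \<and> \<gamma> = 1) (rtree_of_dtree t)"
  by (induction t) auto

lemma rok_ntree: "ntree_on n t \<Longrightarrow> rok (\<lambda>i \<gamma>. i < n) (rtree_of_ntree t)"
  by (induction t) auto

lemma finite_set_ntree_run: "finite (set_pmf (ntree_run x t))"
  by (induction t) auto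

lemma prob_eq_expectation: "measure_pmf.prob R {t. Q t} = measure_pmf.expectation R (\<lambda>t. of_bool (Q t))"
proof -
  have "measure_pmf.expectation R (\<lambda>t. of_bool (Q t)) = measure_pmf.expectation R (indicat_real {t. Q t})"
    by (rule Bochner_Integration.integral_cong) (auto simp: indicator_def)
  then show ?thesis by simp
qed

lemma expectation_finite_bind:
  fixes h :: "'b \<Rightarrow> real"
  assumes "finite (set_pmf p)" "\<And>a. a \<in> set_pmf p \<Longrightarrow> finite (set_pmf (f a))"
  shows "measure_pmf.expectation (bind_pmf p f) h =
    measure_pmf.expectation p (\<lambda>a. measure_pmf.expectation (f a) h)"
  using assms
  by (subst pmf_expectation_bind[where A = "set_pmf p"])
    (auto simp: integral_measure_pmf[where A = "set_pmf p"])

lemma expectation_noisy_oracle: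
  fixes h :: "bool \<Rightarrow> real"
  assumes "0 \<le> \<gamma>" "\<gamma> \<le> 1"
  shows "measure_pmf.expectation (noisy_oracle b \<gamma>) h = qprob b \<gamma> * h True + (1 - qprob b \<gamma>) * h False"
  using assms unfolding noisy_oracle_def
  by (cases b) (auto simp: qprob_def field_simps)

lemma expectation_ntree_run:
  assumes "ntree_on n t"
  shows "measure_pmf.expectation (ntree_run x t) (\<lambda>r. of_bool (fst r)) = racc ((!) x) (rtree_of_ntree t)"
    and "measure_pmf.expectation (ntree_run x t) snd = rcost (\<lambda>_ \<gamma>. \<gamma>\<^sup>2) ((!) x) (rtree_of_ntree t)"
proof -
  have A: "measure_pmf.expectation (ntree_run x (NQuery i \<gamma> t0 t1)) h =
      qprob (x ! i) \<gamma> * measure_pmf.expectation (ntree_run x t1) (\<lambda>r. h (fst r, \<gamma>\<^sup>2 + snd r)) +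
      (1 - qprob (x ! i) \<gamma>) * measure_pmf.expectation (ntree_run x t0) (\<lambda>r. h (fst r, \<gamma>\<^sup>2 + snd r))"
    if "0 \<le> \<gamma>" "\<gamma> \<le> 1" for i \<gamma> t0 t1 and h :: "bool \<times> real \<Rightarrow> real"
    using that by (simp add: expectation_finite_bind finite_set_ntree_run expectation_noisy_oracle
        noisy_oracle_def[THEN arg_cong[where f = set_pmf]] case_prod_beta)
  show "measure_pmf.expectation (ntree_run x t) (\<lambda>r. of_bool (fst r)) = racc ((!) x) (rtree_of_ntree t)"
    using assms by (induction t) (auto simp: A case_prod_beta simp del: ntree_run.simps(2))
  have "integrable (measure_pmf (ntree_run x t)) snd" for t
    by (rule integrable_measure_pmf_finite[OF finite_set_ntree_run])
  then have B: "measure_pmf.expectation (ntree_run x t) (\<lambda>r. c + snd r) =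
      c + measure_pmf.expectation (ntree_run x t) snd" for c t
    by simp
  show "measure_pmf.expectation (ntree_run x t) snd = rcost (\<lambda>_ \<gamma>. \<gamma>\<^sup>2) ((!) x) (rtree_of_ntree t)"
    using assms
  proof (induction t)
    case (NQuery i \<gamma> t0 t1)
    have mix: "q * (c + e1) + (1 - q) * (c + e0) = c + (q * e1 + (1 - q) * e0)" for q c e1 e0 :: real
      by algebra
    show ?case using NQuery by (simp add: A B mix del: ntree_run.simps(2))
  qed simp
qed

lemma noisy_alg_as_mixture:
  assumes "noisy_alg n R"
  shows "measure_pmf.prob (noisy_run R x) {r. fst r} =
      (\<Sum>t\<in>set_pmf R. pmf R t * racc ((!) x) (rtree_of_ntree t))"
    and "noisy_cost R x = (\<Sum>t\<in>set_pmf R. pmf R t * rcost (\<lambda>_ \<gamma>. \<gamma>\<^sup>2) ((!) x) (rtree_of_ntree t))"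
proof -
  have fin: "finite (set_pmf R)" and on: "\<And>t. t \<in> set_pmf R \<Longrightarrow> ntree_on n t"
    using assms by (auto simp: noisy_alg_def)
  show "measure_pmf.prob (noisy_run R x) {r. fst r} =
      (\<Sum>t\<in>set_pmf R. pmf R t * racc ((!) x) (rtree_of_ntree t))"
    unfolding prob_eq_expectation noisy_run_def
    by (subst expectation_finite_bind)
      (auto simp: fin finite_set_ntree_run integral_measure_pmf[OF fin] expectation_ntree_run[OF on]
          intro!: sum.cong)
  show "noisy_cost R x = (\<Sum>t\<in>set_pmf R. pmf R t * rcost (\<lambda>_ \<gamma>. \<gamma>\<^sup>2) ((!) x) (rtree_of_ntree t))"
    unfolding noisy_cost_def noisy_run_def
    by (subst expectation_finite_bind)
      (auto simp: fin finite_set_ntree_run integral_measure_pmf[OF fin] expectation_ntree_run[OF on]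
          intro!: sum.cong)
qed

lemma rtree_of_noisy_alg:
  assumes "noisy_alg n R"
  shows "\<exists>T. rok (\<lambda>i \<gamma>. i < n) T \<and>
    (\<forall>x. measure_pmf.prob (noisy_run R x) {r. fst r} = racc ((!) x) T \<and>
         noisy_cost R x = rcost (\<lambda>_ \<gamma>. \<gamma>\<^sup>2) ((!) x) T)"
proof -
  have fin: "finite (set_pmf R)" and on: "\<And>t. t \<in> set_pmf R \<Longrightarrow> ntree_on n t"
    using assms by (auto simp: noisy_alg_def)
  have "sum (pmf R) (set_pmf R) = 1" using fin by (simp add: sum_pmf_eq_1)
  with rtree_mixture[OF fin set_pmf_not_empty, of "pmf R" "\<lambda>i \<gamma>. i < n" rtree_of_ntree]
  show ?thesis using noisy_alg_as_mixture[OF assms] rok_ntree[OF on] by auto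
qed

text \<open>All coins are flipped before the run. The subtrees of a query are drawn independently,
  but a run enters only one of them, so only their marginal distributions matter.\<close>

primrec ntree_pmf :: "rtree \<Rightarrow> ntree pmf" where
  "ntree_pmf (RLeaf b) = return_pmf (NLeaf b)"
| "ntree_pmf (RCoin p t0 t1) =
     bind_pmf (bernoulli_pmf p) (\<lambda>c. if c then ntree_pmf t1 else ntree_pmf t0)"
| "ntree_pmf (RQuery i \<gamma> t0 t1) =
     bind_pmf (ntree_pmf t0) (\<lambda>a. bind_pmf (ntree_pmf t1) (\<lambda>b. return_pmf (NQuery i \<gamma> a b)))"

lemma finite_set_ntree_pmf: "finite (set_pmf (ntree_pmf T))"
  by (induction T) auto

lemma ntree_on_ntree_pmf: "rok (\<lambda>i \<gamma>. i < n) T \<Longrightarrow> t \<in> set_pmf (ntree_pmf T) \<Longrightarrow> ntree_on n t"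
  by (induction T arbitrary: t) (auto split: if_splits)

lemma expectation_linear_pair:
  fixes p :: "'a pmf" and q :: "'b pmf" and f g :: "_ \<Rightarrow> real"
  assumes "finite (set_pmf p)" "finite (set_pmf q)"
  shows "measure_pmf.expectation p (\<lambda>a. measure_pmf.expectation q (\<lambda>b. c + (u * f b + v * g a))) =
    c + (u * measure_pmf.expectation q f + v * measure_pmf.expectation p g)"
  by (simp add: integrable_measure_pmf_finite[OF assms(1)] integrable_measure_pmf_finite[OF assms(2)])

lemma noisy_alg_of_rtree:
  assumes "rok (\<lambda>i \<gamma>. i < n) T"
  shows "\<exists>R. noisy_alg n R \<and>
    (\<forall>x. measure_pmf.prob (noisy_run R x) {r. fst r} = racc ((!) x) T \<and>
         noisy_cost R x = rcost (\<lambda>_ \<gamma>. \<gamma>\<^sup>2) ((!) x) T)"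
proof -
  let ?R = "ntree_pmf T"
  have alg: "noisy_alg n ?R"
    using ntree_on_ntree_pmf[OF assms] by (auto simp: noisy_alg_def finite_set_ntree_pmf)
  have "measure_pmf.expectation (ntree_pmf T) (\<lambda>t. racc x (rtree_of_ntree t)) = racc x T" for x
    using assms
  proof (induction T)
    case (RQuery i \<gamma> t0 t1)
    then show ?case
      using expectation_linear_pair[where c = 0 and f = "\<lambda>t. racc x (rtree_of_ntree t)"
          and g = "\<lambda>t. racc x (rtree_of_ntree t)" and p = "ntree_pmf t0" and q = "ntree_pmf t1"]
      by (simp add: expectation_finite_bind finite_set_ntree_pmf)
  qed (auto simp: expectation_finite_bind finite_set_ntree_pmf)
  moreover have "measure_pmf.expectation (ntree_pmf T) (\<lambda>t. rcost w x (rtree_of_ntree t)) = rcost w x T"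
    for w x
    using assms
  proof (induction T)
    case (RQuery i \<gamma> t0 t1)
    then show ?case
      using expectation_linear_pair[where f = "\<lambda>t. rcost w x (rtree_of_ntree t)"
          and g = "\<lambda>t. rcost w x (rtree_of_ntree t)" and p = "ntree_pmf t0" and q = "ntree_pmf t1"]
      by (simp add: expectation_finite_bind finite_set_ntree_pmf)
  qed (auto simp: expectation_finite_bind finite_set_ntree_pmf)
  ultimately show ?thesis
    using alg by (intro exI[of _ ?R])
      (simp add: noisy_alg_as_mixture integral_measure_pmf[OF finite_set_ntree_pmf])
qed

primrec dtree_pmf :: "rtree \<Rightarrow> dtree pmf" where
  "dtree_pmf (RLeaf b) = return_pmf (Leaf b)"
| "dtree_pmf (RCoin p t0 t1) =
     bind_pmf (bernoulli_pmf p) (\<lambda>c. if c then dtree_pmf t1 else dtree_pmf t0)"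
| "dtree_pmf (RQuery i \<gamma> t0 t1) =
     bind_pmf (dtree_pmf t0) (\<lambda>a. bind_pmf (dtree_pmf t1) (\<lambda>b. return_pmf (Query i a b)))"

lemma finite_set_dtree_pmf: "finite (set_pmf (dtree_pmf T))"
  by (induction T) auto

lemma dtree_on_dtree_pmf:
  "rok (\<lambda>i \<gamma>. i < n \<and> P i \<gamma>) T \<Longrightarrow> t \<in> set_pmf (dtree_pmf T) \<Longrightarrow> dtree_on n t"
  by (induction T arbitrary: t) (auto split: if_splits)

lemma dtree_queries_dtree_pmf: "t \<in> set_pmf (dtree_pmf T) \<Longrightarrow> dtree_queries x t \<le> rdepth T"
proof (induction T arbitrary: t)
  case (RCoin p t0 t1)
  then show ?case by (fastforce split: if_splits simp: le_max_iff_disj)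
next
  case (RQuery i \<gamma> t0 t1)
  then show ?case by (fastforce simp: le_max_iff_disj)
qed auto

lemma rand_dtree_of_rtree:
  assumes "rok (\<lambda>i \<gamma>. i < n \<and> \<gamma> = 1) T"
  shows "\<exists>R. rand_dtree n R \<and> (\<forall>t\<in>set_pmf R. \<forall>x. dtree_queries x t \<le> rdepth T) \<and>
    (\<forall>x. measure_pmf.prob R {t. dtree_output x t} = racc ((!) x) T)"
proof -
  have "measure_pmf.expectation (dtree_pmf T) (\<lambda>t. racc x (rtree_of_dtree t)) = racc x T" for x
    using assms
  proof (induction T)
    case (RQuery i \<gamma> t0 t1)
    then show ?case
      using expectation_linear_pair[where c = 0 and f = "\<lambda>t. racc x (rtree_of_dtree t)"
          and g = "\<lambda>t. racc x (rtree_of_dtree t)" and p = "dtree_pmf t0" and q = "dtree_pmf t1"]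
      by (simp add: expectation_finite_bind finite_set_dtree_pmf del: Groups.mult_ac)
  qed (auto simp: expectation_finite_bind finite_set_dtree_pmf)
  then show ?thesis
    using dtree_on_dtree_pmf[OF assms] dtree_queries_dtree_pmf
    by (intro exI[of _ "dtree_pmf T"])
      (auto simp: rand_dtree_def prob_eq_expectation racc_dtree[symmetric])
qed

text \<open>
  The support of a randomized decision tree may be infinite, since a tree may contain arbitrary
  unreachable branches. Grouping the trees by the set of accepted inputs leaves finitely many.
\<close>

lemma rtree_of_rand_dtree:
  assumes "rand_dtree n R" and depth: "\<And>t x. t \<in> set_pmf R \<Longrightarrow> length x = n \<Longrightarrow> dtree_queries x t \<le> d"
  shows "\<exists>T. rok (\<lambda>i \<gamma>. i < n \<and> \<gamma> = 1) T \<and>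
    (\<forall>x. length x = n \<longrightarrow> measure_pmf.prob R {t. dtree_output x t} = racc ((!) x) T \<and>
         rcost (\<lambda>_ _. 1) ((!) x) T \<le> real d)"
proof -
  define beh where "beh t = {x. length x = n \<and> dtree_output x t}" for t
  define R' where "R' = map_pmf beh R"
  have "finite {x :: bool list. length x = n}"
    using finite_lists_length_eq[of "UNIV :: bool set" n] by simp
  then have "finite (Pow {x :: bool list. length x = n})" by simp
  then have fin: "finite (set_pmf R')"
    by (rule finite_subset[rotated]) (auto simp: R'_def beh_def)
  have "\<exists>t. t \<in> set_pmf R \<and> beh t = A" if "A \<in> set_pmf R'" for A
    using that by (auto simp: R'_def)
  then obtain F where F: "\<And>A. A \<in> set_pmf R' \<Longrightarrow> F A \<in> set_pmf R \<and> beh (F A) = A"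
    by metis
  have s1: "sum (pmf R') (set_pmf R') = 1" using fin by (simp add: sum_pmf_eq_1)
  have "\<exists>T. rok (\<lambda>i \<gamma>. i < n \<and> \<gamma> = 1) T \<and>
    (\<forall>x. sum (pmf R') (set_pmf R') * racc x T = (\<Sum>A\<in>set_pmf R'. pmf R' A * racc x (rtree_of_dtree (F A)))) \<and>
    (\<forall>w x. sum (pmf R') (set_pmf R') * rcost w x T = (\<Sum>A\<in>set_pmf R'. pmf R' A * rcost w x (rtree_of_dtree (F A))))"
    using F assms(1) by (intro rtree_mixture fin set_pmf_not_empty) (auto simp: rand_dtree_def rok_dtree)
  then obtain T where T: "rok (\<lambda>i \<gamma>. i < n \<and> \<gamma> = 1) T"
    "\<And>x. racc x T = (\<Sum>A\<in>set_pmf R'. pmf R' A * racc x (rtree_of_dtree (F A)))"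
    "\<And>w x. rcost w x T = (\<Sum>A\<in>set_pmf R'. pmf R' A * rcost w x (rtree_of_dtree (F A)))"
    unfolding s1 by auto
  show ?thesis
  proof (intro exI[of _ T] conjI allI impI T(1))
    fix x :: "bool list" assume x: "length x = n"
    have "measure_pmf.prob R {t. dtree_output x t} = measure_pmf.prob R' {A. x \<in> A}"
      unfolding R'_def using x by (simp add: beh_def vimage_def)
    also have "\<dots> = (\<Sum>A\<in>set_pmf R'. pmf R' A * of_bool (x \<in> A))"
      by (simp add: prob_eq_expectation integral_measure_pmf[OF fin] del: sum_mult_of_bool_eq)
    also have "\<dots> = (\<Sum>A\<in>set_pmf R'. pmf R' A * racc ((!) x) (rtree_of_dtree (F A)))"
    proof (rule sum.cong[OF refl])
      fix A assume "A \<in> set_pmf R'"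
      then have "x \<in> A \<longleftrightarrow> dtree_output x (F A)" using F x by (auto simp: beh_def)
      then show "pmf R' A * of_bool (x \<in> A) = pmf R' A * racc ((!) x) (rtree_of_dtree (F A))"
        by (simp add: racc_dtree)
    qed
    finally show "measure_pmf.prob R {t. dtree_output x t} = racc ((!) x) T" by (simp add: T(2))
    have "rcost (\<lambda>_ _. 1) ((!) x) T \<le> (\<Sum>A\<in>set_pmf R'. pmf R' A * real d)"
      unfolding T(3) using F depth x by (intro sum_mono mult_left_mono) (auto simp: rcost_dtree)
    also have "\<dots> = real d" using s1 by (simp add: sum_distrib_right[symmetric])
    finally show "rcost (\<lambda>_ _. 1) ((!) x) T \<le> real d" .
  qed
qed

section \<open>Distinguishing two inputs, truncation and amplification\<close>

text \<open>Cauchy-Schwarz in the plane, for the vectors of square roots.\<close>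

lemma sqrt_mult_add_le:
  fixes a b c d :: real
  assumes "0 \<le> a" "0 \<le> b" "0 \<le> c" "0 \<le> d"
  shows "sqrt (a * c) + sqrt (b * d) \<le> sqrt ((a + b) * (c + d))"
proof (rule real_le_rsqrt)
  have "2 * (sqrt (a * d) * sqrt (b * c)) \<le> a * d + b * c"
    using sum_squares_bound[of "sqrt (a * d)" "sqrt (b * c)"] assms by (simp add: power2_eq_square)
  moreover have "sqrt (a * d) * sqrt (b * c) = sqrt (a * c) * sqrt (b * d)"
    by (simp add: real_sqrt_mult[symmetric] ac_simps)
  ultimately show "(sqrt (a * c) + sqrt (b * d))\<^sup>2 \<le> (a + b) * (c + d)"
    using assms by (simp add: power2_sum algebra_simps)
qed

text \<open>The Bhattacharyya coefficient of two Bernoulli distributions, that is, 1 minus their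
  squared Hellinger distance.\<close>

definition affinity :: "real \<Rightarrow> real \<Rightarrow> real" where
  "affinity a b = sqrt (a * b) + sqrt ((1 - a) * (1 - b))"

text \<open>Forgetting which branch was taken cannot decrease the affinity: Cauchy-Schwarz for each
  of the two outputs.\<close>

lemma affinity_mix:
  assumes "0 \<le> p" "p \<le> 1" "0 \<le> q" "q \<le> 1"
    and "0 \<le> a0" "a0 \<le> 1" "0 \<le> a1" "a1 \<le> 1" "0 \<le> b0" "b0 \<le> 1" "0 \<le> b1" "b1 \<le> 1"
  shows "sqrt (p * q) * affinity a1 b1 + sqrt ((1 - p) * (1 - q)) * affinity a0 b0
    \<le> affinity (p * a1 + (1 - p) * a0) (q * b1 + (1 - q) * b0)"
proof -
  have 1: "sqrt ((p * a1) * (q * b1)) + sqrt (((1 - p) * a0) * ((1 - q) * b0))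
      \<le> sqrt ((p * a1 + (1 - p) * a0) * (q * b1 + (1 - q) * b0))"
    using assms by (intro sqrt_mult_add_le) auto
  have 2: "sqrt ((p * (1 - a1)) * (q * (1 - b1))) + sqrt (((1 - p) * (1 - a0)) * ((1 - q) * (1 - b0)))
      \<le> sqrt ((p * (1 - a1) + (1 - p) * (1 - a0)) * (q * (1 - b1) + (1 - q) * (1 - b0)))"
    using assms by (intro sqrt_mult_add_le) auto
  have 3: "p * (1 - a1) + (1 - p) * (1 - a0) = 1 - (p * a1 + (1 - p) * a0)"
    "q * (1 - b1) + (1 - q) * (1 - b0) = 1 - (q * b1 + (1 - q) * b0)"
    by algebra+
  have 4: "sqrt ((r * a) * (s * b)) = sqrt (r * s) * sqrt (a * b)" for r s a b
    by (simp add: real_sqrt_mult[symmetric] ac_simps)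
  show ?thesis
    using add_mono[OF 1 2] unfolding affinity_def 3 4 distrib_left by simp
qed

text \<open>
  The weights \<open>u\<close> and \<open>v\<close> stand for the probabilities of reaching the subtree on the two inputs:
  a query to a differing bit loses at most a fraction \<open>\<gamma>\<^sup>2\<close> of the affinity present there.
\<close>

lemma affinity_racc_ge:
  assumes "rok P T" "0 \<le> u" "0 \<le> v"
  shows "sqrt (u * v) * (1 - affinity (racc x T) (racc y T))
    \<le> (u * rcost (\<lambda>_ \<gamma>. \<gamma>\<^sup>2) x T + v * rcost (\<lambda>_ \<gamma>. \<gamma>\<^sup>2) y T) / 2"
  using assms
proof (induction T arbitrary: u v)
  case (RLeaf b)
  then show ?case by (auto simp: affinity_def)
next
  case (RCoin p t0 t1)
  let ?A = "\<lambda>t. affinity (racc x t) (racc y t)"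
  have p: "0 \<le> p" "p \<le> 1" using RCoin by auto
  have m: "p * ?A t1 + (1 - p) * ?A t0 \<le> ?A (RCoin p t0 t1)"
    using affinity_mix[of p p "racc x t0" "racc x t1" "racc y t0" "racc y t1"] p RCoin.prems
      racc_bounds[of P t0] racc_bounds[of P t1] by simp
  have "sqrt (u * v) * (1 - ?A (RCoin p t0 t1)) \<le> sqrt (u * v) * (1 - (p * ?A t1 + (1 - p) * ?A t0))"
    using m RCoin.prems by (intro mult_left_mono) auto
  also have "\<dots> = p * (sqrt (u * v) * (1 - ?A t1)) + (1 - p) * (sqrt (u * v) * (1 - ?A t0))"
    by algebra
  also have "\<dots> \<le> p * ((u * rcost (\<lambda>_ \<gamma>. \<gamma>\<^sup>2) x t1 + v * rcost (\<lambda>_ \<gamma>. \<gamma>\<^sup>2) y t1) / 2) +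
     (1 - p) * ((u * rcost (\<lambda>_ \<gamma>. \<gamma>\<^sup>2) x t0 + v * rcost (\<lambda>_ \<gamma>. \<gamma>\<^sup>2) y t0) / 2)"
    using RCoin p by (intro add_mono mult_left_mono) auto
  also have "\<dots> = (u * rcost (\<lambda>_ \<gamma>. \<gamma>\<^sup>2) x (RCoin p t0 t1) + v * rcost (\<lambda>_ \<gamma>. \<gamma>\<^sup>2) y (RCoin p t0 t1)) / 2"
    by (simp add: algebra_simps add_divide_distrib diff_divide_distrib)
  finally show ?case .
next
  case (RQuery i \<gamma> t0 t1)
  let ?A = "\<lambda>t. affinity (racc x t) (racc y t)"
  define p q where "p = qprob (x i) \<gamma>" and "q = qprob (y i) \<gamma>"
  have g: "0 \<le> \<gamma>" "\<gamma> \<le> 1" using RQuery.prems by auto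
  have pq: "0 \<le> p" "p \<le> 1" "0 \<le> q" "q \<le> 1"
    using qprob_bounds[OF g] by (auto simp: p_def q_def)
  define s1 s0 where "s1 = sqrt (p * q)" and "s0 = sqrt ((1 - p) * (1 - q))"
  \<comment> \<open>The affinity of the two answer distributions is 1 if the bits agree and
    \<open>sqrt (1 - \<gamma>\<^sup>2)\<close> otherwise, and a number in [0, 1] is at least its own
    square.\<close>
  have s: "s1 + s0 \<ge> 1 - \<gamma>\<^sup>2"
  proof (cases "x i = y i")
    case True
    then have "p = q" by (simp add: p_def q_def)
    then show ?thesis using pq by (simp add: s1_def s0_def)
  next
    case False
    then have e: "p * q = (1 - \<gamma>\<^sup>2) / 2\<^sup>2" "(1 - p) * (1 - q) = (1 - \<gamma>\<^sup>2) / 2\<^sup>2"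
      by (auto simp: p_def q_def qprob_def field_simps power2_eq_square)
    have g2: "0 \<le> 1 - \<gamma>\<^sup>2" "1 - \<gamma>\<^sup>2 \<le> 1" using g by (auto simp: power_le_one)
    have "(1 - \<gamma>\<^sup>2)\<^sup>2 \<le> 1 - \<gamma>\<^sup>2"
      using mult_left_mono[OF g2(2) g2(1)] by (simp add: power2_eq_square)
    then have "1 - \<gamma>\<^sup>2 \<le> sqrt (1 - \<gamma>\<^sup>2)" by (rule real_le_rsqrt)
    moreover have "s1 + s0 = sqrt (1 - \<gamma>\<^sup>2)"
      unfolding s1_def s0_def e by (simp add: real_sqrt_divide)
    ultimately show ?thesis by simp
  qed
  have m: "s1 * ?A t1 + s0 * ?A t0 \<le> ?A (RQuery i \<gamma> t0 t1)"
    using affinity_mix[of p q "racc x t0" "racc x t1" "racc y t0" "racc y t1"] pq RQuery.prems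
      racc_bounds[of P t0] racc_bounds[of P t1] by (simp add: s1_def s0_def p_def q_def)
  \<comment> \<open>AM-GM charges the loss at this node to the average of the two reach
    probabilities, hence to the average of the two costs.\<close>
  have uv: "0 \<le> sqrt (u * v)" "sqrt (u * v) \<le> (u + v) / 2"
    using RQuery.prems arith_geo_mean_sqrt[of u v] by auto
  have "sqrt (u * v) * (1 - ?A (RQuery i \<gamma> t0 t1)) \<le> sqrt (u * v) * (1 - (s1 * ?A t1 + s0 * ?A t0))"
    using m uv(1) by (intro mult_left_mono) auto
  also have "\<dots> = sqrt (u * v) * (1 - (s1 + s0)) +
      ((sqrt (u * v) * s1) * (1 - ?A t1) + (sqrt (u * v) * s0) * (1 - ?A t0))"
    by algebra
  also have "sqrt (u * v) * s1 = sqrt ((u * p) * (v * q))"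
    by (simp add: s1_def real_sqrt_mult)
  also have "sqrt (u * v) * s0 = sqrt ((u * (1 - p)) * (v * (1 - q)))"
    by (simp add: s0_def real_sqrt_mult)
  also have "sqrt (u * v) * (1 - (s1 + s0)) +
     (sqrt ((u * p) * (v * q)) * (1 - ?A t1) + sqrt ((u * (1 - p)) * (v * (1 - q))) * (1 - ?A t0))
    \<le> (u + v) / 2 * \<gamma>\<^sup>2 +
     (((u * p) * rcost (\<lambda>_ \<gamma>. \<gamma>\<^sup>2) x t1 + (v * q) * rcost (\<lambda>_ \<gamma>. \<gamma>\<^sup>2) y t1) / 2 +
     ((u * (1 - p)) * rcost (\<lambda>_ \<gamma>. \<gamma>\<^sup>2) x t0 + (v * (1 - q)) * rcost (\<lambda>_ \<gamma>. \<gamma>\<^sup>2) y t0) / 2)"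
  proof (intro add_mono RQuery.IH)
    have "sqrt (u * v) * (1 - (s1 + s0)) \<le> sqrt (u * v) * \<gamma>\<^sup>2"
      using s uv by (intro mult_left_mono) auto
    also have "\<dots> \<le> (u + v) / 2 * \<gamma>\<^sup>2" using uv by (intro mult_right_mono) auto
    finally show "sqrt (u * v) * (1 - (s1 + s0)) \<le> (u + v) / 2 * \<gamma>\<^sup>2" .
  qed (use RQuery.prems pq in auto)
  also have "\<dots> = (u * rcost (\<lambda>_ \<gamma>. \<gamma>\<^sup>2) x (RQuery i \<gamma> t0 t1) + v * rcost (\<lambda>_ \<gamma>. \<gamma>\<^sup>2) y (RQuery i \<gamma> t0 t1)) / 2"
    by (simp add: p_def[symmetric] q_def[symmetric] algebra_simps add_divide_distrib diff_divide_distrib)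
  finally show ?case .
qed

lemma rcost_distinguish_ge:
  assumes "rok P T" "racc x T \<ge> 2/3" "racc y T \<le> 1/3"
    and "rcost (\<lambda>_ \<gamma>. \<gamma>\<^sup>2) x T \<le> c" "rcost (\<lambda>_ \<gamma>. \<gamma>\<^sup>2) y T \<le> c"
  shows "1 / 18 \<le> c"
proof -
  define a b where "a = racc x T" and "b = racc y T"
  have ab: "0 \<le> a" "a \<le> 1" "0 \<le> b" "b \<le> 1" "2/3 \<le> a" "b \<le> 1/3"
    using racc_bounds[OF assms(1)] assms by (auto simp: a_def b_def)
  \<comment> \<open>The weights 2/3 and 3/2 make AM-GM nearly tight at \<open>a = 2/3\<close>,
    \<open>b = 1/3\<close>. Both bounds together give \<open>13/12 - 5/12 * (a - b)\<close>, which
    is at most 17/18.\<close>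
  have "sqrt (a * b) = sqrt ((2/3 * a) * (3/2 * b))" by simp
  also have "\<dots> \<le> (2/3 * a + 3/2 * b) / 2" using ab by (intro arith_geo_mean_sqrt) auto
  finally have 1: "sqrt (a * b) \<le> a / 3 + 3/4 * b" by simp
  have "sqrt ((1 - a) * (1 - b)) = sqrt ((3/2 * (1 - a)) * (2/3 * (1 - b)))" by (simp add: algebra_simps)
  also have "\<dots> \<le> (3/2 * (1 - a) + 2/3 * (1 - b)) / 2" using ab by (intro arith_geo_mean_sqrt) auto
  finally have 2: "sqrt ((1 - a) * (1 - b)) \<le> 3/4 * (1 - a) + (1 - b) / 3" by argo
  have "1 - affinity a b \<le> c"
    using affinity_racc_ge[OF assms(1), of 1 1 x y] assms by (simp add: a_def b_def)
  then show ?thesis using 1 2 ab unfolding affinity_def by argo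
qed

section \<open>Truncation and majority votes\<close>

primrec rtrunc :: "rtree \<Rightarrow> nat \<Rightarrow> rtree" where
  "rtrunc (RLeaf b) d = RLeaf b"
| "rtrunc (RCoin p t0 t1) d = RCoin p (rtrunc t0 d) (rtrunc t1 d)"
| "rtrunc (RQuery i \<gamma> t0 t1) d =
     (case d of 0 \<Rightarrow> RLeaf False | Suc d' \<Rightarrow> RQuery i \<gamma> (rtrunc t0 d') (rtrunc t1 d'))"

lemma rdepth_rtrunc: "rdepth (rtrunc T d) \<le> d"
  by (induction T arbitrary: d) (auto split: nat.splits)

lemma rok_rtrunc: "rok P T \<Longrightarrow> rok P (rtrunc T d)"
  by (induction T arbitrary: d) (auto split: nat.splits)

lemma abs_convex_diff_le:
  fixes p :: real
  assumes "0 \<le> p" "p \<le> 1"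
  shows "\<bar>(p * a1 + (1 - p) * a0) - (p * b1 + (1 - p) * b0)\<bar> \<le> p * \<bar>a1 - b1\<bar> + (1 - p) * \<bar>a0 - b0\<bar>"
proof -
  have "(p * a1 + (1 - p) * a0) - (p * b1 + (1 - p) * b0) = p * (a1 - b1) + (1 - p) * (a0 - b0)"
    by algebra
  also have "\<bar>\<dots>\<bar> \<le> \<bar>p * (a1 - b1)\<bar> + \<bar>(1 - p) * (a0 - b0)\<bar>" by (rule abs_triangle_ineq)
  also have "\<dots> = p * \<bar>a1 - b1\<bar> + (1 - p) * \<bar>a0 - b0\<bar>" using assms by (simp add: abs_mult)
  finally show ?thesis .
qed

text \<open>Markov's inequality by induction on the tree: only runs that reach query number
  \<open>d + 1\<close> are altered.\<close>

lemma racc_rtrunc: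
  "rok P T \<Longrightarrow> (real d + 1) * \<bar>racc x T - racc x (rtrunc T d)\<bar> \<le> rcost (\<lambda>_ _. 1) x T"
proof (induction T arbitrary: d)
  case (RCoin p t0 t1)
  let ?D = "\<lambda>t. \<bar>racc x t - racc x (rtrunc t d)\<bar>"
  have "?D (RCoin p t0 t1) \<le> p * ?D t1 + (1 - p) * ?D t0"
    using abs_convex_diff_le[of p] RCoin.prems by simp
  then have "(real d + 1) * ?D (RCoin p t0 t1) \<le> (real d + 1) * (p * ?D t1 + (1 - p) * ?D t0)"
    by (intro mult_left_mono) auto
  also have "\<dots> = p * ((real d + 1) * ?D t1) + (1 - p) * ((real d + 1) * ?D t0)" by algebra
  also have "\<dots> \<le> rcost (\<lambda>_ _. 1) x (RCoin p t0 t1)"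
    using RCoin by (simp del: of_nat_Suc) (intro add_mono mult_left_mono; auto)
  finally show ?case .
next
  case (RQuery i \<gamma> t0 t1)
  define q where "q = qprob (x i) \<gamma>"
  have q: "0 \<le> q" "q \<le> 1" using qprob_bounds RQuery.prems by (auto simp: q_def)
  have "\<bar>racc x (RQuery i \<gamma> t0 t1) - racc x (rtrunc (RQuery i \<gamma> t0 t1) d)\<bar> \<le> 1"
    using racc_bounds[OF RQuery.prems, of x] racc_bounds[OF rok_rtrunc[OF RQuery.prems, of d], of x]
    by linarith
  note D1 = this
  have c: "0 \<le> q * rcost (\<lambda>_ _. 1) x t1 + (1 - q) * rcost (\<lambda>_ _. 1) x t0"
    using q RQuery.prems rcost_nonneg[of P t0 "\<lambda>_ _. 1" x] rcost_nonneg[of P t1 "\<lambda>_ _. 1" x] by auto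
  show ?case
  proof (cases d)
    case 0
    then show ?thesis using D1 c by (simp add: q_def)
  next
    case (Suc e)
    let ?D = "\<lambda>t. \<bar>racc x t - racc x (rtrunc t e)\<bar>"
    have "(real e + 1) * \<bar>racc x (RQuery i \<gamma> t0 t1) - racc x (rtrunc (RQuery i \<gamma> t0 t1) d)\<bar>
      \<le> (real e + 1) * (q * ?D t1 + (1 - q) * ?D t0)"
      using abs_convex_diff_le[OF q] by (intro mult_left_mono) (auto simp: Suc q_def)
    also have "\<dots> = q * ((real e + 1) * ?D t1) + (1 - q) * ((real e + 1) * ?D t0)" by algebra
    also have "\<dots> \<le> q * rcost (\<lambda>_ _. 1) x t1 + (1 - q) * rcost (\<lambda>_ _. 1) x t0"
      using RQuery q by (intro add_mono mult_left_mono) auto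
    \<comment> \<open>Of the \<open>d + 1\<close> copies of the difference, the root query pays for
      one, since the difference is at most 1; the induction hypothesis pays for the others.\<close>
    finally show ?thesis using D1 by (simp add: Suc q_def algebra_simps)
  qed
qed auto

definition rmaj3 :: "rtree \<Rightarrow> rtree" where
  "rmaj3 T = rsubst T (rsubst T (RLeaf False) T) (rsubst T T (RLeaf True))"

lemma rok_rmaj3: "rok P T \<Longrightarrow> rok P (rmaj3 T)"
  by (simp add: rmaj3_def rok_rsubst)

lemma rdepth_rmaj3: "rdepth (rmaj3 T) \<le> 3 * rdepth T"
proof -
  have "rdepth (rsubst T (RLeaf False) T) \<le> 2 * rdepth T"
    "rdepth (rsubst T T (RLeaf True)) \<le> 2 * rdepth T"
    using rdepth_rsubst[of T "RLeaf False" T] rdepth_rsubst[of T T "RLeaf True"] by auto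
  then show ?thesis
    using rdepth_rsubst[of T "rsubst T (RLeaf False) T" "rsubst T T (RLeaf True)"]
    by (simp add: rmaj3_def)
qed

lemma racc_rmaj3: "racc x (rmaj3 T) = (racc x T)\<^sup>2 * (3 - 2 * racc x T)"
  by (simp add: rmaj3_def racc_rsubst) algebra

lemma maj3_mono:
  fixes a b :: real
  assumes "0 \<le> a" "a \<le> b" "b \<le> 1"
  shows "a\<^sup>2 * (3 - 2 * a) \<le> b\<^sup>2 * (3 - 2 * b)"
proof -
  have "0 \<le> (b - a) * (2 * a * (1 - a) + 2 * b * (1 - b) + a * (1 - b) + b * (1 - a))"
    using assms by (intro mult_nonneg_nonneg add_nonneg_nonneg) auto
  also have "\<dots> = b\<^sup>2 * (3 - 2 * b) - a\<^sup>2 * (3 - 2 * a)"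
    by algebra
  finally show ?thesis by simp
qed

text \<open>Truncation after about \<open>12 * c\<close> queries changes acceptance by at most 1/12,
  so an error of 1/3 grows to at most 5/12. Two nested majorities of three reduce this to 38/100 and
  then below 1/3, with nine copies of the tree: \<open>108 = 9 * 12\<close>.\<close>

lemma rtree_worst_case:
  assumes "rok P T" "\<And>x. x \<in> X \<Longrightarrow> rcost (\<lambda>_ _. 1) x T \<le> c" "0 \<le> c"
  shows "\<exists>T'. rok P T' \<and> real (rdepth T') \<le> 108 * c \<and>
    (\<forall>x\<in>X. (racc x T \<ge> 2/3 \<longrightarrow> racc x T' \<ge> 2/3) \<and> (racc x T \<le> 1/3 \<longrightarrow> racc x T' \<le> 1/3))"
proof -
  define d where "d = nat \<lfloor>12 * c\<rfloor>"
  define U where "U = rtrunc T d"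
  have d: "real d \<le> 12 * c" "12 * c \<le> real d + 1"
    using assms(3) by (auto simp: d_def)
  have ok: "rok P U" using assms(1) by (simp add: U_def rok_rtrunc)
  have close: "\<bar>racc x T - racc x U\<bar> \<le> 1 / 12" if "x \<in> X" for x
  proof -
    have "(real d + 1) * \<bar>racc x T - racc x U\<bar> \<le> c"
      using racc_rtrunc[OF assms(1), of d x] assms(2)[OF that] by (simp add: U_def)
    also have "c \<le> (real d + 1) * (1 / 12)" using d by simp
    finally show ?thesis by (rule mult_left_le_imp_le) simp
  qed
  have "rdepth (rmaj3 (rmaj3 U)) \<le> 9 * d"
    using rdepth_rmaj3[of U] rdepth_rmaj3[of "rmaj3 U"] rdepth_rtrunc[of T d] by (simp add: U_def)
  then have "real (rdepth (rmaj3 (rmaj3 U))) \<le> 108 * c" using d by simp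
  moreover have "racc x (rmaj3 (rmaj3 U)) \<ge> 2/3" if "x \<in> X" "racc x T \<ge> 2/3" for x
  proof -
    have "racc x U \<ge> 7/12" using close[OF that(1)] that(2) by linarith
    then have "racc x (rmaj3 U) \<ge> (7/12)\<^sup>2 * (3 - 2 * (7/12))"
      using racc_bounds[OF ok] by (auto simp only: racc_rmaj3 intro!: maj3_mono)
    then have "racc x (rmaj3 U) \<ge> 62/100" by (simp add: power2_eq_square)
    then have "racc x (rmaj3 (rmaj3 U)) \<ge> (62/100)\<^sup>2 * (3 - 2 * (62/100))"
      using racc_bounds[OF rok_rmaj3[OF ok]] by (auto simp only: racc_rmaj3[of _ "rmaj3 U"] intro!: maj3_mono)
    then show ?thesis by (simp add: power2_eq_square)
  qed
  moreover have "racc x (rmaj3 (rmaj3 U)) \<le> 1/3" if "x \<in> X" "racc x T \<le> 1/3" for x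
  proof -
    have "racc x U \<le> 5/12" using close[OF that(1)] that(2) by linarith
    then have "racc x (rmaj3 U) \<le> (5/12)\<^sup>2 * (3 - 2 * (5/12))"
      using racc_bounds[OF ok] by (auto simp only: racc_rmaj3 intro!: maj3_mono)
    then have "racc x (rmaj3 U) \<le> 38/100" by (simp add: power2_eq_square)
    then have "racc x (rmaj3 (rmaj3 U)) \<le> (38/100)\<^sup>2 * (3 - 2 * (38/100))"
      using racc_bounds[OF rok_rmaj3[OF ok]] by (auto simp only: racc_rmaj3[of _ "rmaj3 U"] intro!: maj3_mono)
    then show ?thesis by (simp add: power2_eq_square)
  qed
  ultimately show ?thesis
    using rok_rmaj3[OF rok_rmaj3[OF ok]] by (intro exI[of _ "rmaj3 (rmaj3 U)"]) blast
qed

section \<open>Simulating large parameters by a stopped random walk\<close>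

text \<open>The relation \<open>rel\<close> allows the new tree to run on another kind of input: it
  is equality when only parameters change, and \<open>gap_rel\<close> when bits are replaced by
  blocks.\<close>

lemma rtree_replace_queries:
  assumes "rok P T"
    and gadget: "\<And>i \<gamma>. 0 \<le> \<gamma> \<Longrightarrow> \<gamma> \<le> 1 \<Longrightarrow> P i \<gamma> \<Longrightarrow>
      \<exists>G. rok Q G \<and> (\<forall>x z. rel x z \<longrightarrow> racc z G = qprob (x i) \<gamma> \<and> rcost w' z G \<le> w i \<gamma>)"
  shows "\<exists>T'. rok Q T' \<and> (\<forall>x z. rel x z \<longrightarrow> racc z T' = racc x T \<and> rcost w' z T' \<le> rcost w x T)"
  using assms(1)
proof (induction T)
  case (RLeaf b)
  then show ?case by (intro exI[of _ "RLeaf b"]) auto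
next
  case (RCoin p t0 t1)
  then obtain u0 u1 where u: "rok Q u0" "rok Q u1"
    "\<And>x z. rel x z \<Longrightarrow> racc z u0 = racc x t0 \<and> rcost w' z u0 \<le> rcost w x t0"
    "\<And>x z. rel x z \<Longrightarrow> racc z u1 = racc x t1 \<and> rcost w' z u1 \<le> rcost w x t1"
    by auto
  show ?case
    using u RCoin.prems
    by (intro exI[of _ "RCoin p u0 u1"]) (auto intro!: add_mono mult_left_mono)
next
  case (RQuery i \<gamma> t0 t1)
  then obtain u0 u1 where u: "rok Q u0" "rok Q u1"
    "\<And>x z. rel x z \<Longrightarrow> racc z u0 = racc x t0 \<and> rcost w' z u0 \<le> rcost w x t0"
    "\<And>x z. rel x z \<Longrightarrow> racc z u1 = racc x t1 \<and> rcost w' z u1 \<le> rcost w x t1"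
    by auto
  obtain G where G: "rok Q G"
    "\<And>x z. rel x z \<Longrightarrow> racc z G = qprob (x i) \<gamma> \<and> rcost w' z G \<le> w i \<gamma>"
    using gadget[of \<gamma> i] RQuery.prems by auto
  show ?case
    using u G RQuery.prems qprob_bounds[of \<gamma>]
    by (intro exI[of _ "rsubst G u0 u1"])
      (auto simp: racc_rsubst rcost_rsubst rok_rsubst intro!: add_mono mult_left_mono)
qed

abbreviation rflip :: "real \<Rightarrow> rtree" where
  "rflip p \<equiv> RCoin p (RLeaf False) (RLeaf True)"

text \<open>\<open>s\<close> is the position, \<open>m\<close> the number of steps left, and the
  walk stops at distance \<open>k\<close> from 0. The final coin has mean \<open>s / k\<close>,
  which makes acceptance an affine function of the expected final position.\<close>

primrec rwalk :: "nat \<Rightarrow> real \<Rightarrow> int \<Rightarrow> nat \<Rightarrow> int \<Rightarrow> rtree" where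
  "rwalk i g k 0 = (\<lambda>s. rflip ((1 + of_int s / of_int k) / 2))"
| "rwalk i g k (Suc m) = (\<lambda>s. if \<bar>s\<bar> < k then RQuery i g (rwalk i g k m (s - 1)) (rwalk i g k m (s + 1))
     else rflip ((1 + of_int s / of_int k) / 2))"

lemma rok_rwalk:
  assumes "0 < k" "0 \<le> g" "g \<le> 1" "Q i g"
  shows "\<bar>s\<bar> \<le> k \<Longrightarrow> rok Q (rwalk i g k m s)"
proof (induction m arbitrary: s)
  case 0
  then have "- 1 \<le> of_int s / (of_int k :: real)" "of_int s / (of_int k :: real) \<le> 1"
    using assms(1) by (auto simp: field_simps abs_le_iff simp flip: of_int_minus)
  then show ?case by auto
next
  case (Suc m)
  then have "- 1 \<le> of_int s / (of_int k :: real)" "of_int s / (of_int k :: real) \<le> 1"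
    using assms(1) by (auto simp: field_simps abs_le_iff simp flip: of_int_minus)
  then show ?case using Suc assms by auto
qed

text \<open>Reflecting the walk exchanges the two values of the bit. Started at 0, the walk is
  therefore a noisy oracle with one and the same parameter for both values.\<close>

lemma racc_rwalk_flip:
  assumes "x i" "\<not> y i"
  shows "racc y (rwalk i g k m s) = 1 - racc x (rwalk i g k m (- s))"
proof (induction m arbitrary: s)
  case 0
  show ?case by (simp add: field_simps)
next
  case (Suc m)
  show ?case
  proof (cases "\<bar>s\<bar> < k")
    case True
    then have "racc y (rwalk i g k (Suc m) s) =
        qprob False g * (1 - racc x (rwalk i g k m (- (s + 1)))) +
        (1 - qprob False g) * (1 - racc x (rwalk i g k m (- (s - 1))))"
      using assms Suc by simp
    also have "qprob False g = 1 - qprob True g" by (simp add: qprob_def field_simps)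
    finally have 1: "racc y (rwalk i g k (Suc m) s) =
        (1 - qprob True g) * (1 - racc x (rwalk i g k m (- (s + 1)))) +
        (1 - (1 - qprob True g)) * (1 - racc x (rwalk i g k m (- (s - 1))))" .
    have "- s - 1 = - (s + 1)" "- s + 1 = - (s - 1)" by auto
    then have 2: "racc x (rwalk i g k (Suc m) (- s)) =
        qprob True g * racc x (rwalk i g k m (- (s - 1))) +
        (1 - qprob True g) * racc x (rwalk i g k m (- (s + 1)))"
      using True assms by (simp only: rwalk.simps) (simp del: minus_add_distrib minus_diff_eq)
    show ?thesis unfolding 1 2 by algebra
  qed (simp add: field_simps)
qed

lemma rcost_rwalk:
  assumes "0 \<le> g" "g \<le> 1" "w i g = g\<^sup>2"
  shows "rcost w x (rwalk i g k m s) \<le> real m * g\<^sup>2"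
proof (induction m arbitrary: s)
  case (Suc m)
  have "qprob (x i) g * rcost w x (rwalk i g k m (s + 1)) + (1 - qprob (x i) g) * rcost w x (rwalk i g k m (s - 1))
      \<le> real m * g\<^sup>2"
    using qprob_bounds[of g "x i"] assms Suc by (intro convex_bound_le) auto
  then show ?case using assms by (auto simp: algebra_simps)
qed auto

text \<open>
  On a true bit, the expected final position of the stopped walk is the starting position plus \<open>g\<close>
  times the expected number of steps; the bound says that the walk is unlikely to be stopped early.
\<close>

lemma racc_rwalk_ge:
  assumes "0 < k" "0 \<le> g" "g * of_int k \<le> 1 / 2" "x i"
  shows "\<bar>s\<bar> \<le> k \<Longrightarrow>
    of_int s + g * real m * (1 - ((of_int s)\<^sup>2 + 2 * real m) / (of_int k)\<^sup>2)
      \<le> of_int k * (2 * racc x (rwalk i g k m s) - 1)"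
proof (induction m arbitrary: s)
  case 0
  then show ?case using assms by (simp add: field_simps)
next
  case (Suc m)
  let ?K = "of_int k :: real" and ?S = "of_int s :: real"
  have K: "?K > 0" using assms by simp
  show ?case
  proof (cases "\<bar>s\<bar> < k")
    case False
    then have "\<bar>s\<bar> = k" using Suc.prems by simp
    then have "?S\<^sup>2 = ?K\<^sup>2" by (metis of_int_abs power2_abs)
    then have "1 - (?S\<^sup>2 + 2 * real (Suc m)) / ?K\<^sup>2 \<le> 0" using K by (simp add: field_simps)
    then have "g * real (Suc m) * (1 - (?S\<^sup>2 + 2 * real (Suc m)) / ?K\<^sup>2) \<le> 0"
      using assms by (intro mult_nonneg_nonpos) auto
    moreover have "?K * (2 * ((1 + ?S / ?K) / 2) - 1) = ?S" using K by (simp add: field_simps)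
    ultimately show ?thesis using False by simp
  next
    case True
    define p where "p = (1 + g) / 2"
    have "1 \<le> ?K" using assms by simp
    then have "g * 1 \<le> g * ?K" using assms by (intro mult_left_mono) auto
    then have p: "0 \<le> p" "p \<le> 1" using assms by (auto simp: p_def)
    define B where "B s = of_int s + g * real m * (1 - ((of_int s)\<^sup>2 + 2 * real m) / ?K\<^sup>2)" for s :: int
    have IH: "B (s + 1) \<le> ?K * (2 * racc x (rwalk i g k m (s + 1)) - 1)"
      "B (s - 1) \<le> ?K * (2 * racc x (rwalk i g k m (s - 1)) - 1)"
      unfolding B_def using Suc.IH[of "s + 1"] Suc.IH[of "s - 1"] True by auto
    \<comment> \<open>The mean square of the position grows by \<open>1 + 2 * (g * s)\<close> in a
      step, which is at most 2 here; this is the origin of the term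
      \<open>2 * real m\<close>.\<close>
    have S: "g * ?S \<le> 1 / 2"
    proof -
      have "g * ?S \<le> g * ?K" using True assms by (intro mult_left_mono) auto
      then show ?thesis using assms by simp
    qed
    define c where "c = g * real m / ?K\<^sup>2"
    have c: "0 \<le> c" using assms by (simp add: c_def)
    have B': "B s = of_int s + g * real m - c * ((of_int s)\<^sup>2 + 2 * real m)" for s
      by (simp add: B_def c_def field_simps)
    have "p * B (s + 1) + (1 - p) * B (s - 1) = ?S + g + g * real m - c * (?S\<^sup>2 + 2 * (g * ?S) + 1 + 2 * real m)"
      unfolding B' p_def by (simp add: field_simps power2_eq_square)
    also have "\<dots> \<ge> ?S + g + g * real m - c * (?S\<^sup>2 + 2 * (real m + 1))"
      using S c by (auto intro!: mult_left_mono)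
    also have "?S + g + g * real m - c * (?S\<^sup>2 + 2 * (real m + 1)) \<ge>
        ?S + g * real (Suc m) * (1 - (?S\<^sup>2 + 2 * real (Suc m)) / ?K\<^sup>2)"
    proof -
      define X where "X = (?S\<^sup>2 + 2 * (real m + 1)) / ?K\<^sup>2"
      have "0 \<le> g * X" using assms by (simp add: X_def)
      moreover have "c * (?S\<^sup>2 + 2 * (real m + 1)) = g * real m * X" by (simp add: c_def X_def)
      moreover have "(?S\<^sup>2 + 2 * real (Suc m)) / ?K\<^sup>2 = X" by (simp add: X_def add.commute)
      ultimately show ?thesis by (simp add: algebra_simps)
    qed
    finally (xtrans) have "?S + g * real (Suc m) * (1 - (?S\<^sup>2 + 2 * real (Suc m)) / ?K\<^sup>2)
        \<le> p * B (s + 1) + (1 - p) * B (s - 1)" .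
    also have "\<dots> \<le> p * (?K * (2 * racc x (rwalk i g k m (s + 1)) - 1)) +
        (1 - p) * (?K * (2 * racc x (rwalk i g k m (s - 1)) - 1))"
      using p IH by (intro add_mono mult_left_mono) auto
    also have "\<dots> = ?K * (2 * (p * racc x (rwalk i g k m (s + 1)) + (1 - p) * racc x (rwalk i g k m (s - 1))) - 1)"
      by algebra
    also have "p = qprob (x i) g" using assms by (simp add: p_def qprob_def)
    finally show ?thesis using True by simp
  qed
qed

text \<open>A walk of \<open>j\<^sup>2\<close> steps with barrier \<open>k = 2 * j\<close> keeps at
  least half of its drift \<open>g * j\<^sup>2\<close>, so its parameter \<beta> is at least
  \<open>g * j / 4\<close>. With \<open>j\<close> about \<open>4 * \<gamma> / g\<close> this reaches
  \<gamma>, and mixing with a fair coin lowers it to exactly \<gamma>. Rounding up at most doubles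
  \<open>j\<close> because \<open>g / 4 \<le> \<gamma>\<close>, so the cost
  \<open>(j * g)\<^sup>2\<close> is at most \<open>64 * \<gamma>\<^sup>2\<close>; \<gamma> \<le>
  1/32 ensures \<open>g * k \<le> 1 / 2\<close>.\<close>

lemma rtree_simulate_medium_query:
  fixes g \<gamma> :: real
  assumes g: "0 < g" "g \<le> 1" and \<gamma>: "g / 4 \<le> \<gamma>" "\<gamma> \<le> 1 / 32" and Q: "Q i g" and w: "w i g = g\<^sup>2"
  shows "\<exists>G. rok Q G \<and> (\<forall>x. racc x G = qprob (x i) \<gamma> \<and> rcost w x G \<le> 64 * \<gamma>\<^sup>2)"
proof -
  define j where "j = nat \<lceil>4 * \<gamma> / g\<rceil>"
  define k where "k = 2 * int j"
  define W where "W = rwalk i g k (j\<^sup>2) 0"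
  have 1: "1 \<le> 4 * \<gamma> / g" using g \<gamma> by (simp add: field_simps)
  then have j: "4 * \<gamma> / g \<le> real j" "real j \<le> 8 * \<gamma> / g" "0 < real j"
    unfolding j_def by linarith+
  have k: "0 < k" "real_of_int k = 2 * real j" using j by (auto simp: k_def)
  have gk: "g * real_of_int k \<le> 1 / 2"
  proof -
    have "g * real j \<le> 8 * \<gamma>" using j(2) g by (simp add: field_simps)
    then show ?thesis using \<gamma> k by simp
  qed
  have okW: "rok Q W" unfolding W_def using k g Q by (intro rok_rwalk) auto
  define xt :: "nat \<Rightarrow> bool" where "xt = (\<lambda>_. True)"
  define \<beta> where "\<beta> = 2 * racc xt W - 1"
  have "g * real j * real j / 2 \<le> 2 * real j * \<beta>"
  proof -
    have H: "0 + g * (real j)\<^sup>2 * (1 - (0\<^sup>2 + 2 * (real j)\<^sup>2) / (2 * real j)\<^sup>2) \<le> 2 * real j * \<beta>"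
      using racc_rwalk_ge[of k g xt i 0 "j\<^sup>2"] k g gk by (simp add: xt_def W_def \<beta>_def)
    have r: "(0\<^sup>2 + 2 * (real j)\<^sup>2) / (2 * real j)\<^sup>2 = 1 / 2" using j by (simp add: field_simps power2_eq_square)
    show ?thesis using H unfolding r by (simp add: power2_eq_square)
  qed
  then have "(g * real j / 4) * (2 * real j) \<le> \<beta> * (2 * real j)" by (simp add: algebra_simps)
  then have "g * real j / 4 \<le> \<beta>" using j(3) by (simp only: mult_le_cancel_right)
  moreover have "\<gamma> \<le> g * real j / 4" using j(1) g by (simp add: field_simps)
  ultimately have \<beta>: "\<gamma> \<le> \<beta>" "0 < \<beta>" "0 < \<gamma>" using g \<gamma> by linarith+
  have accW: "racc x W = qprob (x i) \<beta>" for x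
  proof (cases "x i")
    case True
    then have "racc x W = 1 - racc (\<lambda>_. False) (rwalk i g k (j\<^sup>2) 0)"
      using racc_rwalk_flip[of x i "\<lambda>_. False" g k "j\<^sup>2" 0] by (simp add: W_def)
    also have "\<dots> = racc xt W"
      using racc_rwalk_flip[of xt i "\<lambda>_. False" g k "j\<^sup>2" 0] by (simp add: W_def xt_def)
    finally show ?thesis using True by (simp add: qprob_def \<beta>_def)
  next
    case False
    then show ?thesis
      using racc_rwalk_flip[of xt i x g k "j\<^sup>2" 0] by (simp add: W_def xt_def \<beta>_def qprob_def)
  qed
  define G where "G = RCoin (\<gamma> / \<beta>) (rflip (1 / 2)) W"
  have "racc x G = qprob (x i) \<gamma>" for x
    using \<beta> by (simp add: G_def accW qprob_def field_simps)
  moreover have "rcost w x G \<le> 64 * \<gamma>\<^sup>2" for x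
  proof -
    have cW: "rcost w x W \<le> real (j\<^sup>2) * g\<^sup>2"
      unfolding W_def using g w by (intro rcost_rwalk) auto
    also have "\<dots> = (real j * g)\<^sup>2" by (simp add: power_mult_distrib)
    also have "\<dots> \<le> (8 * \<gamma>)\<^sup>2" using j(2) g by (intro power_mono) (auto simp: field_simps)
    finally have "rcost w x W \<le> 64 * \<gamma>\<^sup>2" by (simp add: power_mult_distrib)
    then have "\<gamma> / \<beta> * rcost w x W \<le> 1 * (64 * \<gamma>\<^sup>2)" using \<beta>
      by (smt (verit) divide_le_eq_1_pos divide_pos_pos mult_left_le_one_le mult_nonneg_nonneg
          mult_nonneg_nonpos zero_le_power2)
    then show ?thesis by (simp add: G_def)
  qed
  moreover have "rok Q G" using \<beta> okW by (simp add: G_def)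
  ultimately show ?thesis by blast
qed

section \<open>Simulating small parameters by a hidden endpoint\<close>

text \<open>
  Under a uniform prior on a bit, with posterior mean \<open>m\<close> (encoding true as \<open>1\<close> and false as \<open>-1\<close>),
  \<open>update_mean m \<gamma>\<close> is the posterior mean after the answer true to a query with parameter \<open>\<gamma>\<close>, and
  \<open>update_mean m (- \<gamma>)\<close> after the answer false. Consider a martingale of posterior means that starts
  at 0 and ends in \<open>g\<close> or \<open>-g\<close>. Its endpoint is distributed like the answer to a query with parameter
  \<open>g\<close>, and \<open>end_prob g m b\<close> is the probability that it is \<open>g\<close>, given that the current
  value is \<open>m\<close> and the bit is \<open>b\<close>. Given the endpoint, the steps no longer depend on the bit:
  \<open>cond_up1\<close> and \<open>cond_up0\<close> are the conditional probabilities of the answer true.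
\<close>

definition update_mean :: "real \<Rightarrow> real \<Rightarrow> real" where
  "update_mean m \<gamma> = (m + \<gamma>) / (1 + m * \<gamma>)"

definition pm_sign :: "bool \<Rightarrow> real" where
  "pm_sign b = (if b then 1 else - 1)"

definition end_prob :: "real \<Rightarrow> real \<Rightarrow> bool \<Rightarrow> real" where
  "end_prob g m b = (g + m) * (1 + pm_sign b * g) / (2 * g * (1 + pm_sign b * m))"

definition cond_up1 :: "real \<Rightarrow> real \<Rightarrow> real \<Rightarrow> real" where
  "cond_up1 g m \<gamma> = (g * (1 + m * \<gamma>) + (m + \<gamma>)) / (2 * (g + m))"

definition cond_up0 :: "real \<Rightarrow> real \<Rightarrow> real \<Rightarrow> real" where
  "cond_up0 g m \<gamma> = (g * (1 + m * \<gamma>) - (m + \<gamma>)) / (2 * (g - m))"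

lemma pm_sign_bound: "\<bar>u\<bar> < 1 \<Longrightarrow> 0 < 1 + pm_sign b * u"
  by (auto simp: pm_sign_def)

lemma qprob_eq: "qprob b \<gamma> = (1 + pm_sign b * \<gamma>) / 2"
  by (simp add: qprob_def pm_sign_def)

lemma qprob_minus: "qprob b (- \<gamma>) = 1 - qprob b \<gamma>"
  by (simp add: qprob_def field_simps)

lemma abs_mult_less_1: "\<bar>m\<bar> < 1 \<Longrightarrow> \<bar>\<gamma>\<bar> < 1 \<Longrightarrow> \<bar>m * \<gamma>\<bar> < (1 :: real)"
  using abs_mult_less[of m 1 \<gamma> 1] by (simp add: abs_mult)

lemma one_minus_end_prob:
  assumes "0 < g" "\<bar>m\<bar> < 1"
  shows "1 - end_prob g m b = (g - m) * (1 - pm_sign b * g) / (2 * g * (1 + pm_sign b * m))"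
proof -
  have "0 < 1 + pm_sign b * m" using pm_sign_bound assms by auto
  moreover have "2 * g * (1 + pm_sign b * m) - (g + m) * (1 + pm_sign b * g) = (g - m) * (1 - pm_sign b * g)"
    by (simp add: algebra_simps)
  ultimately show ?thesis using assms by (simp add: end_prob_def divide_simps)
qed

lemma update_mean_factor:
  assumes "\<bar>m\<bar> < 1" "\<bar>\<gamma>\<bar> < 1"
  shows "1 + pm_sign b * update_mean m \<gamma> = (1 + pm_sign b * m) * (1 + pm_sign b * \<gamma>) / (1 + m * \<gamma>)"
    and "g + update_mean m \<gamma> = (g * (1 + m * \<gamma>) + (m + \<gamma>)) / (1 + m * \<gamma>)"
    and "g - update_mean m \<gamma> = (g * (1 + m * \<gamma>) - (m + \<gamma>)) / (1 + m * \<gamma>)"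
proof -
  have "1 + m * \<gamma> \<noteq> 0" using abs_mult_less_1[OF assms] by auto
  then show "g + update_mean m \<gamma> = (g * (1 + m * \<gamma>) + (m + \<gamma>)) / (1 + m * \<gamma>)"
    "g - update_mean m \<gamma> = (g * (1 + m * \<gamma>) - (m + \<gamma>)) / (1 + m * \<gamma>)"
    "1 + pm_sign b * update_mean m \<gamma> = (1 + pm_sign b * m) * (1 + pm_sign b * \<gamma>) / (1 + m * \<gamma>)"
    by (auto simp: update_mean_def divide_simps pm_sign_def algebra_simps)
qed

lemma abs_update_mean_less_1:
  assumes "\<bar>m\<bar> < 1" "\<bar>\<gamma>\<bar> < 1"
  shows "\<bar>update_mean m \<gamma>\<bar> < 1"
proof -
  have "0 < 1 + m * \<gamma>" using abs_mult_less_1[OF assms] by auto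
  then have "0 < 1 + pm_sign b * update_mean m \<gamma>" for b
    using pm_sign_bound assms by (simp add: update_mean_factor)
  from this[of True] this[of False] show ?thesis by (simp add: pm_sign_def)
qed

text \<open>Both sides are the probability, given the bit, that the endpoint is \<open>g\<close> and
  the next answer is true: on the left the endpoint is drawn first, on the right the answer. A
  negative \<gamma> covers the answer false.\<close>

lemma end_prob_step1:
  assumes "0 < g" "\<bar>m\<bar> < g" "g \<le> 1" "\<bar>\<gamma>\<bar> < 1"
  shows "end_prob g m b * cond_up1 g m \<gamma> = qprob b \<gamma> * end_prob g (update_mean m \<gamma>) b"
proof -
  define s A where "s = pm_sign b" and "A = 1 + m * \<gamma>"
  have A: "A > 0" using abs_mult_less_1[of m \<gamma>] assms by (auto simp: A_def)
  have n: "1 + s * m > 0" "1 + s * \<gamma> > 0" "g + m > 0"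
    using pm_sign_bound[of m b] pm_sign_bound[of \<gamma> b] assms by (auto simp: s_def)
  have "qprob b \<gamma> * end_prob g (update_mean m \<gamma>) b =
      (1 + s * \<gamma>) / 2 * ((g * A + (m + \<gamma>)) / A * (1 + s * g) / (2 * g * ((1 + s * m) * (1 + s * \<gamma>) / A)))"
    using assms by (simp add: qprob_eq end_prob_def update_mean_factor s_def A_def)
  also have "\<dots> = (g * A + (m + \<gamma>)) * (1 + s * g) / (4 * g * (1 + s * m))"
    using A n assms by (simp add: divide_simps)
  also have "\<dots> = end_prob g m b * cond_up1 g m \<gamma>"
    using A n assms by (simp add: end_prob_def cond_up1_def divide_simps flip: s_def A_def)
      (simp add: algebra_simps)
  finally show ?thesis by simp
qed

lemma end_prob_step0:
  assumes "0 < g" "\<bar>m\<bar> < g" "g \<le> 1" "\<bar>\<gamma>\<bar> < 1"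
  shows "(1 - end_prob g m b) * cond_up0 g m \<gamma> = qprob b \<gamma> * (1 - end_prob g (update_mean m \<gamma>) b)"
proof -
  define s A where "s = pm_sign b" and "A = 1 + m * \<gamma>"
  have A: "A > 0" using abs_mult_less_1[of m \<gamma>] assms by (auto simp: A_def)
  have n: "1 + s * m > 0" "1 + s * \<gamma> > 0" "g - m > 0"
    using pm_sign_bound[of m b] pm_sign_bound[of \<gamma> b] assms by (auto simp: s_def)
  have "qprob b \<gamma> * (1 - end_prob g (update_mean m \<gamma>) b) =
      (1 + s * \<gamma>) / 2 * ((g * A - (m + \<gamma>)) / A * (1 - s * g) / (2 * g * ((1 + s * m) * (1 + s * \<gamma>) / A)))"
    using assms abs_update_mean_less_1[of m \<gamma>]
    by (simp add: qprob_eq one_minus_end_prob update_mean_factor s_def A_def)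
  also have "\<dots> = (g * A - (m + \<gamma>)) * (1 - s * g) / (4 * g * (1 + s * m))"
    using A n assms by (simp add: divide_simps)
  also have "\<dots> = (1 - end_prob g m b) * cond_up0 g m \<gamma>"
    using A n assms by (simp add: one_minus_end_prob cond_up0_def divide_simps flip: s_def A_def)
      (simp add: algebra_simps)
  finally show ?thesis by simp
qed

lemma cond_up_minus:
  assumes "\<bar>m\<bar> < g"
  shows "cond_up1 g m (- \<gamma>) = 1 - cond_up1 g m \<gamma>" "cond_up0 g m (- \<gamma>) = 1 - cond_up0 g m \<gamma>"
  using assms by (auto simp: cond_up1_def cond_up0_def field_simps)

text \<open>The margins \<open>g / 2\<close> and \<open>g / 4\<close> keep the next mean from
  overshooting the endpoints: \<open>\<bar>m + \<gamma>\<bar>\<close> is at most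
  \<open>3 / 4 * g\<close>, while \<open>1 + m * \<gamma>\<close> is at least 3/4.\<close>

lemma cond_up_nonneg:
  assumes "0 < g" "g \<le> 1/2" "\<bar>m\<bar> \<le> g / 2" "\<bar>\<gamma>\<bar> \<le> g / 4"
  shows "0 \<le> cond_up1 g m \<gamma>" "0 \<le> cond_up0 g m \<gamma>"
proof -
  have "\<bar>m * \<gamma>\<bar> \<le> (1 / 4) * (1 / 8)" unfolding abs_mult using assms by (intro mult_mono) auto
  then have "3 / 4 \<le> 1 + m * \<gamma>" by linarith
  then have "g * (3 / 4) \<le> g * (1 + m * \<gamma>)" using assms by (intro mult_left_mono) auto
  moreover have "\<bar>m + \<gamma>\<bar> \<le> 3 / 4 * g" using assms by linarith
  ultimately have "0 \<le> g * (1 + m * \<gamma>) + (m + \<gamma>)" "0 \<le> g * (1 + m * \<gamma>) - (m + \<gamma>)" by linarith+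
  moreover have "0 < g + m" "0 < g - m" using assms by linarith+
  ultimately show "0 \<le> cond_up1 g m \<gamma>" "0 \<le> cond_up0 g m \<gamma>"
    by (auto simp: cond_up1_def cond_up0_def)
qed

text \<open>Given the bit, the posterior mean is no longer a martingale, but its drift is of order
  \<open>\<gamma>\<^sup>2\<close>. Drift and squared jumps each contribute at most
  \<open>2 * \<gamma>\<^sup>2\<close>.\<close>

lemma update_mean_second_moment:
  assumes "\<bar>m\<bar> \<le> 1 / 4" "0 \<le> \<gamma>" "\<gamma> \<le> 1 / 8"
  shows "qprob b \<gamma> * (update_mean m \<gamma>)\<^sup>2 + (1 - qprob b \<gamma>) * (update_mean m (- \<gamma>))\<^sup>2 \<le> m\<^sup>2 + 4 * \<gamma>\<^sup>2"
proof -
  define s where "s = pm_sign b"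
  define A B where "A = 1 + m * \<gamma>" and "B = 1 - m * \<gamma>"
  define p where "p = qprob b \<gamma>"
  define e where "e = \<gamma> * (1 - m\<^sup>2)"
  have "\<bar>m * \<gamma>\<bar> \<le> (1 / 4) * (1 / 8)" unfolding abs_mult using assms by (intro mult_mono) auto
  then have AB: "3 / 4 \<le> A" "3 / 4 \<le> B" by (auto simp: A_def B_def)
  have m2: "0 \<le> 1 - m\<^sup>2" "1 - m\<^sup>2 \<le> 1"
    using assms by (auto simp: abs_square_le_1)
  have e: "0 \<le> e" "e \<le> \<gamma>" using assms m2 by (auto simp: e_def mult_left_le)
  have p: "0 \<le> p" "p \<le> 1" using qprob_bounds assms by (auto simp: p_def)
  have u: "update_mean m \<gamma> = m + e / A" "update_mean m (- \<gamma>) = m - e / B"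
    using AB by (auto simp: update_mean_def e_def A_def B_def divide_simps power2_eq_square algebra_simps)
  have small: "(e / D)\<^sup>2 \<le> 2 * \<gamma>\<^sup>2" if "3 / 4 \<le> D" for D
  proof -
    have "e / D \<le> \<gamma> / (3 / 4)" using that e assms by (intro frac_le) auto
    then have "(e / D)\<^sup>2 \<le> (\<gamma> / (3 / 4))\<^sup>2" using e that by (intro power_mono) auto
    also have "\<dots> \<le> 2 * \<gamma>\<^sup>2" by (simp add: power_divide power_mult_distrib)
    finally show ?thesis .
  qed
  have drift: "p * (e / A) - (1 - p) * (e / B) = e * \<gamma> * (s - m) / (A * B)"
  proof -
    have "p * (e / A) - (1 - p) * (e / B) = e * (p * B - (1 - p) * A) / (A * B)"
      using AB by (simp add: divide_simps) (simp add: algebra_simps)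
    also have "p * B - (1 - p) * A = \<gamma> * (s - m)"
      by (simp add: p_def qprob_eq s_def A_def B_def field_simps)
    finally show ?thesis by (simp add: ac_simps)
  qed
  have "m * (e * \<gamma> * (s - m) / (A * B)) \<le> \<gamma>\<^sup>2"
  proof -
    have "\<bar>m * (e * \<gamma> * (s - m) / (A * B))\<bar> = \<bar>m\<bar> * (e * \<gamma> * \<bar>s - m\<bar> / (A * B))"
      using AB e assms by (simp add: abs_mult)
    also have "\<dots> \<le> (1 / 4) * (\<gamma> * \<gamma> * (5 / 4) / ((3 / 4) * (3 / 4)))"
      using AB e assms
      by (intro mult_mono frac_le) (auto simp: s_def pm_sign_def intro!: mult_mono)
    also have "\<dots> \<le> \<gamma>\<^sup>2" by (simp add: power2_eq_square)
    finally show ?thesis by linarith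
  qed
  moreover have "p * (e / A)\<^sup>2 + (1 - p) * (e / B)\<^sup>2 \<le> 2 * \<gamma>\<^sup>2"
    using p small AB by (intro convex_bound_le) auto
  moreover have "p * (m + e / A)\<^sup>2 + (1 - p) * (m - e / B)\<^sup>2 =
      m\<^sup>2 + 2 * (m * (e * \<gamma> * (s - m) / (A * B))) + (p * (e / A)\<^sup>2 + (1 - p) * (e / B)\<^sup>2)"
    unfolding drift[symmetric] by algebra
  ultimately show ?thesis unfolding p_def[symmetric] u by linarith
qed

text \<open>\<open>T1\<close> and \<open>T0\<close> are to be run once the endpoint is known to be
  \<open>g\<close> or \<open>- g\<close>. The term \<open>4 * m\<^sup>2\<close> is a potential: a
  small query raises it in expectation by at most \<open>16 * \<gamma>\<^sup>2\<close>, which the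
  weight \<open>w\<close> covers, and when the mean leaves the middle half of the interval it
  exceeds \<open>g\<^sup>2\<close>, the price of the endpoint of a new walk.\<close>

lemma rtree_hidden_endpoint:
  assumes g: "0 < g" "g \<le> 1 / 2"
    and PQ: "\<And>j \<gamma>. P j \<gamma> \<Longrightarrow> Q j \<gamma> \<or> j = i \<and> \<gamma> \<le> g / 4" and Q: "Q i g"
    and w: "w i g = g\<^sup>2" "\<And>\<gamma>. 0 \<le> \<gamma> \<Longrightarrow> \<gamma> \<le> g / 4 \<Longrightarrow> 16 * \<gamma>\<^sup>2 \<le> w i \<gamma>"
    and "rok P T" "\<bar>m\<bar> \<le> g / 2"
  shows "\<exists>T0 T1. rok Q T0 \<and> rok Q T1 \<and> (\<forall>x.
    end_prob g m (x i) * racc x T1 + (1 - end_prob g m (x i)) * racc x T0 = racc x T \<and>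
    end_prob g m (x i) * rcost w x T1 + (1 - end_prob g m (x i)) * rcost w x T0 \<le> 4 * m\<^sup>2 + rcost w x T)"
  using assms(7,8)
proof (induction T arbitrary: m)
  case (RLeaf b)
  then show ?case by (intro exI[of _ "RLeaf b"]) (auto simp: algebra_simps)
next
  case (RCoin p t0 t1)
  then obtain u0 u1 v0 v1 where u: "rok Q u0" "rok Q u1" "rok Q v0" "rok Q v1"
    "\<And>x. end_prob g m (x i) * racc x u1 + (1 - end_prob g m (x i)) * racc x u0 = racc x t0"
    "\<And>x. end_prob g m (x i) * rcost w x u1 + (1 - end_prob g m (x i)) * rcost w x u0 \<le> 4 * m\<^sup>2 + rcost w x t0"
    "\<And>x. end_prob g m (x i) * racc x v1 + (1 - end_prob g m (x i)) * racc x v0 = racc x t1"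
    "\<And>x. end_prob g m (x i) * rcost w x v1 + (1 - end_prob g m (x i)) * rcost w x v0 \<le> 4 * m\<^sup>2 + rcost w x t1"
    by (metis rok.simps(2))
  show ?case
  proof (rule exI[of _ "RCoin p u0 v0"], rule exI[of _ "RCoin p u1 v1"], intro conjI allI)
    fix x
    let ?h = "end_prob g m (x i)"
    have "?h * racc x (RCoin p u1 v1) + (1 - ?h) * racc x (RCoin p u0 v0) =
        p * (?h * racc x v1 + (1 - ?h) * racc x v0) + (1 - p) * (?h * racc x u1 + (1 - ?h) * racc x u0)"
      by (simp, algebra)
    then show "?h * racc x (RCoin p u1 v1) + (1 - ?h) * racc x (RCoin p u0 v0) = racc x (RCoin p t0 t1)"
      using u(5,7)[of x] by simp
    have "?h * rcost w x (RCoin p u1 v1) + (1 - ?h) * rcost w x (RCoin p u0 v0) =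
        p * (?h * rcost w x v1 + (1 - ?h) * rcost w x v0) + (1 - p) * (?h * rcost w x u1 + (1 - ?h) * rcost w x u0)"
      by (simp, algebra)
    also have "\<dots> \<le> p * (4 * m\<^sup>2 + rcost w x t1) + (1 - p) * (4 * m\<^sup>2 + rcost w x t0)"
      using u(6,8) RCoin.prems by (intro convex_comb_mono) auto
    also have "\<dots> = 4 * m\<^sup>2 + rcost w x (RCoin p t0 t1)" by (simp, algebra)
    finally show "?h * rcost w x (RCoin p u1 v1) + (1 - ?h) * rcost w x (RCoin p u0 v0)
        \<le> 4 * m\<^sup>2 + rcost w x (RCoin p t0 t1)" .
  qed (use u RCoin.prems in auto)
next
  case (RQuery j \<gamma> t0 t1)
  have ok: "rok P t0" "rok P t1" "0 \<le> \<gamma>" "\<gamma> \<le> 1" "P j \<gamma>" using RQuery.prems by auto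
  show ?case
  proof (cases "Q j \<gamma>")
    case True
    obtain u0 u1 v0 v1 where u: "rok Q u0" "rok Q u1" "rok Q v0" "rok Q v1"
      "\<And>x. end_prob g m (x i) * racc x u1 + (1 - end_prob g m (x i)) * racc x u0 = racc x t0"
      "\<And>x. end_prob g m (x i) * rcost w x u1 + (1 - end_prob g m (x i)) * rcost w x u0 \<le> 4 * m\<^sup>2 + rcost w x t0"
      "\<And>x. end_prob g m (x i) * racc x v1 + (1 - end_prob g m (x i)) * racc x v0 = racc x t1"
      "\<And>x. end_prob g m (x i) * rcost w x v1 + (1 - end_prob g m (x i)) * rcost w x v0 \<le> 4 * m\<^sup>2 + rcost w x t1"
      using RQuery.IH ok RQuery.prems(2) by metis
    show ?thesis
    proof (rule exI[of _ "RQuery j \<gamma> u0 v0"], rule exI[of _ "RQuery j \<gamma> u1 v1"], intro conjI allI)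
      fix x
      let ?h = "end_prob g m (x i)"
      define p where "p = qprob (x j) \<gamma>"
      have p: "0 \<le> p" "p \<le> 1" using qprob_bounds ok by (auto simp: p_def)
      have "?h * racc x (RQuery j \<gamma> u1 v1) + (1 - ?h) * racc x (RQuery j \<gamma> u0 v0) =
          p * (?h * racc x v1 + (1 - ?h) * racc x v0) + (1 - p) * (?h * racc x u1 + (1 - ?h) * racc x u0)"
        by (simp flip: p_def, algebra)
      then show "?h * racc x (RQuery j \<gamma> u1 v1) + (1 - ?h) * racc x (RQuery j \<gamma> u0 v0) = racc x (RQuery j \<gamma> t0 t1)"
        using u(5,7)[of x] by (simp add: p_def)
      have "?h * rcost w x (RQuery j \<gamma> u1 v1) + (1 - ?h) * rcost w x (RQuery j \<gamma> u0 v0) =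
          w j \<gamma> + (p * (?h * rcost w x v1 + (1 - ?h) * rcost w x v0) + (1 - p) * (?h * rcost w x u1 + (1 - ?h) * rcost w x u0))"
        by (simp flip: p_def, algebra)
      also have "\<dots> \<le> w j \<gamma> + (p * (4 * m\<^sup>2 + rcost w x t1) + (1 - p) * (4 * m\<^sup>2 + rcost w x t0))"
        using u(6,8) p by (intro add_left_mono convex_comb_mono) auto
      also have "\<dots> = 4 * m\<^sup>2 + rcost w x (RQuery j \<gamma> t0 t1)" by (simp flip: p_def, algebra)
      finally show "?h * rcost w x (RQuery j \<gamma> u1 v1) + (1 - ?h) * rcost w x (RQuery j \<gamma> u0 v0)
          \<le> 4 * m\<^sup>2 + rcost w x (RQuery j \<gamma> t0 t1)" .
    qed (use u ok True in auto)
  next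
    case False
    then have j: "j = i" and \<gamma>: "\<gamma> \<le> g / 4" using PQ ok by auto
    txt \<open>If the mean has left \<open>[-g/2, g/2]\<close>, the rest of the hidden walk is dropped and a new one is started.\<close>
    have child: "\<exists>T0 T1. rok Q T0 \<and> rok Q T1 \<and> (\<forall>x.
        end_prob g m' (x i) * racc x T1 + (1 - end_prob g m' (x i)) * racc x T0 = racc x t \<and>
        end_prob g m' (x i) * rcost w x T1 + (1 - end_prob g m' (x i)) * rcost w x T0 \<le> 4 * m'\<^sup>2 + rcost w x t)"
      if IH: "\<And>m. \<bar>m\<bar> \<le> g / 2 \<Longrightarrow> \<exists>T0 T1. rok Q T0 \<and> rok Q T1 \<and> (\<forall>x.
        end_prob g m (x i) * racc x T1 + (1 - end_prob g m (x i)) * racc x T0 = racc x t \<and>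
        end_prob g m (x i) * rcost w x T1 + (1 - end_prob g m (x i)) * rcost w x T0 \<le> 4 * m\<^sup>2 + rcost w x t)"
      for m' t
    proof (cases "\<bar>m'\<bar> \<le> g / 2")
      case False
      have e0: "end_prob g 0 b = qprob b g" for b
        using g by (simp add: end_prob_def qprob_eq)
      obtain u0 u1 where u: "rok Q u0" "rok Q u1"
        "\<And>x. qprob (x i) g * racc x u1 + (1 - qprob (x i) g) * racc x u0 = racc x t"
        "\<And>x. qprob (x i) g * rcost w x u1 + (1 - qprob (x i) g) * rcost w x u0 \<le> rcost w x t"
        using IH[of 0] g by (auto simp: e0)
      have "(g / 2)\<^sup>2 \<le> \<bar>m'\<bar>\<^sup>2" using False g by (intro power_mono) auto
      then have "g\<^sup>2 \<le> 4 * m'\<^sup>2" by (simp add: power_divide)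
      then have "rcost w x (RQuery i g u0 u1) \<le> 4 * m'\<^sup>2 + rcost w x t" for x
        using u(4)[of x] w(1) by simp
      moreover have "h * a + (1 - h) * a = a" for h a :: real by (simp add: algebra_simps)
      ultimately show ?thesis
        using u(1-3) g Q by (intro exI[of _ "RQuery i g u0 u1"]) (simp del: rcost.simps)
    qed (use IH in blast)
    define m0 m1 where "m0 = update_mean m (- \<gamma>)" and "m1 = update_mean m \<gamma>"
    obtain u0 u1 where u: "rok Q u0" "rok Q u1"
      "\<And>x. end_prob g m0 (x i) * racc x u1 + (1 - end_prob g m0 (x i)) * racc x u0 = racc x t0"
      "\<And>x. end_prob g m0 (x i) * rcost w x u1 + (1 - end_prob g m0 (x i)) * rcost w x u0 \<le> 4 * m0\<^sup>2 + rcost w x t0"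
      using child[of t0 m0] RQuery.IH(1) ok by metis
    obtain v0 v1 where v: "rok Q v0" "rok Q v1"
      "\<And>x. end_prob g m1 (x i) * racc x v1 + (1 - end_prob g m1 (x i)) * racc x v0 = racc x t1"
      "\<And>x. end_prob g m1 (x i) * rcost w x v1 + (1 - end_prob g m1 (x i)) * rcost w x v0 \<le> 4 * m1\<^sup>2 + rcost w x t1"
      using child[of t1 m1] RQuery.IH(2) ok by metis
    define c1 c0 where "c1 = cond_up1 g m \<gamma>" and "c0 = cond_up0 g m \<gamma>"
    have m: "\<bar>m\<bar> \<le> g / 2" "\<bar>m\<bar> < g" using RQuery.prems g by auto
    have c: "0 \<le> c1" "c1 \<le> 1" "0 \<le> c0" "c0 \<le> 1"
      using cond_up_nonneg[of g m \<gamma>] cond_up_nonneg[of g m "- \<gamma>"] cond_up_minus[of m g \<gamma>] g m \<gamma> ok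
      by (auto simp: c1_def c0_def)
    \<comment> \<open>The joint distribution of endpoint and answer, with the endpoint drawn first
      on the left and the answer drawn first on the right.\<close>
    have mix: "end_prob g m (x i) * (c1 * f v1 + (1 - c1) * f u1) +
        (1 - end_prob g m (x i)) * (c0 * f v0 + (1 - c0) * f u0) =
        qprob (x i) \<gamma> * (end_prob g m1 (x i) * f v1 + (1 - end_prob g m1 (x i)) * f v0) +
        (1 - qprob (x i) \<gamma>) * (end_prob g m0 (x i) * f u1 + (1 - end_prob g m0 (x i)) * f u0)"
      for x and f :: "rtree \<Rightarrow> real"
    proof -
      define h p h1 h0 where "h = end_prob g m (x i)" and "p = qprob (x i) \<gamma>"
        and "h1 = end_prob g m1 (x i)" and "h0 = end_prob g m0 (x i)"
      have "h * c1 = p * h1" "(1 - h) * c0 = p * (1 - h1)"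
        "h * (1 - c1) = (1 - p) * h0" "(1 - h) * (1 - c0) = (1 - p) * (1 - h0)"
        using end_prob_step1[of g m \<gamma> "x i"] end_prob_step1[of g m "- \<gamma>" "x i"]
          end_prob_step0[of g m \<gamma> "x i"] end_prob_step0[of g m "- \<gamma>" "x i"] g m \<gamma> ok
        by (auto simp: h_def p_def h1_def h0_def m1_def m0_def c1_def c0_def cond_up_minus qprob_minus)
      moreover have "h * (c1 * f v1 + (1 - c1) * f u1) + (1 - h) * (c0 * f v0 + (1 - c0) * f u0) =
          h * c1 * f v1 + h * (1 - c1) * f u1 + (1 - h) * c0 * f v0 + (1 - h) * (1 - c0) * f u0"
        by algebra
      ultimately have "h * (c1 * f v1 + (1 - c1) * f u1) + (1 - h) * (c0 * f v0 + (1 - c0) * f u0) =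
          p * h1 * f v1 + (1 - p) * h0 * f u1 + p * (1 - h1) * f v0 + (1 - p) * (1 - h0) * f u0"
        by metis
      also have "\<dots> = p * (h1 * f v1 + (1 - h1) * f v0) + (1 - p) * (h0 * f u1 + (1 - h0) * f u0)"
        by algebra
      finally show ?thesis unfolding h_def p_def h1_def h0_def .
    qed
    show ?thesis
    proof (rule exI[of _ "RCoin c0 u0 v0"], rule exI[of _ "RCoin c1 u1 v1"], intro conjI allI)
      fix x
      show "end_prob g m (x i) * racc x (RCoin c1 u1 v1) + (1 - end_prob g m (x i)) * racc x (RCoin c0 u0 v0)
          = racc x (RQuery j \<gamma> t0 t1)"
        by (simp add: mix[of x "racc x"] u v j)
      define p where "p = qprob (x i) \<gamma>"
      have p: "0 \<le> p" "p \<le> 1" using qprob_bounds ok by (auto simp: p_def)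
      have "end_prob g m (x i) * rcost w x (RCoin c1 u1 v1) + (1 - end_prob g m (x i)) * rcost w x (RCoin c0 u0 v0)
          \<le> p * (4 * m1\<^sup>2 + rcost w x t1) + (1 - p) * (4 * m0\<^sup>2 + rcost w x t0)"
        using p u(4) v(4) by (simp add: mix[of x "rcost w x"] convex_comb_mono flip: p_def)
      also have "\<dots> = 4 * (p * m1\<^sup>2 + (1 - p) * m0\<^sup>2) + (p * rcost w x t1 + (1 - p) * rcost w x t0)"
        by algebra
      also have "\<dots> \<le> 4 * (m\<^sup>2 + 4 * \<gamma>\<^sup>2) + (p * rcost w x t1 + (1 - p) * rcost w x t0)"
        using update_mean_second_moment[of m \<gamma> "x i"] m \<gamma> ok g by (simp add: p_def m1_def m0_def)
      also have "\<dots> \<le> 4 * m\<^sup>2 + rcost w x (RQuery j \<gamma> t0 t1)"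
        using w(2)[of \<gamma>] ok \<gamma> j by (simp add: p_def)
      finally show "end_prob g m (x i) * rcost w x (RCoin c1 u1 v1) + (1 - end_prob g m (x i)) * rcost w x (RCoin c0 u0 v0)
          \<le> 4 * m\<^sup>2 + rcost w x (RQuery j \<gamma> t0 t1)" .
    qed (use u v c in auto)
  qed
qed

text \<open>Bits are treated one at a time, from \<open>k - 1\<close> down. The first walk for a bit
  starts at mean 0, with no potential to pay for its endpoint; this is the additive
  \<open>g\<^sup>2\<close> per bit. Small queries to bits not yet treated pass into both endpoint
  trees and keep their weight \<open>16 * \<gamma>\<^sup>2\<close>.\<close>

lemma rtree_eliminate_small_queries:
  assumes g: "0 < g" "g \<le> 1 / 2" and w: "w = (\<lambda>_ \<gamma>. if \<gamma> \<le> g / 4 then 16 * \<gamma>\<^sup>2 else \<gamma>\<^sup>2)" and "k \<le> n"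
    and "rok (\<lambda>j \<gamma>. j < n \<and> (\<gamma> = g \<or> \<gamma> = 1 \<or> \<gamma> \<le> g / 4 \<and> j < k)) T"
  shows "\<exists>T'. rok (\<lambda>j \<gamma>. j < n \<and> (\<gamma> = g \<or> \<gamma> = 1)) T' \<and>
    (\<forall>x. racc x T' = racc x T \<and> rcost w x T' \<le> real k * g\<^sup>2 + rcost w x T)"
  using assms(4,5)
proof (induction k arbitrary: T)
  case 0
  then show ?case by (intro exI[of _ T]) auto
next
  case (Suc k)
  let ?Q = "\<lambda>j \<gamma>. j < n \<and> (\<gamma> = g \<or> \<gamma> = 1 \<or> \<gamma> \<le> g / 4 \<and> j < k)"
  have "\<exists>T0 T1. rok ?Q T0 \<and> rok ?Q T1 \<and> (\<forall>x.
    end_prob g 0 (x k) * racc x T1 + (1 - end_prob g 0 (x k)) * racc x T0 = racc x T \<and>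
    end_prob g 0 (x k) * rcost w x T1 + (1 - end_prob g 0 (x k)) * rcost w x T0 \<le> 4 * 0\<^sup>2 + rcost w x T)"
    by (rule rtree_hidden_endpoint[OF g _ _ _ _ Suc.prems(2)]) (use g Suc.prems(1) in \<open>auto simp: w less_Suc_eq\<close>)
  moreover have "end_prob g 0 b = qprob b g" for b
    using g by (simp add: end_prob_def qprob_eq)
  ultimately obtain T0 T1 where T: "rok ?Q T0" "rok ?Q T1"
    "\<And>x. qprob (x k) g * racc x T1 + (1 - qprob (x k) g) * racc x T0 = racc x T"
    "\<And>x. qprob (x k) g * rcost w x T1 + (1 - qprob (x k) g) * rcost w x T0 \<le> rcost w x T"
    by auto
  have "rok ?Q (RQuery k g T0 T1)" using T Suc.prems g by auto
  from Suc.IH[OF _ this] Suc.prems(1) obtain T' where T':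
    "rok (\<lambda>j \<gamma>. j < n \<and> (\<gamma> = g \<or> \<gamma> = 1)) T'"
    "\<And>x. racc x T' = racc x (RQuery k g T0 T1)"
    "\<And>x. rcost w x T' \<le> real k * g\<^sup>2 + rcost w x (RQuery k g T0 T1)"
    by auto
  have "w k g = g\<^sup>2" using g by (simp add: w)
  then have "rcost w x T' \<le> real (Suc k) * g\<^sup>2 + rcost w x T" for x
    using T'(3)[of x] T(4)[of x] by (simp add: algebra_simps)
  then show ?case using T' T(3) by (intro exI[of _ T']) auto
qed

text \<open>Parameters up to \<open>g / 4\<close> go to the hidden walks at weight
  \<open>16 * \<gamma>\<^sup>2\<close>, larger ones up to 1/32 become stopped walks at
  \<open>64 * \<gamma>\<^sup>2\<close>, and above 1/32 a query with parameter 1 is affordable. The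
  last range determines the factor \<open>1024 = 32\<^sup>2\<close>.\<close>

lemma rtree_two_noise_levels:
  assumes g: "0 < g" "g \<le> 1 / 2" and "rok (\<lambda>i \<gamma>. i < n) T"
  shows "\<exists>T'. rok (\<lambda>j \<gamma>. j < n \<and> (\<gamma> = g \<or> \<gamma> = 1)) T' \<and>
    (\<forall>x. racc x T' = racc x T \<and>
         rcost (\<lambda>_ \<gamma>. \<gamma>\<^sup>2) x T' \<le> real n * g\<^sup>2 + 1024 * rcost (\<lambda>_ \<gamma>. \<gamma>\<^sup>2) x T)"
proof -
  define w where "w = (\<lambda>(_ :: nat) \<gamma>. if \<gamma> \<le> g / 4 then 16 * \<gamma>\<^sup>2 else \<gamma>\<^sup>2)"
  let ?P = "\<lambda>j \<gamma>. j < n \<and> (\<gamma> = g \<or> \<gamma> = 1 \<or> \<gamma> \<le> g / 4 \<and> j < n)"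
  have gadget: "\<exists>G. rok ?P G \<and> (\<forall>x z. x = z \<longrightarrow> racc z G = qprob (x i) \<gamma> \<and> rcost w z G \<le> 1024 * \<gamma>\<^sup>2)"
    if gi: "0 \<le> \<gamma>" "\<gamma> \<le> 1" "i < n" for i \<gamma>
  proof -
    consider "\<gamma> \<le> g / 4" | "g / 4 < \<gamma>" "\<gamma> \<le> 1 / 32" | "g / 4 < \<gamma>" "1 / 32 < \<gamma>" by linarith
    then show ?thesis
    proof cases
      case 1
      then show ?thesis using gi g
        by (intro exI[of _ "RQuery i \<gamma> (RLeaf False) (RLeaf True)"]) (auto simp: w_def)
    next
      case 2
      have "w i g = g\<^sup>2" using g by (simp add: w_def)
      with 2 obtain G where "rok ?P G" "\<forall>x. racc x G = qprob (x i) \<gamma> \<and> rcost w x G \<le> 64 * \<gamma>\<^sup>2"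
        using rtree_simulate_medium_query[of g \<gamma> ?P i w] g gi by force
      moreover have "64 * \<gamma>\<^sup>2 \<le> 1024 * \<gamma>\<^sup>2" by simp
      ultimately show ?thesis by (meson order_trans)
    next
      case 3
      define G where "G = RQuery i 1 (rflip ((1 - \<gamma>) / 2)) (rflip ((1 + \<gamma>) / 2))"
      have "(1 / 32)\<^sup>2 \<le> \<gamma>\<^sup>2" using 3 by (intro power_mono) auto
      then have "1 \<le> 1024 * \<gamma>\<^sup>2" by (simp add: power_divide)
      then have "rcost w x G \<le> 1024 * \<gamma>\<^sup>2" for x using g by (simp add: G_def w_def)
      moreover have "racc x G = qprob (x i) \<gamma>" for x by (simp add: G_def qprob_def)
      moreover have "rok ?P G" using gi by (simp add: G_def)
      ultimately show ?thesis by blast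
    qed
  qed
  have "\<exists>T'. rok ?P T' \<and> (\<forall>x z. x = z \<longrightarrow> racc z T' = racc x T \<and> rcost w z T' \<le> rcost (\<lambda>_ \<gamma>. 1024 * \<gamma>\<^sup>2) x T)"
    by (rule rtree_replace_queries[OF assms(3) gadget])
  then obtain T1 where T1: "rok ?P T1" "\<And>x. racc x T1 = racc x T"
    "\<And>x. rcost w x T1 \<le> rcost (\<lambda>_ \<gamma>. 1024 * \<gamma>\<^sup>2) x T"
    by auto
  obtain T2 where T2: "rok (\<lambda>j \<gamma>. j < n \<and> (\<gamma> = g \<or> \<gamma> = 1)) T2" "\<And>x. racc x T2 = racc x T1"
    "\<And>x. rcost w x T2 \<le> real n * g\<^sup>2 + rcost w x T1"
    using rtree_eliminate_small_queries[OF g w_def _ T1(1)] by auto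
  have "rcost (\<lambda>_ \<gamma>. 1024 * \<gamma>\<^sup>2) x T = 1024 * rcost (\<lambda>_ \<gamma>. \<gamma>\<^sup>2) x T" for x
    by (induction T) (simp_all add: algebra_simps)
  moreover have "rcost (\<lambda>_ \<gamma>. \<gamma>\<^sup>2) x T2 = rcost w x T2" for x
    using T2(1) g by (induction T2) (auto simp: w_def)
  ultimately show ?thesis
    using T2 T1 by (intro exI[of _ T2]) (smt (verit))
qed

section \<open>Reading blocks of gap majority\<close>

text \<open>The weight for False is the complement of that for True, so that a random position of a
  block errs with the same probability for both values. For \<open>n \<ge> 4\<close> it coincides
  with the rounded-down weight of \<open>GapMaj\<close>.\<close>

definition gap_weight :: "nat \<Rightarrow> bool \<Rightarrow> nat" where
  "gap_weight n b = (let c = nat \<lceil>real n / 2 + sqrt (real n)\<rceil> in if b then c else n - c)"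

definition blk :: "nat \<Rightarrow> nat \<Rightarrow> nat set" where
  "blk n i = {i * n..<i * n + n}"

definition gap_rel :: "nat \<Rightarrow> (nat \<Rightarrow> bool) \<Rightarrow> (nat \<Rightarrow> bool) \<Rightarrow> bool" where
  "gap_rel n x z \<longleftrightarrow> (\<forall>i<n. card {q \<in> blk n i. z q} = gap_weight n (x i))"

lemma finite_blk [simp]: "finite (blk n i)" and card_blk [simp]: "card (blk n i) = n"
  by (auto simp: blk_def)

lemma blk_less: "q \<in> blk n i \<Longrightarrow> i < n \<Longrightarrow> q < n * n"
proof -
  assume "q \<in> blk n i" "i < n"
  then have "q < (i + 1) * n" by (simp add: blk_def)
  also have "\<dots> \<le> n * n" using \<open>i < n\<close> by (intro mult_le_mono1) auto
  finally show ?thesis .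
qed

lemma in_blk_iff: "0 < n \<Longrightarrow> q \<in> blk n i \<longleftrightarrow> q div n = i"
proof
  assume "0 < n" "q \<in> blk n i"
  then show "q div n = i" by (auto simp: blk_def mult.commute intro!: div_nat_eqI)
next
  assume "0 < n" "q div n = i"
  then show "q \<in> blk n i"
    using div_mult_mod_eq[of q n] mod_less_divisor[of n q] unfolding blk_def by (metis atLeastLessThan_iff
        le_add1 nat_add_left_cancel_less)
qed

lemma sqrt_le_half: "4 \<le> n \<Longrightarrow> sqrt (real n) \<le> real n / 2"
proof (rule real_le_lsqrt)
  assume "4 \<le> n"
  then have "real n * 4 \<le> real n * real n" by (intro mult_left_mono) auto
  then show "real n \<le> (real n / 2)\<^sup>2" by (simp add: power2_eq_square)
qed auto

lemma gap_weight_bounds: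
  assumes "4 \<le> n"
  shows "real n / 2 + sqrt (real n) \<le> real (gap_weight n True)"
    and "real (gap_weight n True) \<le> real n / 2 + sqrt (real n) + 1"
    and "gap_weight n b \<le> n"
    and "real (gap_weight n False) = real n - real (gap_weight n True)"
    and "int (gap_weight n True) = \<lceil>real n / 2 + sqrt (real n)\<rceil>"
    and "int (gap_weight n False) = \<lfloor>real n / 2 - sqrt (real n)\<rfloor>"
proof -
  let ?y = "real n / 2 + sqrt (real n)"
  have y: "0 \<le> ?y" "?y \<le> real n" using sqrt_le_half[OF assms] by auto
  have c: "0 \<le> \<lceil>?y\<rceil>" "\<lceil>?y\<rceil> \<le> int n"
    using y unfolding zero_le_ceiling ceiling_le_iff by (linarith, simp)
  have cr: "?y \<le> real_of_int \<lceil>?y\<rceil>" "real_of_int \<lceil>?y\<rceil> \<le> ?y + 1" by linarith+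
  show T: "int (gap_weight n True) = \<lceil>?y\<rceil>" using c by (simp add: gap_weight_def)
  then have Tr: "real (gap_weight n True) = real_of_int \<lceil>?y\<rceil>" by (metis of_int_of_nat_eq)
  show "?y \<le> real (gap_weight n True)" "real (gap_weight n True) \<le> ?y + 1"
    using cr Tr by auto
  have le: "gap_weight n True \<le> n" using T c by linarith
  show "gap_weight n b \<le> n" using le by (cases b) (auto simp: gap_weight_def)
  have F: "gap_weight n False = n - gap_weight n True" by (simp add: gap_weight_def)
  then show "real (gap_weight n False) = real n - real (gap_weight n True)" using le by (simp add: of_nat_diff)
  have "real n / 2 - sqrt (real n) = of_int (int n) + - ?y" by (simp add: field_simps)
  then have "\<lfloor>real n / 2 - sqrt (real n)\<rfloor> = int n - \<lceil>?y\<rceil>"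
    by (simp only: floor_add_int[symmetric] floor_minus add.commute[of "of_int (int n)"])
  then show "int (gap_weight n False) = \<lfloor>real n / 2 - sqrt (real n)\<rfloor>" using F T le by linarith
qed

lemma GapMaj_eq_Some_iff:
  assumes "4 \<le> n"
  shows "GapMaj n z = Some b \<longleftrightarrow> length z = n \<and> hamming_weight z = gap_weight n b"
proof -
  have "0 < sqrt (real n)" using assms by simp
  then have "real (gap_weight n False) \<noteq> real (gap_weight n True)"
    using gap_weight_bounds(1,4)[OF assms] by linarith
  then have "gap_weight n False \<noteq> gap_weight n True" by metis
  then show ?thesis
    unfolding GapMaj_def gap_weight_bounds(5,6)[OF assms, symmetric] by (cases b) auto
qed

lemma hamming_weight_block:
  assumes "length z = n * n" "i < n"
  shows "length (block n z i) = n" "hamming_weight (block n z i) = card {q \<in> blk n i. z ! q}"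
proof -
  have le: "i * n + n \<le> n * n"
    using assms(2) mult_le_mono1[of "i + 1" n n] by simp
  then show l: "length (block n z i) = n" using assms by (simp add: block_def)
  have "{q \<in> blk n i. z ! q} = (\<lambda>j. i * n + j) ` {j. j < n \<and> z ! (i * n + j)}"
  proof (intro set_eqI iffI)
    fix q assume "q \<in> {q \<in> blk n i. z ! q}"
    then show "q \<in> (\<lambda>j. i * n + j) ` {j. j < n \<and> z ! (i * n + j)}"
      by (intro image_eqI[of _ _ "q - i * n"]) (auto simp: blk_def)
  qed (auto simp: blk_def)
  moreover have "{j. j < length (block n z i) \<and> block n z i ! j} = {j. j < n \<and> z ! (i * n + j)}"
    using le assms by (auto simp: l) (auto simp: block_def)
  ultimately show "hamming_weight (block n z i) = card {q \<in> blk n i. z ! q}"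
    unfolding hamming_weight_def by (simp add: card_image)
qed

lemma partial_compose_GapMaj_eq:
  assumes "4 \<le> n" "length z = n * n" "length x = n" "gap_rel n ((!) x) ((!) z)"
  shows "partial_compose n n f (GapMaj n) z = f x"
proof -
  have "GapMaj n (block n z i) = Some (x ! i)" if "i < n" for i
    using that assms by (simp add: GapMaj_eq_Some_iff hamming_weight_block gap_rel_def)
  moreover from this have "map (\<lambda>i. the (GapMaj n (block n z i))) [0..<n] = x"
    using assms by (intro nth_equalityI) auto
  ultimately show ?thesis using assms by (auto simp: partial_compose_def)
qed

lemma partial_compose_GapMaj_dom:
  assumes "4 \<le> n" "z \<in> dom (partial_compose n n f (GapMaj n))"
  obtains x where "length z = n * n" "length x = n" "gap_rel n ((!) x) ((!) z)"
proof -
  have z: "length z = n * n" "\<forall>i<n. block n z i \<in> dom (GapMaj n)"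
    using assms(2) by (auto simp: partial_compose_def split: if_splits)
  define x where "x = map (\<lambda>i. the (GapMaj n (block n z i))) [0..<n]"
  have "GapMaj n (block n z i) = Some (x ! i)" if "i < n" for i
    using that z(2) by (auto simp: x_def dom_def)
  then have "gap_rel n ((!) x) ((!) z)"
    using assms(1) z by (simp add: gap_rel_def GapMaj_eq_Some_iff hamming_weight_block)
  moreover have "length x = n" by (simp add: x_def)
  ultimately show ?thesis using that[OF z(1)] by blast
qed

lemma rtree_read_all:
  "\<exists>T. rok (\<lambda>q \<gamma>. q \<in> set qs \<and> \<gamma> = 1) T \<and> rdepth T = length qs \<and>
    (\<forall>z. racc z T = of_bool (F (map z qs)) \<and> rcost (\<lambda>_ _. 1) z T = real (length qs))"
proof (induction qs arbitrary: F)
  case Nil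
  show ?case by (intro exI[of _ "RLeaf (F [])"]) auto
next
  case (Cons q qs)
  obtain T0 where T0: "rok (\<lambda>q \<gamma>. q \<in> set qs \<and> \<gamma> = 1) T0" "rdepth T0 = length qs"
    "\<And>z. racc z T0 = of_bool (F (False # map z qs))" "\<And>z. rcost (\<lambda>_ _. 1) z T0 = real (length qs)"
    using Cons.IH[of "\<lambda>zs. F (False # zs)"] by auto
  obtain T1 where T1: "rok (\<lambda>q \<gamma>. q \<in> set qs \<and> \<gamma> = 1) T1" "rdepth T1 = length qs"
    "\<And>z. racc z T1 = of_bool (F (True # map z qs))" "\<And>z. rcost (\<lambda>_ _. 1) z T1 = real (length qs)"
    using Cons.IH[of "\<lambda>zs. F (True # zs)"] by auto
  have "rok (\<lambda>p \<gamma>. p \<in> set (q # qs) \<and> \<gamma> = 1) (RQuery q 1 T0 T1)"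
    using rok_mono[OF T0(1)] rok_mono[OF T1(1)] by auto
  then show ?case
    using T0(2-) T1(2-) by (intro exI[of _ "RQuery q 1 T0 T1"]) (auto simp: of_bool_def)
qed

text \<open>A random position shows the bit with a parameter \<beta> of at least
  \<open>2 * g\<close>, whatever the rounding of the weight; mixing with a fair coin lowers it to
  exactly \<open>g\<close>. The gadgets make at most \<open>n * \<gamma>\<^sup>2\<close> queries on
  average: one for \<open>\<gamma> = g\<close>, and \<open>n\<close> for
  \<open>\<gamma> = 1\<close>.\<close>

lemma rtree_query_gap_blocks:
  assumes n: "4 \<le> n" and T: "rok (\<lambda>j \<gamma>. j < n \<and> (\<gamma> = 1 / sqrt (real n) \<or> \<gamma> = 1)) T"
  shows "\<exists>T'. rok (\<lambda>q \<gamma>. q < n * n \<and> \<gamma> = 1) T' \<and>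
    (\<forall>x z. gap_rel n x z \<longrightarrow> racc z T' = racc x T \<and>
       rcost (\<lambda>_ _. 1) z T' \<le> rcost (\<lambda>_ \<gamma>. real n * \<gamma>\<^sup>2) x T)"
proof (rule rtree_replace_queries[OF T])
  fix i \<gamma> assume "0 \<le> \<gamma>" "\<gamma> \<le> 1" and i: "i < n \<and> (\<gamma> = 1 / sqrt (real n) \<or> \<gamma> = 1)"
  show "\<exists>G. rok (\<lambda>q \<gamma>. q < n * n \<and> \<gamma> = 1) G \<and> (\<forall>x z. gap_rel n x z \<longrightarrow>
      racc z G = qprob (x i) \<gamma> \<and> rcost (\<lambda>_ _. 1) z G \<le> real n * \<gamma>\<^sup>2)"
  proof (cases "\<gamma> = 1")
    case True
    obtain G where G: "rok (\<lambda>q \<gamma>. q \<in> set [i * n..<i * n + n] \<and> \<gamma> = 1) G"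
      "\<And>z. racc z G = of_bool (length (filter id (map z [i * n..<i * n + n])) = gap_weight n True)"
      "\<And>z. rcost (\<lambda>_ _. 1) z G = real n"
      using rtree_read_all[of "[i * n..<i * n + n]" "\<lambda>zs. length (filter id zs) = gap_weight n True"]
      by auto
    have "gap_weight n False \<noteq> gap_weight n True"
    proof -
      have "0 < sqrt (real n)" using n by simp
      then have "real (gap_weight n False) \<noteq> real (gap_weight n True)"
        using gap_weight_bounds(1,4)[OF n] by linarith
      then show ?thesis by metis
    qed
    moreover have "length (filter id (map z [i * n..<i * n + n])) = card {q \<in> blk n i. z q}" for z
    proof -
      have "length (filter id (map z [i * n..<i * n + n])) = card (set (filter z [i * n..<i * n + n]))"
        by (subst distinct_card) (auto simp: filter_map)
      also have "set (filter z [i * n..<i * n + n]) = {q \<in> blk n i. z q}" by (auto simp: blk_def)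
      finally show ?thesis .
    qed
    ultimately have "racc z G = of_bool (x i)" if "gap_rel n x z" for x z
      using that i by (cases "x i") (auto simp: G(2) gap_rel_def)
    moreover have "rok (\<lambda>q \<gamma>. q < n * n \<and> \<gamma> = 1) G"
      using rok_mono[OF G(1)] blk_less i by (simp add: blk_def)
    ultimately show ?thesis using G(3) True by auto
  next
    case False
    define g where "g = 1 / sqrt (real n)"
    have g: "\<gamma> = g" using False i by (auto simp: g_def)
    have sn: "2 \<le> sqrt (real n)" using n by (intro real_le_rsqrt) auto
    have ng: "real n * g\<^sup>2 = 1" using n by (simp add: g_def power_divide)
    define \<beta> where "\<beta> = 2 * real (gap_weight n True) / real n - 1"
    have "2 * (real n / 2 + sqrt (real n)) / real n - 1 \<le> \<beta>"
      unfolding \<beta>_def using gap_weight_bounds(1)[OF n] by (intro diff_right_mono divide_right_mono mult_left_mono) auto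
    moreover have "2 * (real n / 2 + sqrt (real n)) / real n - 1 = 2 * g"
      using n by (simp add: g_def field_simps)
    ultimately have \<beta>: "2 * g \<le> \<beta>" by simp
    have g0: "0 < g" using n by (simp add: g_def)
    let ?F = "\<lambda>q. RQuery q 1 (RLeaf False) (RLeaf True)"
    have "blk n i \<noteq> {}" using n by (auto simp: blk_def)
    then have "\<exists>H. rok (\<lambda>q \<gamma>. q < n * n \<and> \<gamma> = 1) H \<and>
      (\<forall>x. sum (\<lambda>_. 1) (blk n i) * racc x H = (\<Sum>q\<in>blk n i. 1 * racc x (?F q))) \<and>
      (\<forall>w x. sum (\<lambda>_. 1) (blk n i) * rcost w x H = (\<Sum>q\<in>blk n i. 1 * rcost w x (?F q)))"
      using blk_less i by (intro rtree_mixture) auto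
    then obtain H where H: "rok (\<lambda>q \<gamma>. q < n * n \<and> \<gamma> = 1) H"
      "\<And>z. real n * racc z H = real (card (blk n i \<inter> {q. z q}))"
      "\<And>w z. real n * rcost w z H = (\<Sum>q\<in>blk n i. w q 1)"
      by auto
    have accH: "racc z H = qprob (x i) \<beta>" if "gap_rel n x z" for x z
    proof -
      have "blk n i \<inter> {q. z q} = {q \<in> blk n i. z q}" by auto
      then have "real n * racc z H = real (gap_weight n (x i))"
        using that i by (simp add: H(2) gap_rel_def)
      then have "racc z H = real (gap_weight n (x i)) / real n"
        using n by (simp add: field_simps)
      also have "\<dots> = qprob (x i) \<beta>"
        using n gap_weight_bounds(4)[OF n] by (cases "x i") (auto simp: qprob_def \<beta>_def field_simps)
      finally show ?thesis .
    qed
    define G where "G = RCoin (g / \<beta>) (rflip (1 / 2)) H"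
    have gb: "0 \<le> g / \<beta>" "g / \<beta> \<le> 1" using \<beta> g0 by (auto simp: field_simps)
    have "rok (\<lambda>q \<gamma>. q < n * n \<and> \<gamma> = 1) G" using H(1) gb by (simp add: G_def)
    moreover have "racc z G = qprob (x i) g" if "gap_rel n x z" for x z
      using \<beta> g0 by (simp add: G_def accH[OF that] qprob_def field_simps)
    moreover have "rcost (\<lambda>_ _. 1) z G \<le> 1" for z
      using H(3)[of "\<lambda>_ _. 1" z] gb n by (simp add: G_def)
    ultimately show ?thesis using g ng by auto
  qed
qed

section \<open>Query complexities in terms of trees with coins\<close>

lemma prob_computes:
  "measure_pmf.prob p {r. Some b = Some (h r)} =
    (if b then measure_pmf.prob p {r. h r} else 1 - measure_pmf.prob p {r. h r})"
proof (cases b)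
  case False
  have "{r. \<not> h r} = UNIV - {r. h r}" by auto
  then have "measure_pmf.prob p {r. \<not> h r} = 1 - measure_pmf.prob p {r. h r}"
    using measure_pmf.prob_compl[of "{r. h r}" p] by simp
  then show ?thesis using False by (simp add: eq_commute[of False])
qed (simp add: eq_commute[of True])

lemma rand_query_complexity_le:
  assumes "rok (\<lambda>q \<gamma>. q < N \<and> \<gamma> = 1) T"
    and "\<And>z. F z = Some True \<Longrightarrow> racc ((!) z) T \<ge> 2/3" "\<And>z. F z = Some False \<Longrightarrow> racc ((!) z) T \<le> 1/3"
  shows "rand_query_complexity N F \<le> rdepth T"
proof -
  obtain R where R: "rand_dtree N R" "\<forall>t\<in>set_pmf R. \<forall>x. dtree_queries x t \<le> rdepth T"
    "\<And>x. measure_pmf.prob R {t. dtree_output x t} = racc ((!) x) T"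
    using rand_dtree_of_rtree[OF assms(1)] by auto
  have "rand_computes R F (1/3)"
    unfolding rand_computes_def
  proof
    fix z assume "z \<in> dom F"
    then obtain b where b: "F z = Some b" by auto
    show "1 - 1/3 \<le> measure_pmf.prob R {t. F z = Some (dtree_output z t)}"
      unfolding b prob_computes R(3) using assms(2,3)[of z] b by (cases b) auto
  qed
  then show ?thesis using R unfolding rand_query_complexity_def by (intro Least_le) blast
qed

text \<open>The tree that reads all \<open>N\<close> bits shows that some depth is admissible, so
  that \<open>LEAST\<close> really denotes an attained minimum.\<close>

lemma rand_query_complexity_attained:
  assumes "partial_bool_fun N F"
  obtains R where "rand_dtree N R" "rand_computes R F (1/3)"
    "\<And>t x. t \<in> set_pmf R \<Longrightarrow> length x = N \<Longrightarrow> dtree_queries x t \<le> rand_query_complexity N F"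
    "rand_query_complexity N F \<le> N"
proof -
  let ?ex = "\<lambda>d. \<exists>R. rand_dtree N R \<and> rand_computes R F (1/3) \<and>
       (\<forall>t \<in> set_pmf R. \<forall>x. length x = N \<longrightarrow> dtree_queries x t \<le> d)"
  obtain T where T: "rok (\<lambda>q \<gamma>. q \<in> set [0..<N] \<and> \<gamma> = 1) T" "rdepth T = N"
    "\<And>z. racc z T = of_bool (F (map z [0..<N]) = Some True)"
    using rtree_read_all[of "[0..<N]" "\<lambda>z. F z = Some True"] by auto
  have T1: "rok (\<lambda>q \<gamma>. q < N \<and> \<gamma> = 1) T" using T(1) by simp
  obtain R where R: "rand_dtree N R" "\<forall>t\<in>set_pmf R. \<forall>x. dtree_queries x t \<le> rdepth T"
    "\<And>x. measure_pmf.prob R {t. dtree_output x t} = racc ((!) x) T"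
    using rand_dtree_of_rtree[OF T1] by auto
  have acc: "racc ((!) z) T = of_bool b" if "F z = Some b" for z b
  proof -
    have "length z = N" using that assms by (auto simp: partial_bool_fun_def)
    then have "map ((!) z) [0..<N] = z" using map_nth by blast
    then show ?thesis using that by (simp add: T(3))
  qed
  have "rand_computes R F (1/3)"
    unfolding rand_computes_def
  proof
    fix z assume "z \<in> dom F"
    then obtain b where b: "F z = Some b" by auto
    show "1 - 1/3 \<le> measure_pmf.prob R {t. F z = Some (dtree_output z t)}"
      unfolding b prob_computes R(3) acc[OF b] by (cases b) auto
  qed
  then have ex: "?ex N" using R T(2) by auto
  then have "?ex (rand_query_complexity N F)" unfolding rand_query_complexity_def by (rule LeastI)
  moreover have "rand_query_complexity N F \<le> N"
    unfolding rand_query_complexity_def using ex by (rule Least_le)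
  ultimately show ?thesis using that by blast
qed

lemma rand_query_complexity_rtree:
  assumes "partial_bool_fun N F"
  obtains T where "rok (\<lambda>q \<gamma>. q < N \<and> \<gamma> = 1) T"
    "\<And>z. F z = Some True \<Longrightarrow> racc ((!) z) T \<ge> 2/3" "\<And>z. F z = Some False \<Longrightarrow> racc ((!) z) T \<le> 1/3"
    "\<And>z. length z = N \<Longrightarrow> rcost (\<lambda>_ _. 1) ((!) z) T \<le> real (rand_query_complexity N F)"
proof -
  obtain R where R: "rand_dtree N R" "rand_computes R F (1/3)"
    "\<And>t x. t \<in> set_pmf R \<Longrightarrow> length x = N \<Longrightarrow> dtree_queries x t \<le> rand_query_complexity N F"
    by (rule rand_query_complexity_attained[OF assms]) blast
  obtain U where U: "rok (\<lambda>q \<gamma>. q < N \<and> \<gamma> = 1) U"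
    "\<And>x. length x = N \<Longrightarrow> measure_pmf.prob R {t. dtree_output x t} = racc ((!) x) U"
    "\<And>x. length x = N \<Longrightarrow> rcost (\<lambda>_ _. 1) ((!) x) U \<le> real (rand_query_complexity N F)"
    using rtree_of_rand_dtree[OF R(1), of "rand_query_complexity N F"] R(3) by blast
  have "(if b then racc ((!) z) U else 1 - racc ((!) z) U) \<ge> 1 - 1/3" if "F z = Some b" for z b
  proof -
    have "length z = N" using that assms by (auto simp: partial_bool_fun_def)
    have "1 - 1/3 \<le> measure_pmf.prob R {t. F z = Some (dtree_output z t)}"
      using R(2) that unfolding rand_computes_def by blast
    then show ?thesis unfolding that prob_computes U(2)[OF \<open>length z = N\<close>] .
  qed
  from this[of _ True] this[of _ False] show ?thesis using that[OF U(1) _ _ U(3)] by force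
qed

lemma noisy_computes_acc:
  assumes "noisy_computes R f (1/3)" "f x = Some b"
  shows "b \<Longrightarrow> measure_pmf.prob (noisy_run R x) {r. fst r} \<ge> 2/3"
    and "\<not> b \<Longrightarrow> measure_pmf.prob (noisy_run R x) {r. fst r} \<le> 1/3"
proof -
  have "1 - 1/3 \<le> measure_pmf.prob (noisy_run R x) {r. f x = Some (fst r)}"
    using assms unfolding noisy_computes_def by blast
  then show "b \<Longrightarrow> measure_pmf.prob (noisy_run R x) {r. fst r} \<ge> 2/3"
    "\<not> b \<Longrightarrow> measure_pmf.prob (noisy_run R x) {r. fst r} \<le> 1/3"
    unfolding assms(2) prob_computes by (auto split: if_splits)
qed

lemma noisy_cost_ge_of_nonconstant:
  assumes "noisy_alg n R" "noisy_computes R f (1/3)" "f x = Some True" "f y = Some False"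
    and "noisy_cost R x \<le> c" "noisy_cost R y \<le> c"
  shows "1 / 18 \<le> c"
proof -
  obtain T where T: "rok (\<lambda>i \<gamma>. i < n) T"
    "\<And>x. measure_pmf.prob (noisy_run R x) {r. fst r} = racc ((!) x) T"
    "\<And>x. noisy_cost R x = rcost (\<lambda>_ \<gamma>. \<gamma>\<^sup>2) ((!) x) T"
    using rtree_of_noisy_alg[OF assms(1)] by auto
  show ?thesis
    using rcost_distinguish_ge[OF T(1), of "(!) x" "(!) y" c] noisy_computes_acc[OF assms(2,3)]
      noisy_computes_acc[OF assms(2,4)] assms(5,6) T by auto
qed

text \<open>The simulations turn cost \<open>c\<close> into at most
  \<open>n * (1 + 1024 * c)\<close> expected queries. As \<open>1 / 18 \<le> c\<close>, the additive
  1 is at most \<open>18 * c\<close>; the worst-case bound costs another factor 108, and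
  \<open>108 * 1042 = 112536\<close>.\<close>

lemma rand_query_complexity_compose_le:
  assumes n: "4 \<le> n" and R: "noisy_alg n R" "noisy_computes R f (1/3)"
    and c: "\<And>x. x \<in> dom f \<Longrightarrow> noisy_cost R x \<le> c" "1 / 18 \<le> c"
  shows "real (rand_query_complexity (n * n) (partial_compose n n f (GapMaj n))) \<le> 112536 * (real n * c)"
proof -
  let ?F = "partial_compose n n f (GapMaj n)"
  define g where "g = 1 / sqrt (real n)"
  have sn: "2 \<le> sqrt (real n)" using n by (intro real_le_rsqrt) auto
  have g: "0 < g" "g \<le> 1 / 2" using sn n by (auto simp: g_def field_simps)
  have ng: "real n * g\<^sup>2 = 1" using n by (simp add: g_def power_divide)
  obtain T where T: "rok (\<lambda>i \<gamma>. i < n) T"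
    "\<And>x. measure_pmf.prob (noisy_run R x) {r. fst r} = racc ((!) x) T"
    "\<And>x. noisy_cost R x = rcost (\<lambda>_ \<gamma>. \<gamma>\<^sup>2) ((!) x) T"
    using rtree_of_noisy_alg[OF R(1)] by auto
  obtain U where U: "rok (\<lambda>j \<gamma>. j < n \<and> (\<gamma> = g \<or> \<gamma> = 1)) U" "\<And>x. racc x U = racc x T"
    "\<And>x. rcost (\<lambda>_ \<gamma>. \<gamma>\<^sup>2) x U \<le> 1 + 1024 * rcost (\<lambda>_ \<gamma>. \<gamma>\<^sup>2) x T"
    using rtree_two_noise_levels[OF g T(1)] unfolding ng by blast
  obtain V where V: "rok (\<lambda>q \<gamma>. q < n * n \<and> \<gamma> = 1) V"
    "\<And>x z. gap_rel n x z \<Longrightarrow> racc z V = racc x U"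
    "\<And>x z. gap_rel n x z \<Longrightarrow> rcost (\<lambda>_ _. 1) z V \<le> rcost (\<lambda>_ \<gamma>. real n * \<gamma>\<^sup>2) x U"
    using rtree_query_gap_blocks[OF n U(1)[unfolded g_def]] by blast
  have scale: "rcost (\<lambda>_ \<gamma>. real n * \<gamma>\<^sup>2) x t = real n * rcost (\<lambda>_ \<gamma>. \<gamma>\<^sup>2) x t" for x t
    by (induction t) (simp_all add: algebra_simps)
  have pre: "\<exists>x. f x = Some b \<and> gap_rel n ((!) x) ((!) z)" if z: "?F z = Some b" for z b
  proof -
    have "z \<in> dom ?F" using z by auto
    then obtain x where "length z = n * n" "length x = n" "gap_rel n ((!) x) ((!) z)"
      by (rule partial_compose_GapMaj_dom[OF n])
    then show ?thesis using partial_compose_GapMaj_eq[OF n, of z x f] z by auto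
  qed
  have cost: "rcost (\<lambda>_ _. 1) z V \<le> 1042 * (real n * c)" if "z \<in> (!) ` dom ?F" for z
  proof -
    from that obtain z' b where z': "z = (!) z'" "?F z' = Some b" by auto
    obtain x where x: "f x = Some b" "gap_rel n ((!) x) z" using pre[OF z'(2)] z'(1) by auto
    have "x \<in> dom f" using x(1) by auto
    have "rcost (\<lambda>_ _. 1) z V \<le> real n * rcost (\<lambda>_ \<gamma>. \<gamma>\<^sup>2) ((!) x) U"
      using V(3)[OF x(2)] by (simp add: scale)
    also have "\<dots> \<le> real n * (1 + 1024 * rcost (\<lambda>_ \<gamma>. \<gamma>\<^sup>2) ((!) x) T)"
      using U(3) by (intro mult_left_mono) auto
    also have "\<dots> \<le> real n * (1042 * c)"
      using c(1)[OF \<open>x \<in> dom f\<close>] c(2) T(3)[of x] by (intro mult_left_mono) auto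
    finally show ?thesis by simp
  qed
  obtain W where W: "rok (\<lambda>q \<gamma>. q < n * n \<and> \<gamma> = 1) W" "real (rdepth W) \<le> 108 * (1042 * (real n * c))"
    "\<And>z. z \<in> (!) ` dom ?F \<Longrightarrow> racc z V \<ge> 2/3 \<Longrightarrow> racc z W \<ge> 2/3"
    "\<And>z. z \<in> (!) ` dom ?F \<Longrightarrow> racc z V \<le> 1/3 \<Longrightarrow> racc z W \<le> 1/3"
    using rtree_worst_case[OF V(1), of "(!) ` dom ?F", OF cost] c(2) by auto
  have accV: "(b \<longrightarrow> racc ((!) z) V \<ge> 2/3) \<and> (\<not> b \<longrightarrow> racc ((!) z) V \<le> 1/3)" if z: "?F z = Some b" for z b
  proof -
    obtain x where x: "f x = Some b" "gap_rel n ((!) x) ((!) z)" using pre[OF z] by auto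
    show ?thesis
      using noisy_computes_acc[OF R(2) x(1)] V(2)[OF x(2)] U(2) T(2)[of x] by auto
  qed
  have "rand_query_complexity (n * n) ?F \<le> rdepth W"
  proof (rule rand_query_complexity_le[OF W(1)])
    fix z assume "?F z = Some True"
    then show "racc ((!) z) W \<ge> 2/3" using accV[of z True] by (intro W(3)) auto
  next
    fix z assume "?F z = Some False"
    then show "racc ((!) z) W \<le> 1/3" using accV[of z False] by (intro W(4)) auto
  qed
  then show ?thesis using W(2) by simp
qed

section \<open>Random blocks of gap majority\<close>

text \<open>A string is encoded as the set of its positions holding 1; \<open>P\<close> and
  \<open>Q\<close> are the positions forced to hold 1 and 0. Conditioning and permuting positions
  become set operations.\<close>

definition gap_inputs :: "nat \<Rightarrow> (nat \<Rightarrow> bool) \<Rightarrow> nat set \<Rightarrow> nat set \<Rightarrow> nat set set" where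
  "gap_inputs n x P Q =
    {Z. Z \<subseteq> {..<n * n} \<and> P \<subseteq> Z \<and> Q \<inter> Z = {} \<and> (\<forall>i<n. card (Z \<inter> blk n i) = gap_weight n (x i))}"

lemma finite_gap_inputs [simp]: "finite (gap_inputs n x P Q)"
  by (rule finite_subset[of _ "Pow {..<n * n}"]) (auto simp: gap_inputs_def)

lemma gap_inputs_split:
  assumes "q \<notin> P" "q \<notin> Q"
  shows "gap_inputs n x P Q = gap_inputs n x (insert q P) Q \<union> gap_inputs n x P (insert q Q)"
    and "gap_inputs n x (insert q P) Q \<inter> gap_inputs n x P (insert q Q) = {}"
  using assms by (auto simp: gap_inputs_def)

lemma sum_gap_inputs_split:
  assumes "q \<notin> P" "q \<notin> Q"
  shows "sum h (gap_inputs n x P Q) = sum h (gap_inputs n x (insert q P) Q) + sum h (gap_inputs n x P (insert q Q))"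
  using gap_inputs_split[OF assms] by (metis finite_gap_inputs sum.union_disjoint)

text \<open>Swapping two unseen positions of one block preserves all block weights. The reverse
  inequality is the same statement with \<open>q\<close> and \<open>q'\<close> exchanged.\<close>

lemma card_gap_inputs_transpose_le:
  assumes "0 < n" "i < n" "q \<in> blk n i" "q' \<in> blk n i" "q \<notin> P \<union> Q" "q' \<notin> P \<union> Q"
  shows "card (gap_inputs n x (insert q' P) Q) \<le> card (gap_inputs n x (insert q P) Q)"
proof -
  let ?t = "Transposition.transpose q q'"
  have "(`) ?t ` gap_inputs n x (insert q' P) Q \<subseteq> gap_inputs n x (insert q P) Q"
  proof (rule image_subsetI)
    fix Z assume Z: "Z \<in> gap_inputs n x (insert q' P) Q"
    have lt: "q < n * n" "q' < n * n" using assms blk_less by auto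
    have sub: "?t ` Z \<subseteq> {..<n * n}"
      using Z lt by (auto simp: gap_inputs_def Transposition.transpose_def)
    have P: "insert q P \<subseteq> ?t ` Z"
    proof
      fix p assume "p \<in> insert q P"
      then have "?t p \<in> Z" using Z assms by (auto simp: gap_inputs_def Transposition.transpose_def)
      then show "p \<in> ?t ` Z" by (metis image_eqI transpose_involutory)
    qed
    have Q: "Q \<inter> ?t ` Z = {}"
    proof (rule ccontr)
      assume "Q \<inter> ?t ` Z \<noteq> {}"
      then obtain z where z: "z \<in> Z" "?t z \<in> Q" by auto
      then have "?t z \<noteq> q" "?t z \<noteq> q'" using assms by auto
      then have "?t z = z" by (auto simp: Transposition.transpose_def split: if_splits)
      then show False using z Z by (auto simp: gap_inputs_def)
    qed
    have "card (?t ` Z \<inter> blk n j) = gap_weight n (x j)" if "j < n" for j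
    proof -
      have "?t r \<in> blk n j \<longleftrightarrow> r \<in> blk n j" for r
        using assms by (auto simp: in_blk_iff Transposition.transpose_def)
      then have "?t ` Z \<inter> blk n j = ?t ` (Z \<inter> blk n j)" by auto
      then show ?thesis using Z that by (simp add: card_image gap_inputs_def)
    qed
    then show "?t ` Z \<in> gap_inputs n x (insert q P) Q"
      using sub P Q by (auto simp: gap_inputs_def)
  qed
  moreover have "inj_on ((`) ?t) (gap_inputs n x (insert q' P) Q)"
    by (rule inj_onI) (simp add: inj_image_eq_iff)
  ultimately show ?thesis by (intro card_inj_on_le) auto
qed

text \<open>
  Counting pairs of a string and an unseen 1 of block \<open>i\<close>; by symmetry every unseen position of
  the block occurs equally often.
\<close>

lemma card_gap_inputs_insert:
  assumes "0 < n" "i < n" "q \<in> blk n i" "q \<notin> P \<union> Q" "P \<inter> Q = {}"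
  shows "real (card (gap_inputs n x (insert q P) Q)) * (real n - real (card ((P \<union> Q) \<inter> blk n i)))
    = (real (gap_weight n (x i)) - real (card (P \<inter> blk n i))) * real (card (gap_inputs n x P Q))"
proof -
  define U where "U = blk n i - (P \<union> Q)"
  define S where "S = gap_inputs n x P Q"
  have cU: "real (card U) = real n - real (card ((P \<union> Q) \<inter> blk n i))"
  proof -
    have "card U = n - card ((P \<union> Q) \<inter> blk n i)"
      unfolding U_def by (metis card_Diff_subset_Int card_blk finite_Int finite_blk inf_commute)
    moreover have "card ((P \<union> Q) \<inter> blk n i) \<le> n"
      using card_mono[of "blk n i" "(P \<union> Q) \<inter> blk n i"] by simp
    ultimately show ?thesis by (simp add: of_nat_diff)
  qed
  have eq: "card (gap_inputs n x (insert q' P) Q) = card (gap_inputs n x (insert q P) Q)" if "q' \<in> U" for q'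
    using that assms by (intro antisym card_gap_inputs_transpose_le[of n i]) (auto simp: U_def)
  have cZ: "real (card (Z \<inter> U)) = real (gap_weight n (x i)) - real (card (P \<inter> blk n i))" if "Z \<in> S" for Z
  proof -
    have "Z \<inter> blk n i = (Z \<inter> U) \<union> (P \<inter> blk n i)" "(Z \<inter> U) \<inter> (P \<inter> blk n i) = {}"
      using that by (auto simp: S_def gap_inputs_def U_def)
    moreover have "finite (Z \<inter> U)" by (simp add: U_def)
    ultimately have "card (Z \<inter> blk n i) = card (Z \<inter> U) + card (P \<inter> blk n i)"
      by (simp add: card_Un_disjoint)
    moreover have "card (Z \<inter> blk n i) = gap_weight n (x i)"
      using that assms by (simp add: S_def gap_inputs_def)
    ultimately show ?thesis by simp
  qed
  have "(\<Sum>q'\<in>U. real (card (gap_inputs n x (insert q' P) Q))) = (\<Sum>q'\<in>U. \<Sum>Z\<in>S. of_bool (q' \<in> Z))"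
  proof (rule sum.cong[OF refl])
    fix q' assume "q' \<in> U"
    have "gap_inputs n x (insert q' P) Q = S \<inter> {Z. q' \<in> Z}" by (auto simp: S_def gap_inputs_def)
    then show "real (card (gap_inputs n x (insert q' P) Q)) = (\<Sum>Z\<in>S. of_bool (q' \<in> Z))"
      by (simp add: S_def)
  qed
  also have "\<dots> = (\<Sum>Z\<in>S. \<Sum>q'\<in>U. of_bool (q' \<in> Z))" by (rule sum.swap)
  also have "\<dots> = (\<Sum>Z\<in>S. real (card (Z \<inter> U)))"
    by (intro sum.cong refl) (simp add: U_def Int_commute)
  also have "\<dots> = (real (gap_weight n (x i)) - real (card (P \<inter> blk n i))) * real (card S)"
    by (simp add: cZ)
  finally show ?thesis by (simp add: eq cU[symmetric] S_def mult.commute)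
qed

lemma gap_inputs_nonempty:
  assumes "4 \<le> n"
  shows "gap_inputs n x {} {} \<noteq> {}"
proof -
  define Z where "Z = (\<Union>i<n. {i * n..<i * n + gap_weight n (x i)})"
  have sub: "{i * n..<i * n + gap_weight n (x i)} \<subseteq> blk n i" for i
    using gap_weight_bounds(3)[OF assms, of "x i"] by (auto simp: blk_def)
  have "card (Z \<inter> blk n j) = gap_weight n (x j)" if "j < n" for j
  proof -
    have "Z \<inter> blk n j = {j * n..<j * n + gap_weight n (x j)}"
    proof
      show "Z \<inter> blk n j \<subseteq> {j * n..<j * n + gap_weight n (x j)}"
      proof
        fix q assume q: "q \<in> Z \<inter> blk n j"
        then obtain i where i: "i < n" "q \<in> {i * n..<i * n + gap_weight n (x i)}" by (auto simp: Z_def)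
        then have "q \<in> blk n i" using subsetD[OF sub] by blast
        then have "i = j" using q assms by (simp add: in_blk_iff)
        then show "q \<in> {j * n..<j * n + gap_weight n (x j)}" using i by simp
      qed
    qed (use that sub[of j] in \<open>auto simp: Z_def\<close>)
    then show ?thesis by simp
  qed
  moreover have "Z \<subseteq> {..<n * n}" using sub blk_less by (fastforce simp: Z_def)
  ultimately have "Z \<in> gap_inputs n x {} {}" by (auto simp: gap_inputs_def)
  then show ?thesis by blast
qed

section \<open>Simulating a decision tree on random blocks at amortized cost\<close>

definition seen_credit :: "nat \<Rightarrow> (nat \<Rightarrow> bool option) \<Rightarrow> nat set \<Rightarrow> real" where
  "seen_credit n K D = 8 / real n * (\<Sum>i | i < n \<and> K i = None. real (card (D \<inter> blk n i)))"

lemma seen_credit_nonneg: "0 \<le> seen_credit n K D"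
  unfolding seen_credit_def by (intro mult_nonneg_nonneg sum_nonneg) auto

lemma seen_credit_insert:
  assumes "0 < n" "i < n" "q \<in> blk n i" "q \<notin> D"
  shows "seen_credit n K (insert q D) = seen_credit n K D + (if K i = None then 8 / real n else 0)"
proof -
  have "real (card (insert q D \<inter> blk n j)) = real (card (D \<inter> blk n j)) + of_bool (j = i)" for j
  proof (cases "j = i")
    case True
    then have "insert q D \<inter> blk n j = insert q (D \<inter> blk n j)" using assms by auto
    then show ?thesis using assms True by simp
  next
    case False
    then have "insert q D \<inter> blk n j = D \<inter> blk n j" using assms by (auto simp: in_blk_iff)
    then show ?thesis using False by simp
  qed
  then have "(\<Sum>j | j < n \<and> K j = None. real (card (insert q D \<inter> blk n j))) =
      (\<Sum>j | j < n \<and> K j = None. real (card (D \<inter> blk n j))) + (\<Sum>j | j < n \<and> K j = None. of_bool (j = i))"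
    by (simp add: sum.distrib)
  also have "(\<Sum>j | j < n \<and> K j = None. of_bool (j = i)) = (if K i = None then 1 else (0 :: real))"
    using assms by (auto simp: of_bool_def sum.If_cases Collect_conj_eq)
  finally show ?thesis by (simp add: seen_credit_def distrib_left)
qed

lemma seen_credit_update:
  assumes "i < n" "K i = None"
  shows "seen_credit n (K(i \<mapsto> b)) D = seen_credit n K D - 8 / real n * real (card (D \<inter> blk n i))"
proof -
  have "{j. j < n \<and> (K(i \<mapsto> b)) j = None} = {j. j < n \<and> K j = None} - {i}" by auto
  then show ?thesis using assms by (simp add: seen_credit_def sum_diff1 right_diff_distrib)
qed

text \<open>A coin needs a probability even in branches that no consistent string reaches. Where
  strings remain, \<open>next_prob\<close> is a genuine conditional probability and clipping changes
  nothing.\<close>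

definition clip01 :: "real \<Rightarrow> real" where
  "clip01 p = max 0 (min 1 p)"

lemma clip01_bounds: "0 \<le> clip01 p" "clip01 p \<le> 1"
  by (auto simp: clip01_def)

definition next_prob :: "nat \<Rightarrow> nat \<Rightarrow> nat set \<Rightarrow> nat set \<Rightarrow> bool \<Rightarrow> real" where
  "next_prob n i P Q b = (real (gap_weight n b) - real (card (P \<inter> blk n i))) /
     (real n - real (card ((P \<union> Q) \<inter> blk n i)))"

lemma card_seen_less:
  assumes "q \<in> blk n i" "q \<notin> D"
  shows "card (D \<inter> blk n i) < n"
  using assms psubset_card_mono[of "blk n i" "D \<inter> blk n i"] by auto

lemma card_gap_inputs_next_prob:
  assumes "0 < n" "i < n" "q \<in> blk n i" "q \<notin> P \<union> Q" "P \<inter> Q = {}"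
  shows "clip01 (next_prob n i P Q (x i)) * real (card (gap_inputs n x P Q)) =
    real (card (gap_inputs n x (insert q P) Q))"
proof -
  let ?p = "next_prob n i P Q (x i)" and ?S = "gap_inputs n x P Q" and ?S1 = "gap_inputs n x (insert q P) Q"
  have k: "real n - real (card ((P \<union> Q) \<inter> blk n i)) > 0"
    using card_seen_less[OF assms(3,4)] by simp
  then have e: "?p * real (card ?S) = real (card ?S1)"
    using card_gap_inputs_insert[OF assms, of x] by (simp add: next_prob_def field_simps)
  have "?S1 \<subseteq> ?S" by (auto simp: gap_inputs_def)
  then have le: "card ?S1 \<le> card ?S" by (intro card_mono) auto
  show ?thesis
  proof (cases "card ?S = 0")
    case True
    then show ?thesis using le by simp
  next
    case False
    then have pos: "0 < real (card ?S)" by linarith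
    have "0 * real (card ?S) \<le> ?p * real (card ?S)" "?p * real (card ?S) \<le> 1 * real (card ?S)"
      unfolding e using le by auto
    from this[THEN mult_right_le_imp_le, OF pos] have "0 \<le> ?p" "?p \<le> 1" by auto
    then show ?thesis using e by (simp add: clip01_def)
  qed
qed

text \<open>
  As long as fewer than an eighth of a block has been seen, the two conditional probabilities of a
  1 at an unseen position stay away from 0 and 1 and differ by \<open>O(1 / sqrt n)\<close>.
\<close>

lemma next_prob_noise:
  assumes n: "144 \<le> n" and k: "8 * real (card ((P \<union> Q) \<inter> blk n i)) < real n"
  defines "p \<equiv> next_prob n i P Q"
  shows "1 / 8 \<le> p False" "p False \<le> p True" "p True \<le> 7 / 8" "4 * (p True - p False) \<le> 1"
    "(4 * (p True - p False))\<^sup>2 \<le> 144 / real n"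
proof -
  define j N where "j = real (card (P \<inter> blk n i))" and "N = real n - real (card ((P \<union> Q) \<inter> blk n i))"
  define w where "w = real (gap_weight n True)"
  define r where "r = sqrt (real n)"
  have "card (P \<inter> blk n i) \<le> card ((P \<union> Q) \<inter> blk n i)" by (intro card_mono) auto
  then have j: "0 \<le> j" "8 * j < real n" using k by (auto simp: j_def)
  have N: "7 / 8 * real n \<le> N" "N \<le> real n" "0 < N" using k n by (auto simp: N_def)
  \<comment> \<open>This is the reason for 144: \<open>12 \<le> r\<close> makes \<open>r\<close>
    small against \<open>n\<close>, which keeps both probabilities between 1/8 and 7/8, and makes
    \<open>12 / r\<close> at most 1, hence a legal parameter.\<close>
  have r: "r * r = real n" "12 \<le> r" using n by (auto simp: r_def intro!: real_le_rsqrt)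
  then have r12: "12 * r \<le> real n" using mult_right_mono[of 12 r r] by simp
  have w: "real n / 2 + r \<le> w" "w \<le> real n / 2 + r + 1"
    using gap_weight_bounds(1,2)[of n] n by (auto simp: w_def r_def)
  have p: "p True = (w - j) / N" "p False = (real n - w - j) / N"
    using gap_weight_bounds(4)[of n] n by (auto simp: p_def next_prob_def w_def j_def N_def)
  have n144: "144 \<le> real n" using n by simp
  show "1 / 8 \<le> p False" unfolding p using N w j r12 n144 by (simp add: field_simps)
  show "p False \<le> p True" unfolding p using N w r by (intro divide_right_mono) auto
  show "p True \<le> 7 / 8" unfolding p using N w j r12 n144 by (simp add: field_simps)
  have diff: "p True - p False = (2 * w - real n) / N"
    unfolding p diff_divide_distrib[symmetric] by simp
  have "4 * (p True - p False) \<le> 12 / r"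
  proof -
    have "(2 * w - real n) / N \<le> (2 * r + 2) / (7 / 8 * real n)"
      using N w r n144 by (intro frac_le) auto
    also have "\<dots> \<le> 3 / r"
    proof -
      have "(2 * r + 2) * r \<le> 3 * (7 / 8 * real n)"
        using r r12 by (simp add: algebra_simps)
      then show ?thesis using r n144 by (simp add: divide_le_eq le_divide_eq field_simps)
    qed
    finally have "4 * ((2 * w - real n) / N) \<le> 4 * (3 / r)" by (rule mult_left_mono) simp
    then show ?thesis by (simp add: diff)
  qed
  moreover have "12 / r \<le> 1" using r by simp
  ultimately show "4 * (p True - p False) \<le> 1" by simp
  have "(4 * (p True - p False))\<^sup>2 \<le> (12 / r)\<^sup>2"
    using \<open>4 * (p True - p False) \<le> 12 / r\<close> \<open>p False \<le> p True\<close> by (intro power_mono) auto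
  also have "\<dots> = 144 / real n" using r by (simp add: power2_eq_square)
  finally show "(4 * (p True - p False))\<^sup>2 \<le> 144 / real n" .
qed

text \<open>
  The simulated tree is run on a uniformly random string among those that agree with the ones \<open>P\<close>
  and zeros \<open>Q\<close> seen so far; \<open>K\<close> records the input bits that are already known with certainty.
  Positions seen in the block of an unknown bit carry a credit of \<open>8 / n\<close> each, which pays for
  learning that bit once an eighth of its block has been seen.
\<close>

lemma rtree_simulate_gap_tree:
  assumes n: "4 \<le> n" and "rok (\<lambda>q \<gamma>. q < n * n \<and> \<gamma> = 1) U" "P \<inter> Q = {}"
  shows "\<exists>T. rok (\<lambda>i \<gamma>. i < n) T \<and> (\<forall>x. (\<forall>i b. K i = Some b \<longrightarrow> x i = b) \<longrightarrow>
    real (card (gap_inputs n x P Q)) * racc x T = (\<Sum>Z\<in>gap_inputs n x P Q. racc (\<lambda>q. q \<in> Z) U) \<and>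
    real (card (gap_inputs n x P Q)) * rcost (\<lambda>_ \<gamma>. \<gamma>\<^sup>2) x T \<le>
      152 / real n * (\<Sum>Z\<in>gap_inputs n x P Q. rcost (\<lambda>_ _. 1) (\<lambda>q. q \<in> Z) U) +
      seen_credit n K (P \<union> Q) * real (card (gap_inputs n x P Q)))"
  (is "\<exists>T. rok ?ok T \<and> (\<forall>x. ?cons K x \<longrightarrow> ?acc x P Q U T \<and> ?cost K x P Q U T)")
  using assms(2,3)
proof (induction U arbitrary: P Q K)
  case (RLeaf b)
  show ?case
    by (intro exI[of _ "RLeaf b"]) (simp add: seen_credit_nonneg)
next
  case (RCoin p t0 t1)
  have p: "0 \<le> p" "p \<le> 1" using RCoin.prems by auto
  obtain V0 where V0: "rok ?ok V0" "\<And>x. ?cons K x \<Longrightarrow> ?acc x P Q t0 V0 \<and> ?cost K x P Q t0 V0"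
    using RCoin.IH(1)[of P Q K] RCoin.prems by auto
  obtain V1 where V1: "rok ?ok V1" "\<And>x. ?cons K x \<Longrightarrow> ?acc x P Q t1 V1 \<and> ?cost K x P Q t1 V1"
    using RCoin.IH(2)[of P Q K] RCoin.prems by auto
  show ?case
  proof (intro exI[of _ "RCoin p V0 V1"] conjI allI impI)
    show "rok ?ok (RCoin p V0 V1)" using V0 V1 p by simp
    fix x assume x: "?cons K x"
    let ?S = "gap_inputs n x P Q"
    let ?c = "real (card ?S)"
    have "?c * racc x (RCoin p V0 V1) = p * (?c * racc x V1) + (1 - p) * (?c * racc x V0)"
      by (simp, algebra)
    also have "\<dots> = (\<Sum>Z\<in>?S. racc (\<lambda>q. q \<in> Z) (RCoin p t0 t1))"
      using V0(2)[OF x] V1(2)[OF x] by (simp add: sum.distrib sum_distrib_left)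
    finally show "?acc x P Q (RCoin p t0 t1) (RCoin p V0 V1)" .
    let ?r = "\<lambda>t. \<Sum>Z\<in>?S. rcost (\<lambda>_ _. 1) (\<lambda>q. q \<in> Z) t"
    have "?c * rcost (\<lambda>_ \<gamma>. \<gamma>\<^sup>2) x (RCoin p V0 V1) =
        p * (?c * rcost (\<lambda>_ \<gamma>. \<gamma>\<^sup>2) x V1) + (1 - p) * (?c * rcost (\<lambda>_ \<gamma>. \<gamma>\<^sup>2) x V0)"
      by (simp, algebra)
    also have "\<dots> \<le> p * (152 / real n * ?r t1 + seen_credit n K (P \<union> Q) * ?c) +
        (1 - p) * (152 / real n * ?r t0 + seen_credit n K (P \<union> Q) * ?c)"
      using V0(2)[OF x] V1(2)[OF x] p by (intro convex_comb_mono) auto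
    also have "\<dots> = 152 / real n * (p * ?r t1 + (1 - p) * ?r t0) + seen_credit n K (P \<union> Q) * ?c"
      by algebra
    also have "p * ?r t1 + (1 - p) * ?r t0 = ?r (RCoin p t0 t1)"
      by (simp add: sum.distrib sum_distrib_left)
    finally show "?cost K x P Q (RCoin p t0 t1) (RCoin p V0 V1)" .
  qed
next
  case (RQuery q \<gamma> t0 t1)
  have q: "q < n * n" "\<gamma> = 1" and ok: "rok (\<lambda>q \<gamma>. q < n * n \<and> \<gamma> = 1) t0" "rok (\<lambda>q \<gamma>. q < n * n \<and> \<gamma> = 1) t1"
    using RQuery.prems by auto
  \<comment> \<open>At a position already seen all remaining strings agree, so the simulation
    follows that branch without asking anything.\<close>
  have known: "\<exists>T. rok ?ok T \<and> (\<forall>x. ?cons K x \<longrightarrow> ?acc x P Q (RQuery q \<gamma> t0 t1) T \<and> ?cost K x P Q (RQuery q \<gamma> t0 t1) T)"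
    if V: "rok ?ok V" "\<And>x. ?cons K x \<Longrightarrow> ?acc x P Q t V \<and> ?cost K x P Q t V"
      and t: "\<And>x Z. Z \<in> gap_inputs n x P Q \<Longrightarrow> t = (if q \<in> Z then t1 else t0)" for t V
  proof (intro exI[of _ V] conjI allI impI V(1))
    fix x assume x: "?cons K x"
    let ?S = "gap_inputs n x P Q"
    have "racc (\<lambda>q. q \<in> Z) (RQuery q \<gamma> t0 t1) = racc (\<lambda>q. q \<in> Z) t"
      "rcost (\<lambda>_ _. 1) (\<lambda>q. q \<in> Z) (RQuery q \<gamma> t0 t1) = 1 + rcost (\<lambda>_ _. 1) (\<lambda>q. q \<in> Z) t" if "Z \<in> ?S" for Z
      using t[OF that] q by (auto split: if_splits)
    then have e: "(\<Sum>Z\<in>?S. racc (\<lambda>q. q \<in> Z) (RQuery q \<gamma> t0 t1)) = (\<Sum>Z\<in>?S. racc (\<lambda>q. q \<in> Z) t)"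
      "(\<Sum>Z\<in>?S. rcost (\<lambda>_ _. 1) (\<lambda>q. q \<in> Z) (RQuery q \<gamma> t0 t1)) =
        real (card ?S) + (\<Sum>Z\<in>?S. rcost (\<lambda>_ _. 1) (\<lambda>q. q \<in> Z) t)"
      by (auto simp: sum.distrib simp del: racc.simps rcost.simps)
    show "?acc x P Q (RQuery q \<gamma> t0 t1) V" unfolding e using V(2)[OF x] by auto
    show "?cost K x P Q (RQuery q \<gamma> t0 t1) V"
      unfolding e distrib_left using V(2)[OF x]
      by (intro order_trans[OF conjunct2[OF V(2)[OF x]]] add_right_mono) simp
  qed
  show ?case
  proof (cases "q \<in> P \<union> Q")
    case True
    then consider "q \<in> P" | "q \<in> Q" by auto
    then show ?thesis
    proof cases
      case 1
      then have "t1 = (if q \<in> Z then t1 else t0)" if "Z \<in> gap_inputs n x P Q" for x Z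
        using that by (auto simp: gap_inputs_def)
      moreover obtain V where "rok ?ok V" "\<And>x. ?cons K x \<Longrightarrow> ?acc x P Q t1 V \<and> ?cost K x P Q t1 V"
        using RQuery.IH(2)[OF ok(2) RQuery.prems(2), of K] by auto
      ultimately show ?thesis by (intro known[of V t1])
    next
      case 2
      then have "t0 = (if q \<in> Z then t1 else t0)" if "Z \<in> gap_inputs n x P Q" for x Z
        using that by (auto simp: gap_inputs_def)
      moreover obtain V where "rok ?ok V" "\<And>x. ?cons K x \<Longrightarrow> ?acc x P Q t0 V \<and> ?cost K x P Q t0 V"
        using RQuery.IH(1)[OF ok(1) RQuery.prems(2), of K] by auto
      ultimately show ?thesis by (intro known[of V t0])
    qed
  next
    case False
    define i where "i = q div n"
    have qi: "q \<in> blk n i" using n by (simp add: in_blk_iff i_def)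
    have i: "i < n" using q by (simp add: i_def less_mult_imp_div_less)
    have n0: "0 < n" using n by simp
    define k where "k = real (card ((P \<union> Q) \<inter> blk n i))"
    define p where "p = next_prob n i P Q"
    have disj: "P \<inter> insert q Q = {}" "insert q P \<inter> Q = {}" using False RQuery.prems(2) by auto
    \<comment> \<open>The continuation depends on the knowledge \<open>K'\<close> held after this
      query, which the cases below choose differently; hence a family of trees indexed by
      \<open>K'\<close>.\<close>
    from choice[OF allI, OF RQuery.IH(1)[OF ok(1) disj(1)]] obtain V0 where
      V0: "\<forall>K'. rok ?ok (V0 K') \<and> (\<forall>x. ?cons K' x \<longrightarrow>
        ?acc x P (insert q Q) t0 (V0 K') \<and> ?cost K' x P (insert q Q) t0 (V0 K'))" ..
    from choice[OF allI, OF RQuery.IH(2)[OF ok(2) disj(2)]] obtain V1 where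
      V1: "\<forall>K'. rok ?ok (V1 K') \<and> (\<forall>x. ?cons K' x \<longrightarrow>
        ?acc x (insert q P) Q t1 (V1 K') \<and> ?cost K' x (insert q P) Q t1 (V1 K'))" ..
    have V: "rok ?ok (V0 K')" "rok ?ok (V1 K')" for K' using V0 V1 by blast+
    have VV: "?acc x P (insert q Q) t0 (V0 K')" "?cost K' x P (insert q Q) t0 (V0 K')"
      "?acc x (insert q P) Q t1 (V1 K')" "?cost K' x (insert q P) Q t1 (V1 K')" if "?cons K' x" for K' x
    proof -
      note 0 = mp[OF spec[OF conjunct2[OF spec[OF V0, of K']], of x] that]
      note 1 = mp[OF spec[OF conjunct2[OF spec[OF V1, of K']], of x] that]
      show "?acc x P (insert q Q) t0 (V0 K')" "?cost K' x P (insert q Q) t0 (V0 K')"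
        "?acc x (insert q P) Q t1 (V1 K')" "?cost K' x (insert q P) Q t1 (V1 K')"
        by (rule conjunct1[OF 0], rule conjunct2[OF 0], rule conjunct1[OF 1], rule conjunct2[OF 1])
    qed
    \<comment> \<open>The amortized step: the actual cost \<open>e\<close> plus the new credit may
      exceed the old credit by at most \<open>152 / n\<close>. The cases below use
      \<open>e = 0\<close>, \<open>d\<^sup>2\<close> and 1; the constant is 144 for a noisy query
      plus 8 for the credit of the new position.\<close>
    have combine: "?acc x P Q (RQuery q \<gamma> t0 t1) T \<and> ?cost K x P Q (RQuery q \<gamma> t0 t1) T"
      if x: "?cons K' x"
        and T: "racc x T = clip01 (p (x i)) * racc x (V1 K') + (1 - clip01 (p (x i))) * racc x (V0 K')"
          "rcost (\<lambda>_ \<gamma>. \<gamma>\<^sup>2) x T = e + (clip01 (p (x i)) * rcost (\<lambda>_ \<gamma>. \<gamma>\<^sup>2) x (V1 K') +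
             (1 - clip01 (p (x i))) * rcost (\<lambda>_ \<gamma>. \<gamma>\<^sup>2) x (V0 K'))"
        and e: "e + seen_credit n K' (insert q (P \<union> Q)) \<le> 152 / real n + seen_credit n K (P \<union> Q)"
      for x T K' e
    proof
      let ?S = "gap_inputs n x P Q" and ?ST = "gap_inputs n x (insert q P) Q"
        and ?SF = "gap_inputs n x P (insert q Q)"
      define c c1 c0 where "c = real (card ?S)" and "c1 = real (card ?ST)" and "c0 = real (card ?SF)"
      have split: "sum h ?S = sum h ?ST + sum h ?SF" for h :: "nat set \<Rightarrow> real"
        using False by (intro sum_gap_inputs_split) auto
      have c: "c = c1 + c0" using split[of "\<lambda>_. 1"] by (simp add: c_def c1_def c0_def)
      have pc: "clip01 (p (x i)) * c = c1"
        unfolding p_def c_def c1_def using False RQuery.prems(2)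
        by (intro card_gap_inputs_next_prob n0 i qi) auto
      have mix: "c * (clip01 (p (x i)) * a + (1 - clip01 (p (x i))) * b) = c1 * a + c0 * b" for a b
      proof -
        have "c * (clip01 (p (x i)) * a + (1 - clip01 (p (x i))) * b) =
            clip01 (p (x i)) * c * a + (c - clip01 (p (x i)) * c) * b"
          by (simp add: algebra_simps)
        then show ?thesis unfolding pc by (simp add: c)
      qed
      have ev: "racc (\<lambda>q. q \<in> Z) (RQuery q \<gamma> t0 t1) = racc (\<lambda>q. q \<in> Z) t1"
        "rcost (\<lambda>_ _. 1) (\<lambda>q. q \<in> Z) (RQuery q \<gamma> t0 t1) = 1 + rcost (\<lambda>_ _. 1) (\<lambda>q. q \<in> Z) t1"
        if "Z \<in> ?ST" for Z
        using that q by (auto simp: gap_inputs_def)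
      have ev0: "racc (\<lambda>q. q \<in> Z) (RQuery q \<gamma> t0 t1) = racc (\<lambda>q. q \<in> Z) t0"
        "rcost (\<lambda>_ _. 1) (\<lambda>q. q \<in> Z) (RQuery q \<gamma> t0 t1) = 1 + rcost (\<lambda>_ _. 1) (\<lambda>q. q \<in> Z) t0"
        if "Z \<in> ?SF" for Z
        using that q by (auto simp: gap_inputs_def)
      have "c * racc x T = c1 * racc x (V1 K') + c0 * racc x (V0 K')" unfolding T mix ..
      also have "\<dots> = (\<Sum>Z\<in>?ST. racc (\<lambda>q. q \<in> Z) t1) + (\<Sum>Z\<in>?SF. racc (\<lambda>q. q \<in> Z) t0)"
        using VV(1)[OF x] VV(3)[OF x] by (simp add: c1_def c0_def)
      also have "\<dots> = (\<Sum>Z\<in>?S. racc (\<lambda>q. q \<in> Z) (RQuery q \<gamma> t0 t1))"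
        unfolding split by (simp add: ev ev0 del: racc.simps)
      finally show "?acc x P Q (RQuery q \<gamma> t0 t1) T" unfolding c_def .
      let ?rT = "\<Sum>Z\<in>?ST. rcost (\<lambda>_ _. 1) (\<lambda>q. q \<in> Z) t1"
      let ?rF = "\<Sum>Z\<in>?SF. rcost (\<lambda>_ _. 1) (\<lambda>q. q \<in> Z) t0"
      let ?\<Phi> = "seen_credit n K' (insert q (P \<union> Q))"
      have "c * rcost (\<lambda>_ \<gamma>. \<gamma>\<^sup>2) x T =
          c * e + (c1 * rcost (\<lambda>_ \<gamma>. \<gamma>\<^sup>2) x (V1 K') + c0 * rcost (\<lambda>_ \<gamma>. \<gamma>\<^sup>2) x (V0 K'))"
        unfolding T distrib_left[of c e] mix ..
      also have "\<dots> \<le> c * e + ((152 / real n * ?rT + ?\<Phi> * c1) + (152 / real n * ?rF + ?\<Phi> * c0))"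
        using VV(2)[OF x] VV(4)[OF x] unfolding c1_def c0_def by (intro add_left_mono add_mono) auto
      also have "\<dots> = 152 / real n * (?rT + ?rF) + c * (e + ?\<Phi>)" unfolding c by algebra
      also have "\<dots> \<le> 152 / real n * (?rT + ?rF) + c * (152 / real n + seen_credit n K (P \<union> Q))"
        using e by (intro add_left_mono mult_left_mono) (auto simp: c_def)
      also have "\<dots> = 152 / real n * ((c1 + ?rT) + (c0 + ?rF)) + seen_credit n K (P \<union> Q) * c"
        unfolding c by algebra
      also have "(c1 + ?rT) + (c0 + ?rF) = (\<Sum>Z\<in>?S. rcost (\<lambda>_ _. 1) (\<lambda>q. q \<in> Z) (RQuery q \<gamma> t0 t1))"
        unfolding split by (simp add: ev ev0 sum.distrib c1_def c0_def del: rcost.simps)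
      finally show "?cost K x P Q (RQuery q \<gamma> t0 t1) T" unfolding c_def .
    qed
    have ins: "seen_credit n K' (insert q (P \<union> Q)) =
        seen_credit n K' (P \<union> Q) + (if K' i = None then 8 / real n else 0)" for K'
      using False qi i n0 by (intro seen_credit_insert) auto
    consider (known) b where "K i = Some b"
      | (noise) "K i = None" "144 \<le> n" "8 * k < real n"
      | (learn) "K i = None" "n < 144 \<or> real n \<le> 8 * k"
      by (cases "K i") force+
    then show ?thesis
    proof cases
      case known
      show ?thesis
      proof (intro exI[of _ "RCoin (clip01 (p b)) (V0 K) (V1 K)"] conjI[OF _ allI] impI)
        show "rok ?ok (RCoin (clip01 (p b)) (V0 K) (V1 K))" using V(1,2) clip01_bounds by simp
        fix x assume x: "?cons K x"
        then have "x i = b" using known by auto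
        then show "?acc x P Q (RQuery q \<gamma> t0 t1) (RCoin (clip01 (p b)) (V0 K) (V1 K)) \<and>
            ?cost K x P Q (RQuery q \<gamma> t0 t1) (RCoin (clip01 (p b)) (V0 K) (V1 K))"
          by (intro combine[OF x, where e = 0]) (auto simp: ins known)
      qed
    next
      case noise
      note pn = next_prob_noise[OF noise(2) noise(3)[unfolded k_def], folded p_def]
      \<comment> \<open>The two probabilities are \<open>m + d / 8\<close> and
        \<open>m - d / 8\<close>. A coin of probability \<open>m + 1/8\<close> or
        \<open>m - 1/8\<close>, chosen by an answer of mean \<open>d\<close> or \<open>- d\<close>,
        realizes exactly these; the bounds 1/8 and 7/8 make both coins legal.\<close>
      define d where "d = 4 * (p True - p False)"
      define m where "m = (p True + p False) / 2"
      define T where "T = RQuery i d (RCoin (m - 1/8) (V0 K) (V1 K)) (RCoin (m + 1/8) (V0 K) (V1 K))"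
      have d: "0 \<le> d" "d \<le> 1" "d\<^sup>2 \<le> 144 / real n" using pn by (auto simp: d_def)
      have m: "0 \<le> m - 1/8" "m + 1/8 \<le> 1" using pn(1-3) unfolding m_def by (simp_all add: field_simps)
      have clip: "clip01 (p b) = p b" for b using pn by (cases b) (auto simp: clip01_def)
      have mix: "qprob b d * ((m + 1/8) * v + (1 - (m + 1/8)) * u) +
          (1 - qprob b d) * ((m - 1/8) * v + (1 - (m - 1/8)) * u) = p b * v + (1 - p b) * u" for b u v
      proof -
        have "p b = m + (2 * qprob b d - 1) / 8" by (cases b) (auto simp: m_def qprob_def d_def field_simps)
        then show ?thesis by algebra
      qed
      show ?thesis
      proof (intro exI[of _ T] conjI[OF _ allI] impI)
        show "rok ?ok T" using V(1,2) d m i by (simp add: T_def)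
        fix x assume x: "?cons K x"
        show "?acc x P Q (RQuery q \<gamma> t0 t1) T \<and> ?cost K x P Q (RQuery q \<gamma> t0 t1) T"
        proof (rule combine[OF x, where e = "d\<^sup>2"])
          show "d\<^sup>2 + seen_credit n K (insert q (P \<union> Q)) \<le> 152 / real n + seen_credit n K (P \<union> Q)"
            using d(3) noise(1) by (simp add: ins add_divide_distrib[symmetric])
        qed (simp_all only: T_def racc.simps rcost.simps mix clip)
      qed
    next
      case learn
      define T where "T = RQuery i 1
        (RCoin (clip01 (p False)) (V0 (K(i \<mapsto> False))) (V1 (K(i \<mapsto> False))))
        (RCoin (clip01 (p True)) (V0 (K(i \<mapsto> True))) (V1 (K(i \<mapsto> True))))"
      \<comment> \<open>For \<open>n < 144\<close> the first summand alone pays for a query with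
        parameter 1; otherwise an eighth of the block has been seen and its credit does.\<close>
      have pay: "1 \<le> 144 / real n + 8 / real n * k"
      proof (cases "n < 144")
        case True
        then have "1 \<le> 144 / real n" "0 \<le> 8 / real n * k" using n by (auto simp: k_def)
        then show ?thesis by linarith
      next
        case False
        then have "1 \<le> 8 / real n * k" "0 \<le> 144 / real n" using learn(2) n by (auto simp: field_simps)
        then show ?thesis by linarith
      qed
      show ?thesis
      proof (intro exI[of _ T] conjI[OF _ allI] impI)
        show "rok ?ok T" using V(1,2) clip01_bounds i by (simp add: T_def)
        fix x assume x: "?cons K x"
        then have x': "?cons (K(i \<mapsto> x i)) x" by (auto split: if_splits)
        have T: "racc x T = clip01 (p (x i)) * racc x (V1 (K(i \<mapsto> x i))) +
            (1 - clip01 (p (x i))) * racc x (V0 (K(i \<mapsto> x i)))"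
          "rcost (\<lambda>_ \<gamma>. \<gamma>\<^sup>2) x T = 1 + (clip01 (p (x i)) * rcost (\<lambda>_ \<gamma>. \<gamma>\<^sup>2) x (V1 (K(i \<mapsto> x i))) +
            (1 - clip01 (p (x i))) * rcost (\<lambda>_ \<gamma>. \<gamma>\<^sup>2) x (V0 (K(i \<mapsto> x i))))"
          unfolding T_def by (cases "x i"; simp)+
        show "?acc x P Q (RQuery q \<gamma> t0 t1) T \<and> ?cost K x P Q (RQuery q \<gamma> t0 t1) T"
        proof (rule combine[OF x' T])
          have "seen_credit n (K(i \<mapsto> x i)) (P \<union> Q) = seen_credit n K (P \<union> Q) - 8 / real n * k"
            unfolding k_def using i learn(1) by (rule seen_credit_update)
          moreover have "144 / real n \<le> 152 / real n" by (intro divide_right_mono) auto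
          ultimately show "1 + seen_credit n (K(i \<mapsto> x i)) (insert q (P \<union> Q)) \<le>
              152 / real n + seen_credit n K (P \<union> Q)"
            using pay by (simp add: ins)
        qed
      qed
    qed
  qed
qed

section \<open>The two bounds\<close>

text \<open>Acceptance and cost of the simulation on \<open>x\<close> are averages over strings all
  of which the composed function maps to \<open>f x\<close>, so bounds valid for each string carry
  over.\<close>

lemma noisy_alg_of_compose:
  assumes n: "4 \<le> n" and f: "partial_bool_fun n f"
  obtains R where "noisy_alg n R" "noisy_computes R f (1/3)"
    "\<And>x. x \<in> dom f \<Longrightarrow> noisy_cost R x \<le>
      152 * (real (rand_query_complexity (n * n) (partial_compose n n f (GapMaj n))) / real n)"
proof -
  let ?F = "partial_compose n n f (GapMaj n)"
  have "partial_bool_fun (n * n) ?F"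
    by (auto simp: partial_bool_fun_def partial_compose_def split: if_splits)
  then obtain U where U: "rok (\<lambda>q \<gamma>. q < n * n \<and> \<gamma> = 1) U"
    "\<And>z. ?F z = Some True \<Longrightarrow> racc ((!) z) U \<ge> 2/3" "\<And>z. ?F z = Some False \<Longrightarrow> racc ((!) z) U \<le> 1/3"
    "\<And>z. length z = n * n \<Longrightarrow> rcost (\<lambda>_ _. 1) ((!) z) U \<le> real (rand_query_complexity (n * n) ?F)"
    by (rule rand_query_complexity_rtree) blast
  define d where "d = real (rand_query_complexity (n * n) ?F)"
  obtain T where T: "rok (\<lambda>i \<gamma>. i < n) T"
    "\<And>x. real (card (gap_inputs n x {} {})) * racc x T = (\<Sum>Z\<in>gap_inputs n x {} {}. racc (\<lambda>q. q \<in> Z) U)"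
    "\<And>x. real (card (gap_inputs n x {} {})) * rcost (\<lambda>_ \<gamma>. \<gamma>\<^sup>2) x T \<le>
      152 / real n * (\<Sum>Z\<in>gap_inputs n x {} {}. rcost (\<lambda>_ _. 1) (\<lambda>q. q \<in> Z) U)"
    using rtree_simulate_gap_tree[OF n U(1), of "{}" "{}" "\<lambda>_. None"] by (auto simp: seen_credit_def)
  obtain R where R: "noisy_alg n R"
    "\<And>x. measure_pmf.prob (noisy_run R x) {r. fst r} = racc ((!) x) T"
    "\<And>x. noisy_cost R x = rcost (\<lambda>_ \<gamma>. \<gamma>\<^sup>2) ((!) x) T"
    using noisy_alg_of_rtree[OF T(1)] by auto
  have main: "(b \<longrightarrow> racc ((!) x) T \<ge> 2/3) \<and> (\<not> b \<longrightarrow> racc ((!) x) T \<le> 1/3) \<and>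
      rcost (\<lambda>_ \<gamma>. \<gamma>\<^sup>2) ((!) x) T \<le> 152 * (d / real n)" if x: "f x = Some b" for x b
  proof -
    let ?S = "gap_inputs n ((!) x) {} {}"
    define c where "c = real (card ?S)"
    have c: "0 < c" using gap_inputs_nonempty[OF n, of "(!) x"] by (simp add: c_def card_gt_0_iff)
    have len: "length x = n" using x f by (auto simp: partial_bool_fun_def)
    have Z: "(b \<longrightarrow> racc (\<lambda>q. q \<in> Z) U \<ge> 2/3) \<and> (\<not> b \<longrightarrow> racc (\<lambda>q. q \<in> Z) U \<le> 1/3) \<and>
        rcost (\<lambda>_ _. 1) (\<lambda>q. q \<in> Z) U \<le> d" if "Z \<in> ?S" for Z
    proof -
      define z where "z = map (\<lambda>q. q \<in> Z) [0..<n * n]"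
      have z: "length z = n * n" "\<And>q. q < n * n \<Longrightarrow> z ! q = (q \<in> Z)" by (auto simp: z_def)
      have "gap_rel n ((!) x) ((!) z)"
        unfolding gap_rel_def
      proof (intro allI impI)
        fix i assume i: "i < n"
        then have "{q \<in> blk n i. z ! q} = Z \<inter> blk n i" using blk_less z(2) by blast
        then show "card {q \<in> blk n i. z ! q} = gap_weight n (x ! i)" using that i by (simp add: gap_inputs_def)
      qed
      then have "?F z = Some b" using partial_compose_GapMaj_eq[OF n z(1) len] x by simp
      moreover have "racc (\<lambda>q. q \<in> Z) U = racc ((!) z) U" using z(2) by (intro racc_cong[OF U(1)]) auto
      moreover have "rcost (\<lambda>_ _. 1) (\<lambda>q. q \<in> Z) U = rcost (\<lambda>_ _. 1) ((!) z) U"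
        using z(2) by (intro rcost_cong[OF U(1)]) auto
      ultimately show ?thesis using U(2,3)[of z] U(4)[OF z(1)] by (cases b) (auto simp: d_def)
    qed
    have "2/3 \<le> racc ((!) x) T" if b
    proof -
      have "(\<Sum>Z\<in>?S. 2/3) \<le> (\<Sum>Z\<in>?S. racc (\<lambda>q. q \<in> Z) U)" using Z that by (intro sum_mono) auto
      then have "c * (2/3) \<le> c * racc ((!) x) T" by (simp add: T(2) c_def)
      then show ?thesis using c by (rule mult_left_le_imp_le)
    qed
    moreover have "racc ((!) x) T \<le> 1/3" if "\<not> b"
    proof -
      have "(\<Sum>Z\<in>?S. racc (\<lambda>q. q \<in> Z) U) \<le> (\<Sum>Z\<in>?S. 1/3)" using Z that by (intro sum_mono) auto
      then have "c * racc ((!) x) T \<le> c * (1/3)" by (simp add: T(2) c_def)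
      then show ?thesis using c by (rule mult_left_le_imp_le)
    qed
    moreover have "rcost (\<lambda>_ \<gamma>. \<gamma>\<^sup>2) ((!) x) T \<le> 152 * (d / real n)"
    proof -
      have "c * rcost (\<lambda>_ \<gamma>. \<gamma>\<^sup>2) ((!) x) T \<le> 152 / real n * (\<Sum>Z\<in>?S. rcost (\<lambda>_ _. 1) (\<lambda>q. q \<in> Z) U)"
        using T(3) by (simp add: c_def)
      also have "\<dots> \<le> 152 / real n * (\<Sum>Z\<in>?S. d)" using Z by (intro mult_left_mono sum_mono) auto
      also have "\<dots> = c * (152 * (d / real n))" by (simp add: c_def)
      finally show ?thesis using c by (rule mult_left_le_imp_le)
    qed
    ultimately show ?thesis by blast
  qed
  have "noisy_computes R f (1/3)"
    unfolding noisy_computes_def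
  proof
    fix x assume "x \<in> dom f"
    then obtain b where b: "f x = Some b" by auto
    show "1 - 1/3 \<le> measure_pmf.prob (noisy_run R x) {r. f x = Some (fst r)}"
      unfolding b prob_computes R(2) using main[OF b] by (cases b) auto
  qed
  moreover have "noisy_cost R x \<le> 152 * (real (rand_query_complexity (n * n) ?F) / real n)" if "x \<in> dom f" for x
    using that main unfolding R(3) d_def by blast
  ultimately show ?thesis using that R(1) by blast
qed

lemma finite_dom_partial_bool_fun:
  assumes "partial_bool_fun n f"
  shows "finite (dom f)"
proof (rule finite_subset)
  show "dom f \<subseteq> {x. length x = n}" using assms by (simp add: partial_bool_fun_def)
  show "finite {x :: bool list. length x = n}"
    using finite_lists_length_eq[of "UNIV :: bool set" n] by simp
qed

lemma rand_query_complexity_constant: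
  assumes "\<And>x. F x \<noteq> Some (\<not> b)"
  shows "rand_query_complexity N F = 0"
proof -
  have "rand_query_complexity N F \<le> rdepth (RLeaf b)"
    using assms by (intro rand_query_complexity_le) (auto, (metis (full_types))+)
  then show ?thesis by simp
qed

lemma noisy_query_complexity_le_compose:
  assumes n: "4 \<le> n" and f: "partial_bool_fun n f"
  shows "noisy_query_complexity n f \<le>
    152 * (real (rand_query_complexity (n * n) (partial_compose n n f (GapMaj n))) / real n)"
proof -
  obtain R where R: "noisy_alg n R" "noisy_computes R f (1/3)"
    "\<And>x. x \<in> dom f \<Longrightarrow> noisy_cost R x \<le>
      152 * (real (rand_query_complexity (n * n) (partial_compose n n f (GapMaj n))) / real n)"
    by (rule noisy_alg_of_compose[OF assms]) blast
  have fin: "finite (insert 0 (noisy_cost R ` dom f))" for R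
    using finite_dom_partial_bool_fun[OF f] by simp
  have "noisy_query_complexity n f \<le> Max (insert 0 (noisy_cost R ` dom f))"
    unfolding noisy_query_complexity_def
  proof (rule cInf_lower)
    show "bdd_below {Max (insert 0 (noisy_cost R ` dom f)) |R. noisy_alg n R \<and> noisy_computes R f (1/3)}"
      by (rule bdd_belowI[of _ 0]) (use Max_ge[OF fin] in auto)
  qed (use R in auto)
  also have "\<dots> \<le> 152 * (real (rand_query_complexity (n * n) (partial_compose n n f (GapMaj n))) / real n)"
    using R(3) by (subst Max_le_iff[OF fin]) auto
  finally show ?thesis .
qed

text \<open>A lower bound on a real infimum needs a nonempty set; the algorithm obtained by
  simulation provides a member.\<close>

lemma noisy_query_complexity_greatest:
  assumes "4 \<le> n" "partial_bool_fun n f"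
    and "\<And>R c. noisy_alg n R \<Longrightarrow> noisy_computes R f (1/3) \<Longrightarrow> 0 \<le> c \<Longrightarrow>
      (\<And>x. x \<in> dom f \<Longrightarrow> noisy_cost R x \<le> c) \<Longrightarrow> a \<le> c"
  shows "a \<le> noisy_query_complexity n f"
  unfolding noisy_query_complexity_def
proof (rule cInf_greatest)
  obtain R where "noisy_alg n R" "noisy_computes R f (1/3)"
    by (rule noisy_alg_of_compose[OF assms(1,2)])
  then show "{Max (insert 0 (noisy_cost R ` dom f)) |R. noisy_alg n R \<and> noisy_computes R f (1/3)} \<noteq> {}"
    by blast
  fix c assume "c \<in> {Max (insert 0 (noisy_cost R ` dom f)) |R. noisy_alg n R \<and> noisy_computes R f (1/3)}"
  then obtain R where R: "c = Max (insert 0 (noisy_cost R ` dom f))" "noisy_alg n R" "noisy_computes R f (1/3)"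
    by auto
  have fin: "finite (insert 0 (noisy_cost R ` dom f))"
    using finite_dom_partial_bool_fun[OF assms(2)] by simp
  show "a \<le> c" unfolding R(1) using Max_ge[OF fin] by (intro assms(3)[OF R(2,3)]) auto
qed

lemma noisy_query_complexity_nonconstant:
  assumes "4 \<le> n" "partial_bool_fun n f" "f x = Some True" "f y = Some False"
  shows "1 / 18 \<le> noisy_query_complexity n f"
proof (rule noisy_query_complexity_greatest[OF assms(1,2)])
  fix R c assume "noisy_alg n R" "noisy_computes R f (1/3)" "\<And>x. x \<in> dom f \<Longrightarrow> noisy_cost R x \<le> c"
  then show "1 / 18 \<le> c" using noisy_cost_ge_of_nonconstant[OF _ _ assms(3,4)] assms(3,4) by blast
qed

lemma compose_le_noisy_query_complexity:
  assumes n: "4 \<le> n" and f: "partial_bool_fun n f"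
  shows "1 / 112536 * (real (rand_query_complexity (n * n) (partial_compose n n f (GapMaj n))) / real n)
    \<le> noisy_query_complexity n f"
proof (rule noisy_query_complexity_greatest[OF assms])
  fix R c assume R: "noisy_alg n R" "noisy_computes R f (1/3)" "\<And>x. x \<in> dom f \<Longrightarrow> noisy_cost R x \<le> c"
    and c: "0 \<le> c"
  let ?r = "rand_query_complexity (n * n) (partial_compose n n f (GapMaj n))"
  have "real ?r \<le> 112536 * (real n * c)"
  \<comment> \<open>A constant \<open>f\<close> escapes the bound 1/18, but then the composed
    function is constant as well and needs no query.\<close>
  proof (cases "\<exists>b. \<forall>x. f x \<noteq> Some (\<not> b)")
    case True
    then obtain b where "\<And>x. f x \<noteq> Some (\<not> b)" by auto
    then have "?r = 0" by (intro rand_query_complexity_constant[of _ b]) (simp add: partial_compose_def)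
    then show ?thesis using c by simp
  next
    case False
    then obtain x y where "f x = Some True" "f y = Some False" by (metis (full_types))
    then have "1 / 18 \<le> c" using noisy_cost_ge_of_nonconstant[OF R(1,2)] R(3) by blast
    then show ?thesis using rand_query_complexity_compose_le[OF n R] by blast
  qed
  then show "1 / 112536 * (real ?r / real n) \<le> c" using n by (simp add: field_simps)
qed

section \<open>Linear randomized complexity of gap majority\<close>

lemma partial_bool_fun_GapMaj: "partial_bool_fun n (GapMaj n)"
  by (auto simp: partial_bool_fun_def GapMaj_def split: if_splits)

lemma rand_query_complexity_GapMaj_le: "rand_query_complexity n (GapMaj n) \<le> n"
  by (rule rand_query_complexity_attained[OF partial_bool_fun_GapMaj])

lemma dtree_take:
  assumes "dtree_on n t"
  shows "dtree_output (take n z) t = dtree_output z t" "dtree_queries (take n z) t = dtree_queries z t"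
  using assms by (induction t) auto

lemma dtree_on_mono: "dtree_on n t \<Longrightarrow> n \<le> m \<Longrightarrow> dtree_on m t"
  by (induction t) auto

text \<open>Only the first block matters, and membership in the composed domain guarantees that this
  block lies in the domain of \<open>g\<close>; so a tree for \<open>g\<close> can be run on it as
  it is.\<close>

lemma rand_query_complexity_compose_projection_le:
  assumes "0 < n" "partial_bool_fun m g"
  shows "rand_query_complexity (n * m) (partial_compose n m (\<lambda>x. Some (x ! 0)) g) \<le> rand_query_complexity m g"
proof -
  let ?F = "partial_compose n m (\<lambda>x. Some (x ! 0)) g"
  obtain R where R: "rand_dtree m R" "rand_computes R g (1/3)"
    "\<And>t x. t \<in> set_pmf R \<Longrightarrow> length x = m \<Longrightarrow> dtree_queries x t \<le> rand_query_complexity m g"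
    by (rule rand_query_complexity_attained[OF assms(2)]) blast
  have le: "m \<le> n * m" using assms(1) by simp
  have on: "dtree_on m t" if "t \<in> set_pmf R" for t using R(1) that by (auto simp: rand_dtree_def)
  have "rand_dtree (n * m) R" using on dtree_on_mono[OF _ le] by (auto simp: rand_dtree_def)
  moreover have "rand_computes R ?F (1/3)"
    unfolding rand_computes_def
  proof
    fix z assume "z \<in> dom ?F"
    then have z: "\<forall>i<n. block m z i \<in> dom g"
      and Fz: "?F z = Some (the (g (block m z 0)))"
      using assms(1) by (auto simp: partial_compose_def split: if_splits)
    have b0: "block m z 0 = take m z" by (simp add: block_def)
    have "take m z \<in> dom g" using z assms(1) b0 by metis
    then have F: "?F z = g (take m z)" using Fz b0 by auto
    have "1 - 1/3 \<le> measure_pmf.prob R {t. g (take m z) = Some (dtree_output (take m z) t)}"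
      using R(2) \<open>take m z \<in> dom g\<close> by (auto simp: rand_computes_def)
    \<comment> \<open>Dropping the other blocks leaves a tree unaffected only if it queries
      positions below \<open>m\<close>, which is known only on the support.\<close>
    also have "\<dots> = measure_pmf.prob R ({t. g (take m z) = Some (dtree_output (take m z) t)} \<inter> set_pmf R)"
      by (simp add: measure_Int_set_pmf)
    also have "{t. g (take m z) = Some (dtree_output (take m z) t)} \<inter> set_pmf R =
        {t. ?F z = Some (dtree_output z t)} \<inter> set_pmf R"
      using on by (auto simp: F dtree_take)
    also have "measure_pmf.prob R \<dots> = measure_pmf.prob R {t. ?F z = Some (dtree_output z t)}"
      by (simp add: measure_Int_set_pmf)
    finally show "1 - 1/3 \<le> measure_pmf.prob R {t. ?F z = Some (dtree_output z t)}" .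
  qed
  moreover have "dtree_queries x t \<le> rand_query_complexity m g" if "t \<in> set_pmf R" "length x = n * m" for t x
    using R(3)[OF that(1), of "take m x"] dtree_take(2)[OF on[OF that(1)], of x] le that(2) by simp
  ultimately have "\<exists>R. rand_dtree (n * m) R \<and> rand_computes R ?F (1/3) \<and>
      (\<forall>t \<in> set_pmf R. \<forall>x. length x = n * m \<longrightarrow> dtree_queries x t \<le> rand_query_complexity m g)"
    by blast
  then show ?thesis unfolding rand_query_complexity_def[of "n * m"] by (rule Least_le)
qed

text \<open>The nonconstant function returning the first bit has noisy complexity at least 1/18,
  which the simulation bounds by 152 times the complexity over \<open>n\<close>:
  \<open>2736 = 18 * 152\<close>.\<close>

lemma rand_query_complexity_GapMaj_ge:
  assumes n: "4 \<le> n"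
  shows "real n \<le> 2736 * real (rand_query_complexity n (GapMaj n))"
proof -
  define f where "f x = (if length x = n then Some (x ! 0) else None)" for x :: "bool list"
  have f: "partial_bool_fun n f" by (auto simp: partial_bool_fun_def f_def split: if_splits)
  have F: "partial_compose n n f (GapMaj n) = partial_compose n n (\<lambda>x. Some (x ! 0)) (GapMaj n)"
    by (rule ext) (simp add: partial_compose_def f_def)
  have "1 / 18 \<le> noisy_query_complexity n f"
    by (rule noisy_query_complexity_nonconstant[OF n f, of "replicate n True" "replicate n False"])
      (use n in \<open>auto simp: f_def\<close>)
  also have "\<dots> \<le> 152 * (real (rand_query_complexity (n * n) (partial_compose n n f (GapMaj n))) / real n)"
    by (rule noisy_query_complexity_le_compose[OF n f])
  also have "\<dots> \<le> 152 * (real (rand_query_complexity n (GapMaj n)) / real n)"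
    unfolding F using rand_query_complexity_compose_projection_le[OF _ partial_bool_fun_GapMaj, of n n] n
    by (intro mult_left_mono divide_right_mono) auto
  finally show ?thesis using n by (simp add: field_simps)
qed

theorem theorem1p5:
  "(\<exists>c C :: real. 0 < c \<and> 0 < C \<and>
      (\<forall>n f. n \<ge> 4 \<longrightarrow> partial_bool_fun n f \<longrightarrow>
         c * (real (rand_query_complexity (n * n) (partial_compose n n f (GapMaj n))) / real n)
           \<le> noisy_query_complexity n f \<and>
         noisy_query_complexity n f
           \<le> C * (real (rand_query_complexity (n * n) (partial_compose n n f (GapMaj n))) / real n))) \<and>
   (\<lambda>n. real (rand_query_complexity n (GapMaj n))) \<in> \<Theta>(\<lambda>n. real n)"
proof
  show "\<exists>c C :: real. 0 < c \<and> 0 < C \<and>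
      (\<forall>n f. n \<ge> 4 \<longrightarrow> partial_bool_fun n f \<longrightarrow>
         c * (real (rand_query_complexity (n * n) (partial_compose n n f (GapMaj n))) / real n)
           \<le> noisy_query_complexity n f \<and>
         noisy_query_complexity n f
           \<le> C * (real (rand_query_complexity (n * n) (partial_compose n n f (GapMaj n))) / real n))"
    by (rule exI[of _ "1 / 112536"], rule exI[of _ 152])
      (use compose_le_noisy_query_complexity noisy_query_complexity_le_compose in simp)
  show "(\<lambda>n. real (rand_query_complexity n (GapMaj n))) \<in> \<Theta>(\<lambda>n. real n)"
  proof (rule bigthetaI)
    show "(\<lambda>n. real (rand_query_complexity n (GapMaj n))) \<in> O(\<lambda>n. real n)"
      by (rule bigoI[of _ 1]) (simp add: rand_query_complexity_GapMaj_le)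
    show "(\<lambda>n. real (rand_query_complexity n (GapMaj n))) \<in> \<Omega>(\<lambda>n. real n)"
      \<comment> \<open>For \<open>0 < n < 4\<close> the domain is empty and the complexity is 0, so
        the bound is claimed only from 4 on.\<close>
      by (rule landau_omega.bigI[of "1 / 2736"])
        (auto intro!: eventually_sequentiallyI[of 4] dest: rand_query_complexity_GapMaj_ge)
  qed
qed

end
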